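(* Let $T>0$ and $s>5/2$, and let $u\in C([0,T]:H^s(\mathbb{R}))$ be a strong solution of the initial value problem associated to the Camassa-Holm equation in integral-differential form $$\partial_t u+u\,\partial_x u+\partial_x G\ast\Big(u^2+\tfrac12(\partial_x u)^2\Big)=0,\qquad G(x)=\tfrac12 e^{-|x|},$$ with initial datum $u_0(x)=u(x,0)$, $u_0\not\equiv0$. Let $\eta(x,t)$ be the flow of $u$, i.e. $\frac{d}{dt}\eta(x,t)=u(\eta(x,t),t)$, $\eta(x,0)=x$, for $x\in\mathbb{R}$, $t\in[0,T]$. (a) If $u_0$ has compact support, contained in the interval $[a,b]$, then there are functions $c_+,c_-$ on $(0,T]$ such that for every $t\in(0,T]$ $$u(x,t)=\begin{cases} c_+(t)\,e^{-x}, & x>\eta(b,t),\\ c_-(t)\,e^{x}, & x<\eta(a,t).\end{cases}$$ (b) If for some $\mu>0$ $$\partial_x^j u_0(x)= O(e^{-(1+\mu)|x|})\quad\text{as } |x|\to\infty,\qquad j=0,1,2,$$ then for every $t\in(0,T]$ $$h(x,t):=(1-\partial_x^2)u(x,t)= O(e^{-(1+\mu)|x|})\quad\text{as } |x|\to\infty,$$ and there are functions $c_+,c_-$ on $(0,T]$ such that for every $t\in(0,T]$ $$\lim_{x\to+\infty}e^{x}u(x,t)=c_+(t),\qquad \lim_{x\to-\infty}e^{-x}u(x,t)=c_-(t).$$ Moreover, in both (a) and (b), $c_+$ and $c_-$ are continuous and non-vanishing, with $c_+(t)>0$ and $c_-(t)<0$ for all $t\in(0,T]$, $c_+$ is strictly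 increasing, and $c_-$ is strictly decreasing.
   Context: Functions are real-valued, $\ast$ denotes convolution in $x\in\mathbb{R}$, and $H^s(\mathbb{R})$ is the usual $L^2$-based Sobolev space. A strong solution on $[0,T]$ is a function $u\in C([0,T]:H^s(\mathbb{R}))\cap C^1([0,T]:H^{s-1}(\mathbb{R}))$ satisfying the equation for every $t\in[0,T]$ as an identity in $H^{s-1}(\mathbb{R})$. Since $s>5/2$, $u(\cdot,t)$ and its first two $x$-derivatives are continuous bounded functions, so pointwise statements make sense, and the flow $\eta$ is well defined on $\mathbb{R}\times[0,T]$. The equation is the integral-differential form of the Camassa-Holm equation $\partial_t u-\partial_t\partial_x^2u+3u\partial_xu-2\partial_xu\,\partial_x^2u-u\,\partial_x^3u=0$, obtained by inverting $1-\partial_x^2$, whose fundamental solution is $\tfrac12e^{-|x|}$. *)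

theory Defs
  imports "HOL-Analysis.Analysis" "HOL-Library.Landau_Symbols"
begin

definition square_integrable :: "(real \<Rightarrow> 'a::{real_normed_vector, second_countable_topology}) \<Rightarrow> bool" where
  "square_integrable f \<longleftrightarrow>
     f \<in> borel_measurable lborel \<and> integrable lborel (\<lambda>x. (norm (f x))\<^sup>2)"

text \<open>
  The Fourier transform on $L^2(\mathbb{R})$, as a relation (it determines \<open>g\<close> up to null sets):
  \<open>g\<close> is the $L^2$-limit, as $R \to \infty$, of $\xi \mapsto \int_{-R}^{R} e^{-ix\xi} f(x)\,dx$.
  The squared $L^2$-distance is an extended nonnegative integral, so its convergence to zero
  cannot hold merely because an integral fails to exist.
\<close>

definition fourier_L2 :: "(real \<Rightarrow> real) \<Rightarrow> (real \<Rightarrow> complex) \<Rightarrow> bool" where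
  "fourier_L2 f g \<longleftrightarrow> square_integrable f \<and> square_integrable g \<and>
     ((\<lambda>R. \<integral>\<^sup>+\<xi>. ennreal ((norm (g \<xi> -
         (LBINT x:{-R..R}. cis (- (x * \<xi>)) * complex_of_real (f x))))\<^sup>2) \<partial>lborel) \<longlongrightarrow> 0) at_top"

text \<open>
  The real-valued space $H^s(\mathbb{R})$ for $s \ge 0$, consisting of those $f \in L^2$ with
  $(1+\xi^2)^{s/2} \hat f \in L^2$.  Elements are represented by functions;
  two functions that agree almost everywhere represent the same element.
\<close>

definition sobolev :: "real \<Rightarrow> (real \<Rightarrow> real) set" where
  "sobolev s = {f. \<exists>g. fourier_L2 f g \<and>
     square_integrable (\<lambda>\<xi>. complex_of_real ((1 + \<xi>\<^sup>2) powr (s / 2)) * g \<xi>)}"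

definition sobolev_norm :: "real \<Rightarrow> (real \<Rightarrow> real) \<Rightarrow> real" where
  "sobolev_norm s f = (let g = (SOME g. fourier_L2 f g) in
     sqrt (\<integral>\<xi>. (1 + \<xi>\<^sup>2) powr s * (norm (g \<xi>))\<^sup>2 \<partial>lborel))"

text \<open>
  A function of time and space is written \<open>u t x\<close> (time first), so that \<open>u t\<close> is
  the spatial profile at time \<open>t\<close>.
\<close>

definition C0_sobolev :: "real \<Rightarrow> real \<Rightarrow> (real \<Rightarrow> real \<Rightarrow> real) \<Rightarrow> bool" where
  "C0_sobolev T s u \<longleftrightarrow> (\<forall>t\<in>{0..T}. u t \<in> sobolev s) \<and>
     (\<forall>t\<in>{0..T}. ((\<lambda>r. sobolev_norm s (\<lambda>x. u r x - u t x)) \<longlongrightarrow> 0) (at t within {0..T}))"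

text \<open>\<open>u\<close> belongs to $C^1([0,T]:H^s)$ with time derivative \<open>v\<close>.\<close>

definition C1_sobolev ::
    "real \<Rightarrow> real \<Rightarrow> (real \<Rightarrow> real \<Rightarrow> real) \<Rightarrow> (real \<Rightarrow> real \<Rightarrow> real) \<Rightarrow> bool" where
  "C1_sobolev T s u v \<longleftrightarrow> C0_sobolev T s u \<and> C0_sobolev T s v \<and>
     (\<forall>t\<in>{0..T}. ((\<lambda>r. sobolev_norm s (\<lambda>x. (u r x - u t x) / (r - t) - v t x)) \<longlongrightarrow> 0)
        (at t within {0..T}))"

definition convolution :: "(real \<Rightarrow> real) \<Rightarrow> (real \<Rightarrow> real) \<Rightarrow> real \<Rightarrow> real" where
  "convolution f g x = (\<integral>y. f (x - y) * g y \<partial>lborel)"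

definition CH_kernel :: "real \<Rightarrow> real" where
  "CH_kernel x = exp (- \<bar>x\<bar>) / 2"

text \<open>
  Each profile \<open>u t\<close> is taken to be the continuous representative of its class
  (unique, and of class $C^2$ when $s > 5/2$), which gives meaning to its pointwise values and
  derivatives.  The equation is an identity between classes of functions, hence almost everywhere
  in \<open>x\<close>; the value of \<open>deriv CH_kernel\<close> at its single point of
  non-differentiability \<open>0\<close> does not affect the convolution.
\<close>

definition CH_strong_solution :: "real \<Rightarrow> real \<Rightarrow> (real \<Rightarrow> real \<Rightarrow> real) \<Rightarrow> bool" where
  "CH_strong_solution T s u \<longleftrightarrow>
     (\<forall>t\<in>{0..T}. continuous_on UNIV (u t)) \<and>
     C0_sobolev T s u \<and>
     (\<exists>v. C1_sobolev T (s - 1) u v \<and>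
       (\<forall>t\<in>{0..T}. AE x in lborel.
          v t x + u t x * deriv (u t) x
            + convolution (deriv CH_kernel) (\<lambda>y. (u t y)\<^sup>2 + (deriv (u t) y)\<^sup>2 / 2) x = 0))"

text \<open>The flow is written \<open>\<eta> x t\<close>; at the endpoints of $[0,T]$ its time derivative is one-sided.\<close>

definition is_flow :: "real \<Rightarrow> (real \<Rightarrow> real \<Rightarrow> real) \<Rightarrow> (real \<Rightarrow> real \<Rightarrow> real) \<Rightarrow> bool" where
  "is_flow T u \<eta> \<longleftrightarrow> (\<forall>x. \<eta> x 0 = x \<and>
     (\<forall>t\<in>{0..T}. ((\<lambda>r. \<eta> x r) has_real_derivative u t (\<eta> x t)) (at t within {0..T})))"

definition signed_monotone_coeffs :: "real \<Rightarrow> (real \<Rightarrow> real) \<Rightarrow> (real \<Rightarrow> real) \<Rightarrow> bool" where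
  "signed_monotone_coeffs T cp cm \<longleftrightarrow>
     continuous_on {0<..T} cp \<and> continuous_on {0<..T} cm \<and>
     (\<forall>t\<in>{0<..T}. cp t > 0 \<and> cm t < 0) \<and>
     strict_mono_on {0<..T} cp \<and> strict_antimono_on {0<..T} cm"

end

theory Submission
  imports Defs "HOL-Probability.Characteristic_Functions" "HOL-Real_Asymp.Real_Asymp"
begin

text \<open>
  Write \<open>p = u + u\<^sub>x\<close>, so that $(e^x u)_x = e^x p$ and $h = u - u_{xx} = p - p_x$.  Everything
  rests on the evolution of \<open>p\<close> along a characteristic $x = \eta(\cdot, t)$,
  $$\frac{d}{dt}\, p = p u - \tfrac12 p^2 - \tfrac12 \int_x^\infty e^{x-y} p^2\,dy,$$
  which follows from the equations for \<open>u\<close> and \<open>u\<^sub>x\<close> because the nonlocal term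
  $\int_x^\infty e^{x-y}(u^2 + \tfrac12 u_x^2)\,dy$ equals
  $\tfrac12 u^2 + \tfrac12\int_x^\infty e^{x-y} p^2\,dy$ (\<open>exp_avg_F\<close>, \<open>lagrange_p\<close>).  Every term on
  the right contains a factor \<open>p\<close>, and only values of \<open>p\<close> at or to the right of \<open>x\<close> occur.  Hence a
  Gronwall argument for the weighted supremum of \<open>p\<close>, with any nondecreasing weight of the label of
  the characteristic, closes (\<open>weighted_gronwall\<close>).  Its weights give three conclusions: an
  indicator shows that \<open>p\<close> stays zero to the right of $\eta(b,t)$, so that $e^x u$ is constant there;
  an exponential shows that \<open>p\<close> keeps the decay $e^{-\kappa x}$ of the datum; and a constant weight,
  run backwards in time, shows that \<open>u\<close> never vanishes identically.

  Decay of \<open>p\<close> with rate $\kappa > 1$ makes $(e^x u)_x$ integrable, so $e^x u(x,t)$ has a limit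
  $c(t)$, uniformly in \<open>t\<close>; this gives continuity, and $c(0) = 0$.  At fixed \<open>x\<close> the time derivative
  of $e^x u$ is $\tfrac12\int_{-\infty}^x e^y (u^2 + \tfrac12 u_x^2)\,dy$ up to an error
  $O(e^{-(\kappa-1)x})$ (\<open>deriv_time_exp_u\<close>).  The integral is positive because \<open>u\<close> is never zero,
  hence \<open>c\<close> increases strictly and is positive for \<open>t > 0\<close>.  The decay of $p_x$, and so of the
  momentum \<open>h\<close>, is obtained from the same evolution equation applied to difference quotients of \<open>p\<close>
  between two neighbouring characteristics (\<open>p_increment_le\<close>): their distance is comparable to that
  of their labels, and the estimate survives as the labels merge.  The tail at \<open>-\<infinity>\<close> follows from
  the tail at \<open>+\<infinity>\<close> because $-u(-x,t)$ solves the same equation.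

  The pointwise calculus is justified by Sobolev embedding.  Fourier inversion
  (\<open>fourier_L2_inversion\<close>) represents elements of $H^\sigma$ by absolutely convergent integrals;
  thus \<open>u\<close> is $C^2$ in \<open>x\<close>, and the difference quotients of \<open>u\<close> and $u_x$ in time converge uniformly
  in \<open>x\<close>, which yields the derivatives along characteristics (\<open>strong_solution_lagrangian\<close>).
\<close>

section \<open>Fourier inversion for square-integrable functions\<close>

lemma square_integrable_norm_mult:
  assumes "square_integrable f" "square_integrable g"
  shows "integrable lborel (\<lambda>x. norm (f x) * norm (g x))"
proof (rule Bochner_Integration.integrable_bound)
  show "integrable lborel (\<lambda>x. (norm (f x))\<^sup>2 + (norm (g x))\<^sup>2)"
    using assms by (auto simp: square_integrable_def)
  show "(\<lambda>x. norm (f x) * norm (g x)) \<in> borel_measurable lborel"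
    using assms by (auto simp: square_integrable_def)
  show "AE x in lborel. norm (norm (f x) * norm (g x)) \<le> norm ((norm (f x))\<^sup>2 + (norm (g x))\<^sup>2)"
  proof (rule AE_I2)
    fix x :: real
    have "2 * (norm (f x) * norm (g x)) \<le> (norm (f x))\<^sup>2 + (norm (g x))\<^sup>2"
      using sum_squares_bound[of "norm (f x)" "norm (g x)"] by (simp add: mult.assoc)
    moreover have "norm (f x) * norm (g x) \<ge> 0" by simp
    ultimately show "norm (norm (f x) * norm (g x)) \<le> norm ((norm (f x))\<^sup>2 + (norm (g x))\<^sup>2)"
      unfolding real_norm_def by linarith
  qed
qed

lemma norm_add_square_le:
  fixes a b :: "'a::real_normed_vector"
  shows "(norm (a + b))\<^sup>2 \<le> 2 * (norm a)\<^sup>2 + 2 * (norm b)\<^sup>2"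
proof -
  have "(norm (a + b))\<^sup>2 \<le> (norm a + norm b)\<^sup>2"
    by (intro power_mono norm_triangle_ineq) auto
  also have "\<dots> \<le> 2 * (norm a)\<^sup>2 + 2 * (norm b)\<^sup>2"
    using sum_squares_bound[of "norm a" "norm b"] by (simp add: power2_sum)
  finally show ?thesis .
qed

lemma square_integrable_add:
  assumes "square_integrable f" "square_integrable g"
  shows "square_integrable (\<lambda>x. f x + g x)"
  unfolding square_integrable_def
proof
  show m: "(\<lambda>x. f x + g x) \<in> borel_measurable lborel"
    using assms by (auto simp: square_integrable_def)
  show "integrable lborel (\<lambda>x. (norm (f x + g x))\<^sup>2)"
  proof (rule Bochner_Integration.integrable_bound)
    show "integrable lborel (\<lambda>x. 2 * (norm (f x))\<^sup>2 + 2 * (norm (g x))\<^sup>2)"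
      using assms by (auto simp: square_integrable_def)
    show "(\<lambda>x. (norm (f x + g x))\<^sup>2) \<in> borel_measurable lborel" using m by measurable
    show "AE x in lborel. norm ((norm (f x + g x))\<^sup>2) \<le> norm (2 * (norm (f x))\<^sup>2 + 2 * (norm (g x))\<^sup>2)"
      by (rule AE_I2) (use norm_add_square_le in simp)
  qed
qed

lemma square_integrable_scaleR:
  assumes "square_integrable f"
  shows "square_integrable (\<lambda>x. c *\<^sub>R f x)"
  using assms by (auto simp: square_integrable_def power_mult_distrib)

lemma square_integrable_cong_AE:
  assumes "square_integrable f" "AE x in lborel. f x = g x" "g \<in> borel_measurable lborel"
  shows "square_integrable g"
  unfolding square_integrable_def
proof
  show "integrable lborel (\<lambda>x. (norm (g x))\<^sup>2)"
    by (rule integrable_cong_AE_imp[of _ "\<lambda>x. (norm (f x))\<^sup>2"])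
       (use assms in \<open>auto simp: square_integrable_def\<close>)
qed fact

lemma square_integrable_truncation:
  fixes f :: "real \<Rightarrow> real"
  assumes "square_integrable f"
  shows "set_integrable lborel {-R..R} f"
proof -
  have "square_integrable (\<lambda>x. indicator {-R..R} x :: real)"
    unfolding square_integrable_def
  proof
    have "integrable lborel (indicator {-R..R} :: real \<Rightarrow> real)"
      by (rule integrable_real_indicator) (auto simp: emeasure_lborel_Icc_eq)
    moreover have "(\<lambda>x. (norm (indicator {-R..R} x :: real))\<^sup>2) = (indicator {-R..R} :: real \<Rightarrow> real)"
      by (auto simp: indicator_def)
    ultimately show "integrable lborel (\<lambda>x. (norm (indicator {-R..R} x :: real))\<^sup>2)" by simp
  qed simp
  from square_integrable_norm_mult[OF this assms]
  show ?thesis unfolding set_integrable_def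
    by (rule Bochner_Integration.integrable_bound)
       (use assms in \<open>auto simp: square_integrable_def abs_mult\<close>)
qed

text \<open>
  AM-GM with a free parameter.  Integrated and optimised over \<open>l\<close>, it serves as the Cauchy-Schwarz
  inequality.
\<close>

lemma mult_le_weighted_squares:
  fixes a b l :: real
  assumes "l > 0"
  shows "a * b \<le> (l * a\<^sup>2 + b\<^sup>2 / l) / 2"
proof -
  have "0 \<le> (l * a - b)\<^sup>2 / l" using assms by simp
  also have "\<dots> = l * a\<^sup>2 - 2 * (a * b) + b\<^sup>2 / l"
    using assms by (simp add: power2_diff power2_eq_square field_simps)
  finally show ?thesis by simp
qed

lemma L2_pairing_tendsto:
  fixes \<psi> g :: "real \<Rightarrow> complex" and G :: "real \<Rightarrow> real \<Rightarrow> complex"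
  assumes psi: "square_integrable \<psi>" and g: "square_integrable g"
    and G: "\<And>R. G R \<in> borel_measurable lborel"
    and lim: "((\<lambda>R. \<integral>\<^sup>+\<xi>. ennreal ((norm (g \<xi> - G R \<xi>))\<^sup>2) \<partial>lborel) \<longlongrightarrow> 0) at_top"
  shows "((\<lambda>R. LINT \<xi>|lborel. \<psi> \<xi> * G R \<xi>) \<longlongrightarrow> (LINT \<xi>|lborel. \<psi> \<xi> * g \<xi>)) at_top"
proof (rule tendstoI)
  fix e :: real assume e: "e > 0"
  define A where "A = (LINT \<xi>|lborel. (norm (\<psi> \<xi>))\<^sup>2)"
  have A: "A \<ge> 0" unfolding A_def by simp
  \<comment> \<open>with this parameter both halves of AM-GM are below \<open>e\<close>; the summand 1 covers \<open>A = 0\<close>\<close>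
  define l where "l = e / (A + 1)"
  have l: "l > 0" using e A by (simp add: l_def)
  have lA: "l * A < e" using e A by (simp add: l_def field_simps)
  have "eventually (\<lambda>R. (\<integral>\<^sup>+\<xi>. ennreal ((norm (g \<xi> - G R \<xi>))\<^sup>2) \<partial>lborel) < ennreal (l * e)) at_top"
    by (rule order_tendstoD(2)[OF lim]) (use l e in simp)
  then show "eventually (\<lambda>R. dist (LINT \<xi>|lborel. \<psi> \<xi> * G R \<xi>) (LINT \<xi>|lborel. \<psi> \<xi> * g \<xi>) < e) at_top"
  proof eventually_elim
    case (elim R)
    let ?d = "\<lambda>\<xi>. g \<xi> - G R \<xi>"
    have gm [measurable]: "g \<in> borel_measurable borel" and pm [measurable]: "\<psi> \<in> borel_measurable borel"
      and Gm [measurable]: "G R \<in> borel_measurable borel"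
      using g psi G by (auto simp: square_integrable_def)
    have id: "integrable lborel (\<lambda>\<xi>. (norm (?d \<xi>))\<^sup>2)"
      by (rule integrableI_bounded) (use elim in \<open>auto intro: order.strict_trans\<close>)
    have sd: "square_integrable ?d" using id by (simp add: square_integrable_def)
    have "ennreal (LINT \<xi>|lborel. (norm (?d \<xi>))\<^sup>2) < ennreal (l * e)"
      using elim by (subst nn_integral_eq_integral[symmetric]) (use id in auto)
    then have D: "(LINT \<xi>|lborel. (norm (?d \<xi>))\<^sup>2) < l * e"
      by (simp add: ennreal_less_iff)
    have ipg: "integrable lborel (\<lambda>\<xi>. \<psi> \<xi> * g \<xi>)"
      by (rule Bochner_Integration.integrable_bound[OF square_integrable_norm_mult[OF psi g]]) (auto simp: norm_mult)
    have ipd: "integrable lborel (\<lambda>\<xi>. \<psi> \<xi> * ?d \<xi>)"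
      by (rule Bochner_Integration.integrable_bound[OF square_integrable_norm_mult[OF psi sd]]) (auto simp: norm_mult)
    have "(LINT \<xi>|lborel. \<psi> \<xi> * G R \<xi>) = (LINT \<xi>|lborel. \<psi> \<xi> * g \<xi> - \<psi> \<xi> * ?d \<xi>)"
      by (intro Bochner_Integration.integral_cong) (auto simp: algebra_simps)
    also have "\<dots> = (LINT \<xi>|lborel. \<psi> \<xi> * g \<xi>) - (LINT \<xi>|lborel. \<psi> \<xi> * ?d \<xi>)"
      by (rule Bochner_Integration.integral_diff[OF ipg ipd])
    finally have "dist (LINT \<xi>|lborel. \<psi> \<xi> * G R \<xi>) (LINT \<xi>|lborel. \<psi> \<xi> * g \<xi>)
        = norm (LINT \<xi>|lborel. \<psi> \<xi> * ?d \<xi>)" by (simp add: dist_norm)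
    also have "\<dots> \<le> (LINT \<xi>|lborel. norm (\<psi> \<xi> * ?d \<xi>))" by (rule integral_norm_bound)
    also have "\<dots> \<le> (LINT \<xi>|lborel. (l * (norm (\<psi> \<xi>))\<^sup>2 + (norm (?d \<xi>))\<^sup>2 / l) / 2)"
    proof (rule integral_mono)
      show "integrable lborel (\<lambda>\<xi>. norm (\<psi> \<xi> * ?d \<xi>))" using ipd by simp
      show "integrable lborel (\<lambda>\<xi>. (l * (norm (\<psi> \<xi>))\<^sup>2 + (norm (?d \<xi>))\<^sup>2 / l) / 2)"
        using id psi by (auto simp: square_integrable_def)
    qed (use mult_le_weighted_squares[OF l] in \<open>simp add: norm_mult\<close>)
    also have "\<dots> = (l * A + (LINT \<xi>|lborel. (norm (?d \<xi>))\<^sup>2) / l) / 2"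
      using id psi by (simp add: A_def square_integrable_def)
    also have "\<dots> < e"
    proof -
      have "(LINT \<xi>|lborel. (norm (?d \<xi>))\<^sup>2) / l < e" using D l by (simp add: field_simps)
      with lA show ?thesis by simp
    qed
    finally show ?case .
  qed
qed

lemma cis_measurable [measurable]: "cis \<in> borel_measurable borel"
  by (intro borel_measurable_continuous_onI continuous_intros)

lemma truncated_fourier_measurable:
  fixes f :: "real \<Rightarrow> real"
  assumes [measurable]: "f \<in> borel_measurable borel"
  shows "(\<lambda>\<xi>. LBINT x:{-R..R}. cis (- (x * \<xi>)) * complex_of_real (f x)) \<in> borel_measurable lborel"
proof -
  show ?thesis
    unfolding set_lebesgue_integral_def
    by (intro lborel.borel_measurable_lebesgue_integral) measurable
qed

text \<open>
  The multiplication formula $\int \psi \hat f = \int \hat\psi f$.  For the truncations of \<open>f\<close> it is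
  Fubini's theorem; both sides pass to the limit because all functions are square-integrable.
\<close>

lemma fourier_L2_pairing:
  fixes \<psi> :: "real \<Rightarrow> complex"
  assumes fg: "fourier_L2 f g" and psi: "square_integrable \<psi>" and psi1: "integrable lborel \<psi>"
    and hat: "\<And>x. (LINT \<xi>|lborel. \<psi> \<xi> * cis (- (x * \<xi>))) = complex_of_real (k x)"
    and k: "square_integrable k"
  shows "(LINT \<xi>|lborel. \<psi> \<xi> * g \<xi>) = complex_of_real (LINT x|lborel. f x * k x)"
proof -
  define G where "G R \<xi> = (LBINT x:{-R..R}. cis (- (x * \<xi>)) * complex_of_real (f x))" for R \<xi>
  have f: "square_integrable f" and g: "square_integrable g"
    and lim: "((\<lambda>R. \<integral>\<^sup>+\<xi>. ennreal ((norm (g \<xi> - G R \<xi>))\<^sup>2) \<partial>lborel) \<longlongrightarrow> 0) at_top"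
    using fg by (auto simp: fourier_L2_def G_def)
  have fm [measurable]: "f \<in> borel_measurable borel" and pm [measurable]: "\<psi> \<in> borel_measurable borel"
    and km [measurable]: "k \<in> borel_measurable borel"
    using f psi k by (auto simp: square_integrable_def)
  have "((\<lambda>R. LINT \<xi>|lborel. \<psi> \<xi> * G R \<xi>) \<longlongrightarrow> (LINT \<xi>|lborel. \<psi> \<xi> * g \<xi>)) at_top"
    by (rule L2_pairing_tendsto[OF psi g _ lim])
       (use truncated_fourier_measurable[OF fm] in \<open>simp add: G_def[abs_def]\<close>)
  moreover have "(LINT \<xi>|lborel. \<psi> \<xi> * G R \<xi>)
      = complex_of_real (LINT x|lborel. indicator {-R..R} x *\<^sub>R (f x * k x))" for R
  proof -
    let ?H = "\<lambda>x \<xi>. \<psi> \<xi> * (indicator {-R..R} x *\<^sub>R (cis (- (x * \<xi>)) * complex_of_real (f x)))"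
    have nH: "norm (?H x \<xi>) = norm (indicator {-R..R} x *\<^sub>R f x) * norm (\<psi> \<xi>)" for x \<xi>
      by (simp add: norm_mult abs_mult)
    have int: "integrable (lborel \<Otimes>\<^sub>M lborel) (\<lambda>(x, \<xi>). ?H x \<xi>)"
    proof (rule lborel_pair.Fubini_integrable)
      show "(\<lambda>(x, \<xi>). ?H x \<xi>) \<in> borel_measurable (lborel \<Otimes>\<^sub>M lborel)"
        by measurable
      have "integrable lborel (\<lambda>x. norm (indicator {-R..R} x *\<^sub>R f x) * (LINT \<xi>|lborel. norm (\<psi> \<xi>)))"
        using square_integrable_truncation[OF f, of R] unfolding set_integrable_def
        by (intro integrable_mult_left integrable_norm)
      then show "integrable lborel (\<lambda>x. LINT \<xi>|lborel. norm (case (x, \<xi>) of (x, \<xi>) \<Rightarrow> ?H x \<xi>))"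
        unfolding prod.case nH by (simp only: integral_mult_right_zero)
      show "AE x in lborel. integrable lborel (\<lambda>\<xi>. case (x, \<xi>) of (x, \<xi>) \<Rightarrow> ?H x \<xi>)"
      proof (rule AE_I2)
        fix x
        have "integrable lborel (\<lambda>\<xi>. norm (?H x \<xi>))"
          unfolding nH using psi1 by (intro integrable_mult_right integrable_norm)
        then show "integrable lborel (\<lambda>\<xi>. case (x, \<xi>) of (x, \<xi>) \<Rightarrow> ?H x \<xi>)"
          unfolding prod.case by (subst (asm) integrable_norm_iff) auto
      qed
    qed
    have "(LINT \<xi>|lborel. \<psi> \<xi> * G R \<xi>) = (LINT \<xi>|lborel. LINT x|lborel. ?H x \<xi>)"
      unfolding G_def set_lebesgue_integral_def by (simp only: integral_mult_right_zero)
    also have "\<dots> = (LINT x|lborel. LINT \<xi>|lborel. ?H x \<xi>)"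
      by (rule lborel_pair.Fubini_integral[OF int])
    also have "\<dots> = (LINT x|lborel. complex_of_real (indicator {-R..R} x *\<^sub>R (f x * k x)))"
    proof (rule Bochner_Integration.integral_cong[OF refl])
      fix x
      have "(LINT \<xi>|lborel. ?H x \<xi>)
          = (LINT \<xi>|lborel. complex_of_real (indicator {-R..R} x * f x) * (\<psi> \<xi> * cis (- (x * \<xi>))))"
        by (intro Bochner_Integration.integral_cong) (auto simp: scaleR_conv_of_real)
      also have "\<dots> = complex_of_real (indicator {-R..R} x * f x) * complex_of_real (k x)"
        by (simp only: integral_mult_right_zero hat)
      finally show "(LINT \<xi>|lborel. ?H x \<xi>) = complex_of_real (indicator {-R..R} x *\<^sub>R (f x * k x))"
        by simp
    qed
    finally show ?thesis by (simp only: integral_complex_of_real)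
  qed
  ultimately have L: "((\<lambda>R. complex_of_real (LINT x|lborel. indicator {-R..R} x *\<^sub>R (f x * k x)))
      \<longlongrightarrow> (LINT \<xi>|lborel. \<psi> \<xi> * g \<xi>)) at_top" by simp
  have "((\<lambda>R. (LINT x|lborel. indicator {-R..R} x *\<^sub>R (f x * k x))) \<longlongrightarrow> (LINT x|lborel. f x * k x)) at_top"
  proof (rule integral_dominated_convergence_at_top[where w = "\<lambda>x. norm (f x) * norm (k x)"])
    show "AE x in lborel. ((\<lambda>R. indicator {-R..R} x *\<^sub>R (f x * k x)) \<longlongrightarrow> f x * k x) at_top"
    proof (rule AE_I2, rule tendsto_eventually)
      fix x :: real
      show "\<forall>\<^sub>F R in at_top. indicator {-R..R} x *\<^sub>R (f x * k x) = f x * k x"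
        using eventually_ge_at_top[of "\<bar>x\<bar>"] by eventually_elim (auto simp: indicator_def)
    qed
    show "\<forall>\<^sub>F R in at_top. AE x in lborel. norm (indicator {-R..R} x *\<^sub>R (f x * k x)) \<le> norm (f x) * norm (k x)"
      by (auto simp: indicator_def abs_mult)
  qed (use square_integrable_norm_mult[OF f k] in auto)
  from tendsto_of_real[OF this] show ?thesis
    by (rule tendsto_unique[OF trivial_limit_at_top_linorder L])
qed

lemma gaussian_fourier:
  assumes "\<epsilon> > 0"
  shows "(LINT \<xi>|lborel. (cis (a * \<xi>) * complex_of_real (std_normal_density (\<epsilon> * \<xi>))) * cis (- (x * \<xi>)))
    = complex_of_real (exp (- ((x - a) / \<epsilon>)\<^sup>2 / 2) / \<epsilon>)"
proof -
  let ?t = "(a - x) / \<epsilon>"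
  have "complex_of_real (exp (- (?t^2) / 2)) = (LINT z|std_normal_distribution. iexp (?t * z))"
    using fun_cong[OF char_std_normal_distribution, of ?t] by (simp add: char_def)
  also have "\<dots> = (LINT z|lborel. std_normal_density z *\<^sub>R iexp (?t * z))"
    by (subst integral_density) (auto simp: normal_density_nonneg)
  also have "\<dots> = \<bar>\<epsilon>\<bar> *\<^sub>R (LINT \<xi>|lborel. std_normal_density (0 + \<epsilon> * \<xi>) *\<^sub>R iexp (?t * (0 + \<epsilon> * \<xi>)))"
    by (rule lborel_integral_real_affine) (use assms in simp)
  also have "\<dots> = \<epsilon> *\<^sub>R (LINT \<xi>|lborel. (cis (a * \<xi>) * complex_of_real (std_normal_density (\<epsilon> * \<xi>))) * cis (- (x * \<xi>)))"
  proof -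
    have "std_normal_density (0 + \<epsilon> * \<xi>) *\<^sub>R iexp (?t * (0 + \<epsilon> * \<xi>)) =
      (cis (a * \<xi>) * complex_of_real (std_normal_density (\<epsilon> * \<xi>))) * cis (- (x * \<xi>))" for \<xi>
    proof -
      have "iexp (?t * (0 + \<epsilon> * \<xi>)) = cis ((a - x) * \<xi>)"
        using assms by (simp add: cis_conv_exp)
      also have "(a - x) * \<xi> = a * \<xi> + - (x * \<xi>)" by (simp add: algebra_simps)
      also have "cis \<dots> = cis (a * \<xi>) * cis (- (x * \<xi>))" by (simp only: cis_mult)
      finally show ?thesis by (simp add: scaleR_conv_of_real)
    qed
    then show ?thesis using assms by simp
  qed
  finally have "(LINT \<xi>|lborel. (cis (a * \<xi>) * complex_of_real (std_normal_density (\<epsilon> * \<xi>))) * cis (- (x * \<xi>)))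
     = complex_of_real (exp (- (?t^2) / 2)) / \<epsilon>"
    using assms by (simp add: scaleR_conv_of_real field_simps)
  moreover have "?t^2 = ((x - a) / \<epsilon>)\<^sup>2" by (simp add: power2_commute power_divide)
  ultimately show ?thesis by simp
qed

lemma std_normal_density_le_1: "std_normal_density y \<le> 1"
proof -
  have "1 / sqrt (2 * pi) \<le> 1" using pi_gt3 by (simp add: real_le_lsqrt)
  moreover have "exp (- y\<^sup>2 / 2) \<le> 1" by simp
  ultimately have "(1 / sqrt (2 * pi)) * exp (- y\<^sup>2 / 2) \<le> 1 * 1"
    by (intro mult_mono) auto
  then show "std_normal_density y \<le> 1" by (simp only: std_normal_density_def mult_1)
qed

lemma gaussian_square_integrable:
  assumes "\<epsilon> > 0"
  shows "integrable lborel (\<lambda>x. std_normal_density (c + \<epsilon> * x))"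
    and "square_integrable (\<lambda>x. std_normal_density (c + \<epsilon> * x))"
proof -
  have i: "integrable lborel (\<lambda>x. std_normal_density x)"
    using integrable_normal_moment_abs[of 1 0 0] by simp
  show 1: "integrable lborel (\<lambda>x. std_normal_density (c + \<epsilon> * x))"
    by (rule lborel_integrable_real_affine[OF i]) (use assms in simp)
  show "square_integrable (\<lambda>x. std_normal_density (c + \<epsilon> * x))"
    unfolding square_integrable_def
  proof
    show "integrable lborel (\<lambda>x. (norm (std_normal_density (c + \<epsilon> * x)))\<^sup>2)"
    proof (rule Bochner_Integration.integrable_bound[OF 1])
      show "AE x in lborel. norm ((norm (std_normal_density (c + \<epsilon> * x)))\<^sup>2) \<le> norm (std_normal_density (c + \<epsilon> * x))"
        using std_normal_density_le_1 by (auto simp: power2_eq_square normal_density_nonneg intro!: mult_left_le)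
    qed auto
  qed auto
qed

text \<open>
  Gaussians are an approximate identity even for functions that are merely square-integrable away
  from the point \<open>a\<close>: there the kernel is at most a constant multiple of \<open>e n\<close> times a fixed
  Gaussian, which pairs with \<open>f\<close> to a finite integral.
\<close>

lemma gaussian_kernel_limit:
  fixes f :: "real \<Rightarrow> real"
  assumes f: "square_integrable f" and cont: "continuous_on UNIV f"
  defines "e \<equiv> \<lambda>n::nat. 1 / real (Suc n)"
  shows "(\<lambda>n. LINT x|lborel. f x * (exp (- ((x - a) / e n)\<^sup>2 / 2) / e n)) \<longlonglongrightarrow> sqrt (2 * pi) * f a"
proof -
  have fm [measurable]: "f \<in> borel_measurable borel" using f by (simp add: square_integrable_def)
  have e0: "e n > 0" "e n \<le> 1" for n by (auto simp: e_def)
  have elim: "e \<longlonglongrightarrow> 0" unfolding e_def by real_asymp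
  define k where "k n x = exp (- ((x - a) / e n)\<^sup>2 / 2) / e n" for n x
  have km [measurable]: "k n \<in> borel_measurable borel" for n unfolding k_def by measurable
  define N where "N = (\<lambda>x. indicator {a-1..a+1} x * f x)"
  define W where "W = (\<lambda>x. indicator (- {a-1..a+1}) x * f x)"
  have Nm [measurable]: "N \<in> borel_measurable borel" and Wm [measurable]: "W \<in> borel_measurable borel"
    unfolding N_def W_def by measurable
  obtain B where B: "\<And>x. x \<in> {a-1..a+1} \<Longrightarrow> \<bar>f x\<bar> \<le> B"
  proof -
    have "compact (f ` {a-1..a+1})"
      by (intro compact_continuous_image continuous_on_subset[OF cont]) auto
    then have "bounded (f ` {a-1..a+1})" by (rule compact_imp_bounded)
    then obtain B where "\<forall>y\<in>f ` {a-1..a+1}. norm y \<le> B" unfolding bounded_iff by auto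
    then show ?thesis by (intro that[of B]) auto
  qed
  have NB: "\<bar>N x\<bar> \<le> B" for x
    using B[of x] B[of a] by (auto simp: N_def indicator_def)
  have gk: "k n x = sqrt (2 * pi) / e n * std_normal_density (- a / e n + (1 / e n) * x)" for n x
    using e0[of n] by (simp add: k_def std_normal_density_def diff_divide_distrib)
  have ki: "integrable lborel (k n)" for n
    unfolding gk[abs_def] using gaussian_square_integrable(1)[of "1 / e n" "- a / e n"] e0[of n]
    by (intro integrable_mult_right) auto
  \<comment> \<open>the part of \<open>f\<close> away from \<open>a\<close> contributes \<open>O(e n)\<close>\<close>
  have far: "(\<lambda>n. LINT x|lborel. W x * k n x) \<longlonglongrightarrow> 0"
    and farint: "\<And>n. integrable lborel (\<lambda>x. W x * k n x)"
  proof -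
    let ?g = "\<lambda>x. std_normal_density (- a / sqrt 2 + (1 / sqrt 2) * x)"
    have g: "square_integrable ?g" by (rule gaussian_square_integrable) auto
    have gi: "integrable lborel (\<lambda>x. 4 * sqrt (2 * pi) * (norm (f x) * norm (?g x)))"
      by (intro integrable_mult_right square_integrable_norm_mult[OF f g])
    have bd: "\<bar>W x * k n x\<bar> \<le> e n * (4 * sqrt (2 * pi) * (norm (f x) * norm (?g x)))" for n x
    proof (cases "x \<in> {a-1..a+1}")
      case True then show ?thesis using e0[of n] by (simp add: W_def)
    next
      case False
      define y where "y = x - a"
      have y: "y\<^sup>2 \<ge> 1" using False unfolding y_def
        by (auto simp: not_le abs_square_le_1[symmetric] intro!: one_le_power abs_le_square_iff[THEN iffD1, of 1, simplified])
      let ?q = "y\<^sup>2 / (4 * (e n)\<^sup>2)"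
      have "y\<^sup>2 > 0" using y by linarith
      then have q: "?q > 0" using e0(1)[of n] by (simp add: zero_less_divide_iff)
      have "?q \<le> exp ?q" using exp_ge_add_one_self[of ?q] by linarith
      then have "inverse (exp ?q) \<le> inverse ?q" using q by (rule le_imp_inverse_le)
      then have "exp (- ?q) \<le> 1 / ?q" by (simp add: exp_minus inverse_eq_divide)
      also have "1 / ?q = 4 * (e n)\<^sup>2 / y\<^sup>2" by simp
      also have "\<dots> \<le> 4 * (e n)\<^sup>2 / 1" using y by (intro divide_left_mono) auto
      also have "\<dots> = 4 * (e n)\<^sup>2" by simp
      finally have 1: "exp (- ?q) \<le> 4 * (e n)\<^sup>2" .
      have "(e n)\<^sup>2 \<le> 1" using e0[of n] by (simp add: power_le_one)
      then have "y\<^sup>2 / 4 \<le> ?q" using y e0[of n] by (simp add: field_simps mult_left_le)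
      then have 2: "exp (- ?q) \<le> exp (- y\<^sup>2 / 4)" by simp
      have "k n x = exp (- ?q) * exp (- ?q) / e n"
        unfolding exp_add[symmetric] k_def y_def by (simp add: power_divide)
      also have "\<dots> \<le> (4 * (e n)\<^sup>2) * exp (- y\<^sup>2 / 4) / e n"
        using 1 2 e0[of n] by (intro divide_right_mono mult_mono) auto
      also have "\<dots> = e n * (4 * exp (- y\<^sup>2 / 4))"
        using e0[of n] by (simp add: power2_eq_square)
      also have "exp (- y\<^sup>2 / 4) = sqrt (2 * pi) * ?g x"
      proof -
        have "- a / sqrt 2 + (1 / sqrt 2) * x = y / sqrt 2" by (simp add: y_def diff_divide_distrib)
        then show ?thesis by (simp add: std_normal_density_def power_divide)
      qed
      finally have "k n x \<le> e n * (4 * sqrt (2 * pi) * ?g x)" by simp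
      moreover have "k n x \<ge> 0" using e0[of n] by (simp add: k_def)
      ultimately have "\<bar>f x\<bar> * k n x \<le> \<bar>f x\<bar> * (e n * (4 * sqrt (2 * pi) * ?g x))"
        by (intro mult_left_mono) auto
      then show ?thesis using False \<open>k n x \<ge> 0\<close>
        by (simp add: W_def abs_mult normal_density_nonneg mult_ac)
    qed
    show fi: "integrable lborel (\<lambda>x. W x * k n x)" for n
    proof (rule Bochner_Integration.integrable_bound[OF integrable_mult_right[OF gi, of "e n"]])
      show "AE x in lborel. norm (W x * k n x) \<le> norm (e n * (4 * sqrt (2 * pi) * (norm (f x) * norm (?g x))))"
        by (intro AE_I2) (use order_trans[OF bd abs_ge_self] in \<open>simp only: real_norm_def\<close>)
    qed auto
    let ?Q = "LINT x|lborel. 4 * sqrt (2 * pi) * (norm (f x) * norm (?g x))"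
    have "\<bar>LINT x|lborel. W x * k n x\<bar> \<le> e n * ?Q" for n
    proof -
      have "\<bar>LINT x|lborel. W x * k n x\<bar> \<le> (LINT x|lborel. \<bar>W x * k n x\<bar>)"
        by (rule integral_abs_bound)
      also have "\<dots> \<le> (LINT x|lborel. e n * (4 * sqrt (2 * pi) * (norm (f x) * norm (?g x))))"
        by (intro integral_mono integrable_abs fi integrable_mult_right[OF gi] bd)
      finally show ?thesis by (simp only: integral_mult_right_zero)
    qed
    then have "norm (LINT x|lborel. W x * k n x) \<le> e n * ?Q" for n
      by (simp only: real_norm_def)
    moreover have "(\<lambda>n. e n * ?Q) \<longlonglongrightarrow> 0"
      using tendsto_mult_left_zero[OF elim] by simp
    ultimately show "(\<lambda>n. LINT x|lborel. W x * k n x) \<longlonglongrightarrow> 0"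
      by (rule Lim_null_comparison[OF always_eventually[OF allI]])
  qed
  \<comment> \<open>near \<open>a\<close>, rescale so that the kernel is a fixed Gaussian\<close>
  have near: "(\<lambda>n. LINT x|lborel. N x * k n x) \<longlonglongrightarrow> (LINT z|lborel. sqrt (2 * pi) * std_normal_density z * f a)"
  proof -
    have eq: "(LINT x|lborel. N x * k n x) = (LINT z|lborel. sqrt (2 * pi) * std_normal_density z * N (a + e n * z))" for n
    proof -
      have "(LINT x|lborel. N x * k n x) = \<bar>e n\<bar> *\<^sub>R (LINT z|lborel. N (a + e n * z) * k n (a + e n * z))"
        by (rule lborel_integral_real_affine) (use e0[of n] in simp)
      also have "\<dots> = (LINT z|lborel. \<bar>e n\<bar> * (N (a + e n * z) * k n (a + e n * z)))" by simp
      also have "\<dots> = (LINT z|lborel. sqrt (2 * pi) * std_normal_density z * N (a + e n * z))"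
        using e0[of n] by (intro Bochner_Integration.integral_cong)
          (auto simp: k_def std_normal_density_def)
      finally show ?thesis .
    qed
    show ?thesis unfolding eq
    proof (rule integral_dominated_convergence[where w = "\<lambda>z. sqrt (2 * pi) * std_normal_density z * B"])
      show "integrable lborel (\<lambda>z. sqrt (2 * pi) * std_normal_density z * B)"
        using gaussian_square_integrable(1)[of 1 0] by auto
      show "AE z in lborel. (\<lambda>n. sqrt (2 * pi) * std_normal_density z * N (a + e n * z)) \<longlonglongrightarrow> sqrt (2 * pi) * std_normal_density z * f a"
      proof (rule AE_I2, rule tendsto_mult_left)
        fix z
        have "(\<lambda>n. f (a + e n * z)) \<longlonglongrightarrow> f (a + 0 * z)"
          by (intro continuous_on_tendsto_compose[OF cont] tendsto_intros elim) auto
        moreover have "\<forall>\<^sub>F n in sequentially. f (a + e n * z) = N (a + e n * z)"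
        proof -
          have "(\<lambda>n. \<bar>e n * z\<bar>) \<longlonglongrightarrow> \<bar>0 * z\<bar>" by (intro tendsto_intros elim)
          then have "\<forall>\<^sub>F n in sequentially. \<bar>e n * z\<bar> < 1" by (rule order_tendstoD) auto
          then show ?thesis by eventually_elim (auto simp: N_def indicator_def)
        qed
        ultimately show "(\<lambda>n. N (a + e n * z)) \<longlonglongrightarrow> f a"
          by (auto simp: tendsto_cong)
      qed
      show "AE z in lborel. norm (sqrt (2 * pi) * std_normal_density z * N (a + e n * z)) \<le> sqrt (2 * pi) * std_normal_density z * B" for n
        using NB by (auto simp: abs_mult normal_density_nonneg intro!: mult_left_mono)
    qed auto
  qed
  have "(LINT z|lborel. sqrt (2 * pi) * std_normal_density z * f a) = sqrt (2 * pi) * f a"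
    using integral_std_normal_moment_even[of 0] by simp
  with near have near': "(\<lambda>n. LINT x|lborel. N x * k n x) \<longlonglongrightarrow> sqrt (2 * pi) * f a" by simp
  have sum: "(LINT x|lborel. f x * k n x) = (LINT x|lborel. N x * k n x) + (LINT x|lborel. W x * k n x)" for n
  proof -
    have "integrable lborel (\<lambda>x. N x * k n x)"
      by (rule Bochner_Integration.integrable_bound[OF integrable_mult_right[OF ki[of n], of B]])
         (use NB e0[of n] order_trans[OF abs_ge_zero NB] in \<open>auto simp: abs_mult intro!: mult_right_mono\<close>)
    then have "(LINT x|lborel. N x * k n x) + (LINT x|lborel. W x * k n x)
      = (LINT x|lborel. N x * k n x + W x * k n x)"
      by (rule Bochner_Integration.integral_add[OF _ farint, symmetric])
    also have "\<dots> = (LINT x|lborel. f x * k n x)"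
      by (intro Bochner_Integration.integral_cong) (auto simp: N_def W_def indicator_def)
    finally show ?thesis by simp
  qed
  show ?thesis
    using tendsto_add[OF near' far] unfolding sum[symmetric] by (simp only: k_def add_0_right)
qed

text \<open>
  Pair \<open>g\<close> with the characters $e^{ia\xi}$ damped by wide Gaussians, whose transforms concentrate at
  \<open>a\<close>.  Both sides of the multiplication formula converge, the left because \<open>g\<close> is integrable and the
  right because \<open>f0\<close> is continuous at \<open>a\<close>.
\<close>

lemma fourier_L2_inversion:
  assumes fg: "fourier_L2 f g" and g1: "integrable lborel g"
    and cont: "continuous_on UNIV f0" and ae: "AE x in lborel. f x = f0 x"
  shows "(LINT \<xi>|lborel. g \<xi> * cis (a * \<xi>)) = complex_of_real (2 * pi * f0 a)"
proof -
  define e where "e = (\<lambda>n::nat. 1 / real (Suc n))"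
  have e0: "e n > 0" for n by (auto simp: e_def)
  have elim: "e \<longlonglongrightarrow> 0" unfolding e_def by real_asymp
  have f: "square_integrable f" using fg by (simp add: fourier_L2_def)
  have f0m [measurable]: "f0 \<in> borel_measurable borel" by (rule borel_measurable_continuous_onI[OF cont])
  have fm [measurable]: "f \<in> borel_measurable borel" using f by (simp add: square_integrable_def)
  have gm [measurable]: "g \<in> borel_measurable borel" using g1 by auto
  have f0: "square_integrable f0" by (rule square_integrable_cong_AE[OF f ae]) simp
  define \<psi> where "\<psi> n \<xi> = cis (a * \<xi>) * complex_of_real (std_normal_density (e n * \<xi>))" for n \<xi>
  define k where "k n x = exp (- ((x - a) / e n)\<^sup>2 / 2) / e n" for n x
  have n\<psi>: "norm (\<psi> n \<xi>) = std_normal_density (0 + e n * \<xi>)" for n \<xi>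
    by (simp add: \<psi>_def norm_mult normal_density_nonneg)
  have \<psi>m [measurable]: "\<psi> n \<in> borel_measurable borel" for n unfolding \<psi>_def by measurable
  have pair: "(LINT \<xi>|lborel. \<psi> n \<xi> * g \<xi>) = complex_of_real (LINT x|lborel. f0 x * k n x)" for n
  proof -
    have "(LINT \<xi>|lborel. \<psi> n \<xi> * g \<xi>) = complex_of_real (LINT x|lborel. f x * k n x)"
    proof (rule fourier_L2_pairing[OF fg])
      show "square_integrable (\<psi> n)"
        using gaussian_square_integrable(2)[OF e0[of n], of 0]
        unfolding square_integrable_def n\<psi> by simp
      show "integrable lborel (\<psi> n)"
        by (rule Bochner_Integration.integrable_bound[OF gaussian_square_integrable(1)[OF e0[of n], of 0]])
           (auto simp: n\<psi>)
      show "(LINT \<xi>|lborel. \<psi> n \<xi> * cis (- (x * \<xi>))) = complex_of_real (k n x)" for x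
        unfolding \<psi>_def k_def by (rule gaussian_fourier[OF e0])
      have "k n x = (sqrt (2 * pi) / e n) *\<^sub>R std_normal_density (- a / e n + (1 / e n) * x)" for x
        using e0[of n] by (simp add: k_def std_normal_density_def diff_divide_distrib)
      then have k': "k n = (\<lambda>x. (sqrt (2 * pi) / e n) *\<^sub>R std_normal_density (- a / e n + (1 / e n) * x))"
        by (rule ext)
      show "square_integrable (k n)"
        unfolding k' by (intro square_integrable_scaleR gaussian_square_integrable) (use e0[of n] in simp)
    qed
    also have "(LINT x|lborel. f x * k n x) = (LINT x|lborel. f0 x * k n x)"
      by (rule integral_cong_AE) (use ae in \<open>auto simp: k_def\<close>)
    finally show ?thesis .
  qed
  have "(\<lambda>n. LINT \<xi>|lborel. \<psi> n \<xi> * g \<xi>) \<longlonglongrightarrow> (LINT \<xi>|lborel. (cis (a * \<xi>) * complex_of_real (std_normal_density 0)) * g \<xi>)"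
  proof (rule integral_dominated_convergence[where w = "\<lambda>\<xi>. norm (g \<xi>)"])
    show "AE \<xi> in lborel. (\<lambda>n. \<psi> n \<xi> * g \<xi>) \<longlonglongrightarrow> (cis (a * \<xi>) * complex_of_real (std_normal_density 0)) * g \<xi>"
    proof (rule AE_I2)
      fix \<xi>
      have "(\<lambda>n. std_normal_density (e n * \<xi>)) \<longlonglongrightarrow> std_normal_density (0 * \<xi>)"
        unfolding std_normal_density_def by (intro tendsto_intros elim) auto
      then show "(\<lambda>n. \<psi> n \<xi> * g \<xi>) \<longlonglongrightarrow> (cis (a * \<xi>) * complex_of_real (std_normal_density 0)) * g \<xi>"
        unfolding \<psi>_def by (intro tendsto_intros) auto
    qed
    show "AE \<xi> in lborel. norm (\<psi> n \<xi> * g \<xi>) \<le> norm (g \<xi>)" for n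
      using std_normal_density_le_1 by (auto simp: norm_mult n\<psi> normal_density_nonneg intro!: mult_left_le_one_le)
  qed (use g1 in auto)
  moreover have "(\<lambda>n. complex_of_real (LINT x|lborel. f0 x * k n x)) \<longlonglongrightarrow> complex_of_real (sqrt (2 * pi) * f0 a)"
    unfolding k_def e_def by (intro tendsto_of_real gaussian_kernel_limit[OF f0 cont])
  ultimately have "(LINT \<xi>|lborel. (cis (a * \<xi>) * complex_of_real (std_normal_density 0)) * g \<xi>) = complex_of_real (sqrt (2 * pi) * f0 a)"
    unfolding pair by (rule LIMSEQ_unique)
  also have "(LINT \<xi>|lborel. (cis (a * \<xi>) * complex_of_real (std_normal_density 0)) * g \<xi>)
     = complex_of_real (1 / sqrt (2 * pi)) * (LINT \<xi>|lborel. g \<xi> * cis (a * \<xi>))"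
    by (subst integral_mult_right_zero[symmetric]) (auto intro!: Bochner_Integration.integral_cong simp: std_normal_density_def)
  finally have eq: "complex_of_real (1 / sqrt (2 * pi)) * (LINT \<xi>|lborel. g \<xi> * cis (a * \<xi>)) = complex_of_real (sqrt (2 * pi) * f0 a)" .
  have "complex_of_real (sqrt (2 * pi)) * (complex_of_real (1 / sqrt (2 * pi)) * (LINT \<xi>|lborel. g \<xi> * cis (a * \<xi>)))
     = (LINT \<xi>|lborel. g \<xi> * cis (a * \<xi>))"
    unfolding mult.assoc[symmetric] of_real_mult[symmetric] by simp
  then show ?thesis
    unfolding eq of_real_mult[symmetric] mult.assoc[symmetric] by simp
qed

section \<open>Sobolev embedding on the line\<close>

text \<open>
  Linearity of limits in \<open>L\<^sup>2\<close>, in terms of squared distances.  It yields both the uniqueness of the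
  Fourier transform and its linearity.
\<close>

lemma L2_limits_combine:
  fixes G G' :: "real \<Rightarrow> real \<Rightarrow> complex"
  assumes [measurable]: "g \<in> borel_measurable borel" "g' \<in> borel_measurable borel"
    "\<And>R. G R \<in> borel_measurable borel" "\<And>R. G' R \<in> borel_measurable borel"
    and 1: "((\<lambda>R. \<integral>\<^sup>+\<xi>. ennreal ((norm (g \<xi> - G R \<xi>))\<^sup>2) \<partial>lborel) \<longlongrightarrow> 0) at_top"
    and 2: "((\<lambda>R. \<integral>\<^sup>+\<xi>. ennreal ((norm (g' \<xi> - G' R \<xi>))\<^sup>2) \<partial>lborel) \<longlongrightarrow> 0) at_top"
  shows "((\<lambda>R. \<integral>\<^sup>+\<xi>. ennreal ((norm ((a *\<^sub>R g \<xi> + b *\<^sub>R g' \<xi>) - (a *\<^sub>R G R \<xi> + b *\<^sub>R G' R \<xi>)))\<^sup>2) \<partial>lborel) \<longlongrightarrow> 0) at_top"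
proof -
  let ?L = "\<lambda>R. \<integral>\<^sup>+\<xi>. ennreal ((norm ((a *\<^sub>R g \<xi> + b *\<^sub>R g' \<xi>) - (a *\<^sub>R G R \<xi> + b *\<^sub>R G' R \<xi>)))\<^sup>2) \<partial>lborel"
  let ?N = "\<lambda>R. \<integral>\<^sup>+\<xi>. ennreal ((norm (g \<xi> - G R \<xi>))\<^sup>2) \<partial>lborel"
  let ?N' = "\<lambda>R. \<integral>\<^sup>+\<xi>. ennreal ((norm (g' \<xi> - G' R \<xi>))\<^sup>2) \<partial>lborel"
  have le: "?L R \<le> ennreal (2 * a\<^sup>2) * ?N R + ennreal (2 * b\<^sup>2) * ?N' R" for R
  proof -
    have "(norm ((a *\<^sub>R g \<xi> + b *\<^sub>R g' \<xi>) - (a *\<^sub>R G R \<xi> + b *\<^sub>R G' R \<xi>)))\<^sup>2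
       \<le> 2 * a\<^sup>2 * (norm (g \<xi> - G R \<xi>))\<^sup>2 + 2 * b\<^sup>2 * (norm (g' \<xi> - G' R \<xi>))\<^sup>2" for \<xi>
    proof -
      have "(a *\<^sub>R g \<xi> + b *\<^sub>R g' \<xi>) - (a *\<^sub>R G R \<xi> + b *\<^sub>R G' R \<xi>)
          = a *\<^sub>R (g \<xi> - G R \<xi>) + b *\<^sub>R (g' \<xi> - G' R \<xi>)" by (simp add: algebra_simps)
      then show ?thesis
        using norm_add_square_le[of "a *\<^sub>R (g \<xi> - G R \<xi>)" "b *\<^sub>R (g' \<xi> - G' R \<xi>)"]
        by (simp add: power_mult_distrib)
    qed
    then have "?L R \<le> (\<integral>\<^sup>+\<xi>. ennreal (2 * a\<^sup>2) * ennreal ((norm (g \<xi> - G R \<xi>))\<^sup>2)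
        + ennreal (2 * b\<^sup>2) * ennreal ((norm (g' \<xi> - G' R \<xi>))\<^sup>2) \<partial>lborel)"
      by (intro nn_integral_mono)
         (simp add: ennreal_mult[symmetric] ennreal_plus[symmetric] del: ennreal_plus)
    also have "\<dots> = ennreal (2 * a\<^sup>2) * ?N R + ennreal (2 * b\<^sup>2) * ?N' R"
      by (subst nn_integral_add) (auto simp: nn_integral_cmult)
    finally show ?thesis .
  qed
  have "((\<lambda>R. ennreal (2 * a\<^sup>2) * ?N R + ennreal (2 * b\<^sup>2) * ?N' R)
      \<longlongrightarrow> ennreal (2 * a\<^sup>2) * 0 + ennreal (2 * b\<^sup>2) * 0) at_top"
    by (intro tendsto_add ennreal_tendsto_cmult 1 2) auto
  then have lim: "((\<lambda>R. ennreal (2 * a\<^sup>2) * ?N R + ennreal (2 * b\<^sup>2) * ?N' R) \<longlongrightarrow> 0) at_top" by simp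
  show "(?L \<longlongrightarrow> 0) at_top"
    by (rule tendsto_sandwich[OF _ always_eventually[OF allI[OF le]] tendsto_const lim]) simp
qed

lemma fourier_L2_unique:
  assumes "fourier_L2 f g" "fourier_L2 f g'"
  shows "AE \<xi> in lborel. g \<xi> = g' \<xi>"
proof -
  define G where "G R \<xi> = (LBINT x:{-R..R}. cis (- (x * \<xi>)) * complex_of_real (f x))" for R \<xi>
  have [measurable]: "f \<in> borel_measurable borel" "g \<in> borel_measurable borel" "g' \<in> borel_measurable borel"
    and lim: "((\<lambda>R. \<integral>\<^sup>+\<xi>. ennreal ((norm (g \<xi> - G R \<xi>))\<^sup>2) \<partial>lborel) \<longlongrightarrow> 0) at_top"
      "((\<lambda>R. \<integral>\<^sup>+\<xi>. ennreal ((norm (g' \<xi> - G R \<xi>))\<^sup>2) \<partial>lborel) \<longlongrightarrow> 0) at_top"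
    using assms by (auto simp: fourier_L2_def square_integrable_def G_def)
  have Gm: "G R \<in> borel_measurable borel" for R
    using truncated_fourier_measurable[of f R] by (simp add: G_def[abs_def])
  have "((\<lambda>R. \<integral>\<^sup>+\<xi>. ennreal ((norm ((1 *\<^sub>R g \<xi> + (-1) *\<^sub>R g' \<xi>) - (1 *\<^sub>R G R \<xi> + (-1) *\<^sub>R G R \<xi>)))\<^sup>2) \<partial>lborel) \<longlongrightarrow> 0) at_top"
    by (rule L2_limits_combine[OF _ _ Gm Gm lim]) auto
  then have "((\<lambda>R::real. \<integral>\<^sup>+\<xi>. ennreal ((norm (g \<xi> - g' \<xi>))\<^sup>2) \<partial>lborel) \<longlongrightarrow> 0) at_top"
    by simp
  then have "(\<integral>\<^sup>+\<xi>. ennreal ((norm (g \<xi> - g' \<xi>))\<^sup>2) \<partial>lborel) = 0"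
    by (simp add: tendsto_const_iff)
  then show ?thesis
    by (subst (asm) nn_integral_0_iff_AE) auto
qed

lemma fourier_L2_lincomb:
  assumes "fourier_L2 f g" "fourier_L2 f' g'"
  shows "fourier_L2 (\<lambda>x. a * f x + b * f' x) (\<lambda>\<xi>. a *\<^sub>R g \<xi> + b *\<^sub>R g' \<xi>)"
proof -
  define G where "G f R \<xi> = (LBINT x:{-R..R}. cis (- (x * \<xi>)) * complex_of_real (f x))" for f R \<xi>
  have sq: "square_integrable f" "square_integrable g" "square_integrable f'" "square_integrable g'"
    and lim: "((\<lambda>R. \<integral>\<^sup>+\<xi>. ennreal ((norm (g \<xi> - G f R \<xi>))\<^sup>2) \<partial>lborel) \<longlongrightarrow> 0) at_top"
      "((\<lambda>R. \<integral>\<^sup>+\<xi>. ennreal ((norm (g' \<xi> - G f' R \<xi>))\<^sup>2) \<partial>lborel) \<longlongrightarrow> 0) at_top"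
    using assms by (auto simp: fourier_L2_def G_def)
  have [measurable]: "f \<in> borel_measurable borel" "g \<in> borel_measurable borel"
    "f' \<in> borel_measurable borel" "g' \<in> borel_measurable borel"
    using sq by (auto simp: square_integrable_def)
  have Gm: "G h R \<in> borel_measurable borel" if "h \<in> borel_measurable borel" for h R
    using truncated_fourier_measurable[OF that, of R] by (simp add: G_def[abs_def])
  have int: "set_integrable lborel {-R..R} (\<lambda>x. cis (- (x * \<xi>)) * complex_of_real (h x))"
    if "square_integrable h" for h R \<xi>
  proof -
    have [measurable]: "h \<in> borel_measurable borel" using that by (simp add: square_integrable_def)
    show ?thesis
      using square_integrable_truncation[OF that, of R] unfolding set_integrable_def
      by (rule Bochner_Integration.integrable_bound) (auto simp: norm_mult)
  qed
  have "G (\<lambda>x. a * f x + b * f' x) R \<xi> = a *\<^sub>R G f R \<xi> + b *\<^sub>R G f' R \<xi>" for R \<xi>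
  proof -
    have "G (\<lambda>x. a * f x + b * f' x) R \<xi> = (LBINT x:{-R..R}.
        a *\<^sub>R (cis (- (x * \<xi>)) * complex_of_real (f x)) + b *\<^sub>R (cis (- (x * \<xi>)) * complex_of_real (f' x)))"
      unfolding G_def by (intro set_lebesgue_integral_cong) (auto simp: scaleR_conv_of_real algebra_simps)
    also have "\<dots> = a *\<^sub>R G f R \<xi> + b *\<^sub>R G f' R \<xi>"
      unfolding G_def using int[OF sq(1)] int[OF sq(3)]
      by (subst set_integral_add) (auto simp: set_integral_scaleR_right)
    finally show ?thesis .
  qed
  moreover have "((\<lambda>R. \<integral>\<^sup>+\<xi>. ennreal ((norm ((a *\<^sub>R g \<xi> + b *\<^sub>R g' \<xi>) - (a *\<^sub>R G f R \<xi> + b *\<^sub>R G f' R \<xi>)))\<^sup>2) \<partial>lborel) \<longlongrightarrow> 0) at_top"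
    by (rule L2_limits_combine[OF _ _ Gm Gm lim]) auto
  moreover have "square_integrable (\<lambda>x. a * f x + b * f' x)"
    using square_integrable_add[OF square_integrable_scaleR[OF sq(1), of a] square_integrable_scaleR[OF sq(3), of b]] by simp
  moreover have "square_integrable (\<lambda>x. a *\<^sub>R g x + b *\<^sub>R g' x)"
    by (intro square_integrable_add square_integrable_scaleR sq)
  ultimately show ?thesis unfolding fourier_L2_def G_def[symmetric] by simp
qed

lemma sobolev_lincomb:
  assumes "f \<in> sobolev \<sigma>" "f' \<in> sobolev \<sigma>"
  shows "(\<lambda>x. a * f x + b * f' x) \<in> sobolev \<sigma>"
proof -
  let ?w = "\<lambda>\<xi>. complex_of_real ((1 + \<xi>\<^sup>2) powr (\<sigma> / 2))"
  obtain g g' where g: "fourier_L2 f g" "square_integrable (\<lambda>\<xi>. ?w \<xi> * g \<xi>)"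
    "fourier_L2 f' g'" "square_integrable (\<lambda>\<xi>. ?w \<xi> * g' \<xi>)"
    using assms unfolding sobolev_def by auto
  have "square_integrable (\<lambda>\<xi>. a *\<^sub>R (?w \<xi> * g \<xi>) + b *\<^sub>R (?w \<xi> * g' \<xi>))"
    by (intro square_integrable_add square_integrable_scaleR g)
  then have "square_integrable (\<lambda>\<xi>. ?w \<xi> * (a *\<^sub>R g \<xi> + b *\<^sub>R g' \<xi>))"
    by (simp add: algebra_simps)
  with fourier_L2_lincomb[OF g(1,3), of a b] show ?thesis unfolding sobolev_def by blast
qed

text \<open>
  The Sobolev norm is defined by an arbitrarily chosen transform; by uniqueness this choice inherits
  the integrability that membership in \<open>sobolev \<sigma>\<close> provides for some transform.
\<close>

lemma sobolev_fourier:
  assumes "f \<in> sobolev \<sigma>"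
  obtains g where "fourier_L2 f g"
    "integrable lborel (\<lambda>\<xi>. (1 + \<xi>\<^sup>2) powr \<sigma> * (norm (g \<xi>))\<^sup>2)"
    "(LINT \<xi>|lborel. (1 + \<xi>\<^sup>2) powr \<sigma> * (norm (g \<xi>))\<^sup>2) = (sobolev_norm \<sigma> f)\<^sup>2"
    "sobolev_norm \<sigma> f \<ge> 0"
proof -
  obtain g' where g': "fourier_L2 f g'"
    "square_integrable (\<lambda>\<xi>. complex_of_real ((1 + \<xi>\<^sup>2) powr (\<sigma> / 2)) * g' \<xi>)"
    using assms unfolding sobolev_def by auto
  define g where "g = (SOME g. fourier_L2 f g)"
  have g: "fourier_L2 f g" unfolding g_def by (rule someI[of "fourier_L2 f", OF g'(1)])
  have [measurable]: "g \<in> borel_measurable borel" "g' \<in> borel_measurable borel"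
    using g g' by (auto simp: fourier_L2_def square_integrable_def)
  have eq: "(norm (complex_of_real ((1 + \<xi>\<^sup>2) powr (\<sigma> / 2)) * g' \<xi>))\<^sup>2 = (1 + \<xi>\<^sup>2) powr \<sigma> * (norm (g' \<xi>))\<^sup>2" for \<xi>
  proof -
    have "((1 + \<xi>\<^sup>2) powr (\<sigma> / 2))\<^sup>2 = (1 + \<xi>\<^sup>2) powr \<sigma>"
      by (simp add: power2_eq_square powr_add[symmetric])
    then show ?thesis by (simp add: norm_mult power_mult_distrib)
  qed
  have "integrable lborel (\<lambda>\<xi>. (1 + \<xi>\<^sup>2) powr \<sigma> * (norm (g' \<xi>))\<^sup>2)"
    using g'(2) unfolding square_integrable_def eq by simp
  then have int: "integrable lborel (\<lambda>\<xi>. (1 + \<xi>\<^sup>2) powr \<sigma> * (norm (g \<xi>))\<^sup>2)"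
    by (rule integrable_cong_AE_imp) (use fourier_L2_unique[OF g g'(1)] in auto)
  have n: "sobolev_norm \<sigma> f = sqrt (LINT \<xi>|lborel. (1 + \<xi>\<^sup>2) powr \<sigma> * (norm (g \<xi>))\<^sup>2)"
    unfolding sobolev_norm_def g_def Let_def ..
  moreover have "(LINT \<xi>|lborel. (1 + \<xi>\<^sup>2) powr \<sigma> * (norm (g \<xi>))\<^sup>2) \<ge> 0"
    by (rule Bochner_Integration.integral_nonneg) auto
  ultimately show ?thesis using that[OF g int] by simp
qed

lemma integrable_japanese_bracket:
  fixes \<alpha> :: real
  assumes "\<alpha> > 1 / 2"
  shows "integrable lborel (\<lambda>\<xi>. (1 + \<xi>\<^sup>2) powr (- \<alpha>))"
proof -
  let ?f = "\<lambda>x::real. indicator {1..} x * x powr (- 2 * \<alpha>)"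
  have "(\<integral>\<^sup>+x. ennreal (x powr (- 2 * \<alpha>)) * indicator {1..} x \<partial>lborel) = ennreal (0 - (1 powr (1 - 2 * \<alpha>) / (1 - 2 * \<alpha>)))"
  proof (rule nn_integral_FTC_atLeast[where F = "\<lambda>x. x powr (1 - 2 * \<alpha>) / (1 - 2 * \<alpha>)"])
    show "((\<lambda>x. x powr (1 - 2 * \<alpha>) / (1 - 2 * \<alpha>)) has_real_derivative x powr (- 2 * \<alpha>)) (at x)" if "1 \<le> x" for x
      using that assms by (auto intro!: derivative_eq_intros)
    show "((\<lambda>x. x powr (1 - 2 * \<alpha>) / (1 - 2 * \<alpha>)) \<longlongrightarrow> 0) at_top"
      using assms by real_asymp
  qed auto
  then have fin: "(\<integral>\<^sup>+x. ennreal (norm (?f x)) \<partial>lborel) < \<infinity>"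
    by (subst nn_integral_cong[where v = "\<lambda>x. ennreal (x powr (- 2 * \<alpha>)) * indicator {1..} x"])
       (auto simp: indicator_def)
  have f: "integrable lborel ?f" by (rule integrableI_bounded[OF _ fin]) auto
  have f': "integrable lborel (\<lambda>x. ?f (0 + (-1) * x))" by (rule lborel_integrable_real_affine[OF f]) auto
  have i: "integrable lborel (indicator {-1..1} :: real \<Rightarrow> real)"
    by (rule integrable_real_indicator) (auto simp: emeasure_lborel_Icc_eq)
  show ?thesis
  proof (rule Bochner_Integration.integrable_bound[OF Bochner_Integration.integrable_add[OF i Bochner_Integration.integrable_add[OF f f']]])
    show "AE \<xi> in lborel. norm ((1 + \<xi>\<^sup>2) powr (- \<alpha>)) \<le> norm (indicator {-1..1} \<xi> + (?f \<xi> + ?f (0 + (-1) * \<xi>)))"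
    proof (rule AE_I2)
      fix \<xi> :: real
      have big: "(1 + \<xi>\<^sup>2) powr (- \<alpha>) \<le> \<bar>\<xi>\<bar> powr (- 2 * \<alpha>)" if "\<bar>\<xi>\<bar> \<ge> 1"
      proof -
        have "(1 + \<xi>\<^sup>2) powr (- \<alpha>) \<le> (\<xi>\<^sup>2) powr (- \<alpha>)"
          using that assms by (intro powr_mono2') auto
        also have "(\<xi>\<^sup>2) powr (- \<alpha>) = (\<bar>\<xi>\<bar> powr 2) powr (- \<alpha>)" using that by simp
        also have "\<dots> = \<bar>\<xi>\<bar> powr (- 2 * \<alpha>)" by (subst powr_powr) simp
        finally show ?thesis .
      qed
      have small: "(1 + \<xi>\<^sup>2) powr (- \<alpha>) \<le> 1" 
        using assms powr_mono2'[of "- \<alpha>" 1 "1 + \<xi>\<^sup>2"] by auto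
      consider "\<xi> \<in> {-1..1}" | "\<xi> > 1" | "\<xi> < -1" by fastforce
      then show "norm ((1 + \<xi>\<^sup>2) powr (- \<alpha>)) \<le> norm (indicator {-1..1} \<xi> + (?f \<xi> + ?f (0 + (-1) * \<xi>)))"
        by cases (use small big in \<open>auto simp: indicator_def\<close>)
    qed
  qed auto
qed

text \<open>
  The key estimate of Sobolev embedding: $|\xi|^k |g|$ is the product of
  $(1+\xi^2)^{\sigma/2}|g|$ and a function bounded by $(1+\xi^2)^{(k-\sigma)/2}$, and the latter is
  square-integrable as $\sigma - k > 1/2$.
\<close>

lemma sobolev_weighted_L1:
  fixes k :: nat
  assumes "\<sigma> > k + 1 / 2"
  shows "\<exists>C\<ge>0. \<forall>f g. f \<in> sobolev \<sigma> \<longrightarrow> fourier_L2 f g \<longrightarrow>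
       integrable lborel (\<lambda>\<xi>. \<bar>\<xi>\<bar> ^ k * norm (g \<xi>)) \<and>
       (LINT \<xi>|lborel. \<bar>\<xi>\<bar> ^ k * norm (g \<xi>)) \<le> C * sobolev_norm \<sigma> f"
proof -
  define A where "A = (LINT \<xi>|lborel. (1 + \<xi>\<^sup>2) powr (k - \<sigma>))"
  have A: "A \<ge> 0" unfolding A_def by (rule Bochner_Integration.integral_nonneg) auto
  have iA: "integrable lborel (\<lambda>\<xi>. (1 + \<xi>\<^sup>2) powr (k - \<sigma>))"
    using integrable_japanese_bracket[of "\<sigma> - k"] assms by simp
  have main: "integrable lborel (\<lambda>\<xi>. \<bar>\<xi>\<bar> ^ k * norm (g \<xi>)) \<and>
       (LINT \<xi>|lborel. \<bar>\<xi>\<bar> ^ k * norm (g \<xi>)) \<le> (A + 1) / 2 * sobolev_norm \<sigma> f"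
    if f: "f \<in> sobolev \<sigma>" and g: "fourier_L2 f g" for f g
  proof -
    define N where "N = sobolev_norm \<sigma> f"
    obtain g0 where g0: "fourier_L2 f g0"
      "integrable lborel (\<lambda>\<xi>. (1 + \<xi>\<^sup>2) powr \<sigma> * (norm (g0 \<xi>))\<^sup>2)"
      "(LINT \<xi>|lborel. (1 + \<xi>\<^sup>2) powr \<sigma> * (norm (g0 \<xi>))\<^sup>2) = N\<^sup>2" and N: "N \<ge> 0"
      unfolding N_def by (rule sobolev_fourier[OF f])
    have [measurable]: "g \<in> borel_measurable borel" "g0 \<in> borel_measurable borel"
      using g g0 by (auto simp: fourier_L2_def square_integrable_def)
    have ae: "AE \<xi> in lborel. g0 \<xi> = g \<xi>" by (rule fourier_L2_unique[OF g0(1) g])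
    have i2: "integrable lborel (\<lambda>\<xi>. (1 + \<xi>\<^sup>2) powr \<sigma> * (norm (g \<xi>))\<^sup>2)"
      by (rule integrable_cong_AE_imp[OF g0(2)]) (use ae in auto)
    have N2: "(LINT \<xi>|lborel. (1 + \<xi>\<^sup>2) powr \<sigma> * (norm (g \<xi>))\<^sup>2) = N\<^sup>2"
      unfolding g0(3)[symmetric] by (rule integral_cong_AE) (use ae in auto)
    have pw: "\<bar>\<xi>\<bar> ^ k * norm (g \<xi>) \<le> (l * (1 + \<xi>\<^sup>2) powr (k - \<sigma>) + ((1 + \<xi>\<^sup>2) powr \<sigma> * (norm (g \<xi>))\<^sup>2) / l) / 2"
      if l: "l > 0" for l \<xi>
    proof -
      let ?b = "1 + \<xi>\<^sup>2"
      have b: "?b > 0" by (simp add: add_pos_nonneg)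
      have "\<bar>\<xi>\<bar> ^ k \<le> sqrt ?b ^ k" by (intro power_mono real_le_rsqrt) auto
      also have "sqrt ?b ^ k = ?b powr (k / 2)"
        using b by (simp add: powr_half_sqrt[symmetric] powr_realpow[symmetric] powr_powr)
      also have "\<dots> = ?b powr ((k - \<sigma>) / 2) * ?b powr (\<sigma> / 2)"
        by (simp add: powr_add[symmetric] field_simps)
      finally have "\<bar>\<xi>\<bar> ^ k * norm (g \<xi>) \<le> ?b powr ((k - \<sigma>) / 2) * (?b powr (\<sigma> / 2) * norm (g \<xi>))"
        by (simp add: mult_right_mono mult.assoc[symmetric])
      also have "\<dots> \<le> (l * (?b powr ((k - \<sigma>) / 2))\<^sup>2 + (?b powr (\<sigma> / 2) * norm (g \<xi>))\<^sup>2 / l) / 2"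
        by (rule mult_le_weighted_squares[OF l])
      also have "(?b powr ((k - \<sigma>) / 2))\<^sup>2 = ?b powr (k - \<sigma>)"
        by (simp add: power2_eq_square powr_add[symmetric])
      also have "(?b powr (\<sigma> / 2) * norm (g \<xi>))\<^sup>2 = ?b powr \<sigma> * (norm (g \<xi>))\<^sup>2"
        by (simp add: power_mult_distrib power2_eq_square powr_add[symmetric])
      finally show ?thesis .
    qed
    have ib: "integrable lborel (\<lambda>\<xi>. (l * (1 + \<xi>\<^sup>2) powr (k - \<sigma>) + ((1 + \<xi>\<^sup>2) powr \<sigma> * (norm (g \<xi>))\<^sup>2) / l) / 2)" for l
      using iA i2 by auto
    have int: "integrable lborel (\<lambda>\<xi>. \<bar>\<xi>\<bar> ^ k * norm (g \<xi>))"
    proof (rule Bochner_Integration.integrable_bound[OF ib[of 1]])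
      show "AE \<xi> in lborel. norm (\<bar>\<xi>\<bar> ^ k * norm (g \<xi>))
          \<le> norm ((1 * (1 + \<xi>\<^sup>2) powr (k - \<sigma>) + ((1 + \<xi>\<^sup>2) powr \<sigma> * (norm (g \<xi>))\<^sup>2) / 1) / 2)"
        using pw[of 1] by (intro AE_I2) (simp add: abs_mult)
    qed auto
    let ?N1 = "LINT \<xi>|lborel. \<bar>\<xi>\<bar> ^ k * norm (g \<xi>)"
    have bd: "?N1 \<le> (l * A + N\<^sup>2 / l) / 2" if l: "l > 0" for l
    proof -
      have "?N1
        \<le> (LINT \<xi>|lborel. (l * (1 + \<xi>\<^sup>2) powr (k - \<sigma>) + ((1 + \<xi>\<^sup>2) powr \<sigma> * (norm (g \<xi>))\<^sup>2) / l) / 2)"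
        by (rule integral_mono[OF int ib pw[OF l]])
      also have "\<dots> = (l * A + N\<^sup>2 / l) / 2"
        using iA i2 by (simp add: A_def N2)
      finally show ?thesis .
    qed
    \<comment> \<open>choose \<open>l = N\<close>; if \<open>N = 0\<close>, then \<open>l\<close> may be arbitrarily small\<close>
    have "?N1 \<le> (A + 1) / 2 * N"
    proof (cases "N = 0")
      case False
      then show ?thesis using bd[of N] N by (simp add: power2_eq_square algebra_simps)
    next
      case True
      have "?N1 \<le> 0"
      proof (rule field_le_epsilon)
        fix e :: real assume "e > 0"
        have "?N1 \<le> (e / (A + 1) * A) / 2"
          using bd[of "e / (A + 1)"] \<open>e > 0\<close> A True by simp
        also have "\<dots> \<le> 0 + e" using \<open>e > 0\<close> A by (simp add: field_simps mult_left_mono)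
        finally show "?N1 \<le> 0 + e" .
      qed
      with True show ?thesis by simp
    qed
    with int show ?thesis by (simp add: N_def)
  qed
  show ?thesis by (rule exI[of _ "(A + 1) / 2"]) (use A main in auto)
qed

lemma sobolev_weighted_L1_integrable:
  fixes k :: nat
  assumes "\<sigma> > k + 1 / 2" "f \<in> sobolev \<sigma>" "fourier_L2 f g"
  shows "integrable lborel (\<lambda>\<xi>. \<bar>\<xi>\<bar> ^ k * norm (g \<xi>))"
  using sobolev_weighted_L1[OF assms(1)] assms(2,3) by blast

text \<open>
  The real part of the inverse Fourier integral of \<open>G\<close>.
\<close>

definition synthesis :: "(real \<Rightarrow> complex) \<Rightarrow> real \<Rightarrow> real" where
  "synthesis G x = (LINT \<xi>|lborel. Re (G \<xi> * cis (x * \<xi>))) / (2 * pi)"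

lemma norm_cis_diff_le: "norm (cis a - cis b) \<le> \<bar>a - b\<bar>"
proof -
  have "cis a - cis b = cis b * (cis (a - b) - 1)"
    by (simp add: right_diff_distrib cis_mult)
  moreover have "norm (cis (a - b) - 1) \<le> \<bar>a - b\<bar>"
    using iexp_approx1[of "a - b" 0] by (simp add: cis_conv_exp)
  ultimately show ?thesis by (simp add: norm_mult)
qed

lemma synthesis_integrable:
  assumes "integrable lborel G"
  shows "integrable lborel (\<lambda>\<xi>. Re (G \<xi> * cis (x * \<xi>)))"
proof (rule Bochner_Integration.integrable_bound[OF assms])
  have [measurable]: "G \<in> borel_measurable borel" using assms by auto
  show "(\<lambda>\<xi>. Re (G \<xi> * cis (x * \<xi>))) \<in> borel_measurable lborel" by measurable
  show "AE \<xi> in lborel. norm (Re (G \<xi> * cis (x * \<xi>))) \<le> norm (G \<xi>)"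
    using abs_Re_le_cmod[of "G _ * cis _"] by (auto simp: norm_mult)
qed

lemma abs_synthesis_le:
  assumes "integrable lborel G"
  shows "\<bar>synthesis G x\<bar> \<le> (LINT \<xi>|lborel. norm (G \<xi>))"
proof -
  have "\<bar>LINT \<xi>|lborel. Re (G \<xi> * cis (x * \<xi>))\<bar> \<le> (LINT \<xi>|lborel. \<bar>Re (G \<xi> * cis (x * \<xi>))\<bar>)"
    by (rule integral_abs_bound)
  also have "\<dots> \<le> (LINT \<xi>|lborel. norm (G \<xi>))"
    using abs_Re_le_cmod[of "G _ * cis _"] assms
    by (intro integral_mono integrable_abs synthesis_integrable) (auto simp: norm_mult)
  finally have 1: "\<bar>LINT \<xi>|lborel. Re (G \<xi> * cis (x * \<xi>))\<bar> \<le> (LINT \<xi>|lborel. norm (G \<xi>))" .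
  have "\<bar>synthesis G x\<bar> = \<bar>LINT \<xi>|lborel. Re (G \<xi> * cis (x * \<xi>))\<bar> / (2 * pi)"
    by (simp add: synthesis_def)
  also have "\<dots> \<le> \<bar>LINT \<xi>|lborel. Re (G \<xi> * cis (x * \<xi>))\<bar> / 1"
    using pi_gt3 by (intro divide_left_mono) auto
  finally show ?thesis using 1 by simp
qed

lemma continuous_on_synthesis:
  assumes "integrable lborel G"
  shows "continuous_on UNIV (synthesis G)"
  unfolding continuous_on_sequentially
proof (intro ballI allI impI; elim conjE)
  fix X :: "nat \<Rightarrow> real" and a assume X: "X \<longlonglongrightarrow> a"
  have [measurable]: "G \<in> borel_measurable borel" using assms by auto
  have "(\<lambda>n. LINT \<xi>|lborel. Re (G \<xi> * cis (X n * \<xi>))) \<longlonglongrightarrow> (LINT \<xi>|lborel. Re (G \<xi> * cis (a * \<xi>)))"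
  proof (rule integral_dominated_convergence[where w = "\<lambda>\<xi>. norm (G \<xi>)"])
    show "AE \<xi> in lborel. (\<lambda>n. Re (G \<xi> * cis (X n * \<xi>))) \<longlonglongrightarrow> Re (G \<xi> * cis (a * \<xi>))"
      by (intro AE_I2 tendsto_intros X)
    show "AE \<xi> in lborel. norm (Re (G \<xi> * cis (X n * \<xi>))) \<le> norm (G \<xi>)" for n
      using abs_Re_le_cmod[of "G _ * cis _"] by (auto simp: norm_mult)
  qed (use assms in auto)
  then show "(synthesis G \<circ> X) \<longlonglongrightarrow> synthesis G a"
    unfolding synthesis_def o_def by (intro tendsto_intros) auto
qed

lemma synthesis_deriv:
  assumes G: "integrable lborel G" and xG: "integrable lborel (\<lambda>\<xi>. \<i> * complex_of_real \<xi> * G \<xi>)"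
  shows "(synthesis G has_real_derivative synthesis (\<lambda>\<xi>. \<i> * complex_of_real \<xi> * G \<xi>) x) (at x)"
  unfolding DERIV_def tendsto_at_iff_sequentially
proof (intro allI impI)
  fix X :: "nat \<Rightarrow> real" assume X: "\<forall>i. X i \<in> UNIV - {0}" "X \<longlonglongrightarrow> 0"
  have [measurable]: "G \<in> borel_measurable borel" using assms by auto
  let ?q = "\<lambda>n \<xi>. (Re (G \<xi> * cis ((x + X n) * \<xi>)) - Re (G \<xi> * cis (x * \<xi>))) / X n"
  have "(\<lambda>n. LINT \<xi>|lborel. ?q n \<xi>) \<longlonglongrightarrow> (LINT \<xi>|lborel. Re (\<i> * complex_of_real \<xi> * G \<xi> * cis (x * \<xi>)))"
  proof (rule integral_dominated_convergence[where w = "\<lambda>\<xi>. norm (\<i> * complex_of_real \<xi> * G \<xi>)"])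
    show "AE \<xi> in lborel. (\<lambda>n. ?q n \<xi>) \<longlonglongrightarrow> Re (\<i> * complex_of_real \<xi> * G \<xi> * cis (x * \<xi>))"
    proof (rule AE_I2)
      fix \<xi>
      have "((\<lambda>y. Re (G \<xi> * cis (y * \<xi>))) has_real_derivative Re (\<i> * complex_of_real \<xi> * G \<xi> * cis (x * \<xi>))) (at x)"
        by (auto intro!: derivative_eq_intros simp: algebra_simps)
      then show "(\<lambda>n. ?q n \<xi>) \<longlonglongrightarrow> Re (\<i> * complex_of_real \<xi> * G \<xi> * cis (x * \<xi>))"
        unfolding DERIV_def tendsto_at_iff_sequentially o_def using X by blast
    qed
    show "AE \<xi> in lborel. norm (?q n \<xi>) \<le> norm (\<i> * complex_of_real \<xi> * G \<xi>)" for n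
    proof (rule AE_I2)
      fix \<xi>
      have "\<bar>Re (G \<xi> * cis ((x + X n) * \<xi>)) - Re (G \<xi> * cis (x * \<xi>))\<bar>
          = \<bar>Re (G \<xi> * (cis ((x + X n) * \<xi>) - cis (x * \<xi>)))\<bar>" by (simp add: algebra_simps)
      also have "\<dots> \<le> norm (G \<xi>) * norm (cis ((x + X n) * \<xi>) - cis (x * \<xi>))"
        using abs_Re_le_cmod by (metis norm_mult)
      also have "\<dots> \<le> norm (G \<xi>) * (\<bar>X n\<bar> * \<bar>\<xi>\<bar>)"
        using norm_cis_diff_le[of "(x + X n) * \<xi>" "x * \<xi>"]
        by (intro mult_left_mono) (auto simp: algebra_simps abs_mult)
      finally have "\<bar>Re (G \<xi> * cis ((x + X n) * \<xi>)) - Re (G \<xi> * cis (x * \<xi>))\<bar> \<le> norm (G \<xi>) * (\<bar>X n\<bar> * \<bar>\<xi>\<bar>)" .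
      moreover have "X n \<noteq> 0" using X by auto
      ultimately show "norm (?q n \<xi>) \<le> norm (\<i> * complex_of_real \<xi> * G \<xi>)"
        by (simp add: norm_mult divide_le_eq mult_ac)
    qed
  qed (use xG in auto)
  then have "(\<lambda>n. (LINT \<xi>|lborel. ?q n \<xi>) / (2 * pi)) \<longlonglongrightarrow> synthesis (\<lambda>\<xi>. \<i> * complex_of_real \<xi> * G \<xi>) x"
    unfolding synthesis_def[of "\<lambda>\<xi>. \<i> * complex_of_real \<xi> * G \<xi>"]
    by (intro tendsto_divide tendsto_const) auto
  moreover have "(LINT \<xi>|lborel. ?q n \<xi>) / (2 * pi) = (synthesis G (x + X n) - synthesis G x) / X n" for n
    unfolding synthesis_def integral_divide_zero diff_divide_distrib[symmetric]
      Bochner_Integration.integral_diff[OF synthesis_integrable[OF G] synthesis_integrable[OF G]]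
    by (simp only: divide_divide_eq_left mult.commute)
  ultimately have "(\<lambda>n. (synthesis G (x + X n) - synthesis G x) / X n) \<longlonglongrightarrow> synthesis (\<lambda>\<xi>. \<i> * complex_of_real \<xi> * G \<xi>) x"
    by (simp only:)
  then show "((\<lambda>h. (synthesis G (x + h) - synthesis G x) / h) \<circ> X) \<longlonglongrightarrow> synthesis (\<lambda>\<xi>. \<i> * complex_of_real \<xi> * G \<xi>) x"
    unfolding o_def .
qed

lemma sobolev_synthesis:
  assumes "\<sigma> > 1 / 2" "f \<in> sobolev \<sigma>" "fourier_L2 f g"
    and cont: "continuous_on UNIV f0" and ae: "AE x in lborel. f x = f0 x"
  shows "f0 = synthesis g" "integrable lborel g"
proof -
  have [measurable]: "g \<in> borel_measurable borel"
    using assms(3) by (auto simp: fourier_L2_def square_integrable_def)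
  have "integrable lborel (\<lambda>\<xi>. \<bar>\<xi>\<bar> ^ 0 * norm (g \<xi>))"
    by (rule sobolev_weighted_L1_integrable[OF _ assms(2,3)]) (use assms(1) in simp)
  then show g: "integrable lborel g" by (simp add: integrable_norm_iff)
  show "f0 = synthesis g"
  proof
    fix a
    have "synthesis g a = Re (LINT \<xi>|lborel. g \<xi> * cis (a * \<xi>)) / (2 * pi)"
    proof -
      have "integrable lborel (\<lambda>\<xi>. g \<xi> * cis (a * \<xi>))"
        by (rule Bochner_Integration.integrable_bound[OF g]) (auto simp: norm_mult)
      then show ?thesis unfolding synthesis_def by (simp only: integral_Re)
    qed
    then show "f0 a = synthesis g a"
      unfolding fourier_L2_inversion[OF assms(3) g cont ae] by simp
  qed
qed

lemma integrable_power_mult: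
  assumes [measurable]: "g \<in> borel_measurable borel"
    and "integrable lborel (\<lambda>\<xi>. \<bar>\<xi>\<bar> ^ k * norm (g \<xi> :: complex))"
  shows "integrable lborel (\<lambda>\<xi>. (\<i> * complex_of_real \<xi>) ^ k * g \<xi>)"
  by (rule Bochner_Integration.integrable_bound[OF assms(2)]) (auto simp: norm_mult norm_power)

text \<open>
  Here \<open>f\<close> stands for its class and \<open>f0\<close> for the continuous representative.  The constant depends on
  \<open>\<sigma>\<close> only, so that convergence in the Sobolev norm implies uniform convergence.
\<close>

theorem sobolev_embedding_bounded:
  assumes "\<sigma> > 1 / 2"
  shows "\<exists>C\<ge>0. \<forall>f f0 x. f \<in> sobolev \<sigma> \<longrightarrow> continuous_on UNIV f0 \<longrightarrow> (AE x in lborel. f x = f0 x) \<longrightarrow>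
       \<bar>f0 x\<bar> \<le> C * sobolev_norm \<sigma> f"
proof -
  have s: "\<sigma> > real 0 + 1 / 2" using assms by simp
  obtain C where C: "C \<ge> 0"
    "\<forall>f g. f \<in> sobolev \<sigma> \<longrightarrow> fourier_L2 f g \<longrightarrow>
       integrable lborel (\<lambda>\<xi>. \<bar>\<xi>\<bar> ^ 0 * norm (g \<xi>)) \<and>
       (LINT \<xi>|lborel. \<bar>\<xi>\<bar> ^ 0 * norm (g \<xi>)) \<le> C * sobolev_norm \<sigma> f"
    using sobolev_weighted_L1[OF s] by blast
  show ?thesis
  proof (rule exI[of _ C], rule conjI[OF C(1)], intro allI impI)
    fix f f0 x
    assume f: "f \<in> sobolev \<sigma>" and f0: "continuous_on UNIV f0" "AE x in lborel. f x = f0 x"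
    obtain g where g: "fourier_L2 f g" by (rule sobolev_fourier[OF f])
    note * = sobolev_synthesis[OF assms f g f0]
    show "\<bar>f0 x\<bar> \<le> C * sobolev_norm \<sigma> f"
      using abs_synthesis_le[OF *(2), of x] C(2)[rule_format, OF f g] unfolding *(1)[symmetric] by simp
  qed
qed

theorem sobolev_embedding_C1:
  assumes "\<sigma> > 3 / 2"
  shows "\<exists>C\<ge>0. \<forall>f f0 x. f \<in> sobolev \<sigma> \<longrightarrow> continuous_on UNIV f0 \<longrightarrow> (AE x in lborel. f x = f0 x) \<longrightarrow>
       (f0 has_real_derivative deriv f0 x) (at x) \<and> \<bar>deriv f0 x\<bar> \<le> C * sobolev_norm \<sigma> f"
proof -
  have s: "\<sigma> > real 1 + 1 / 2" using assms by simp
  obtain C where C: "C \<ge> 0"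
    "\<forall>f g. f \<in> sobolev \<sigma> \<longrightarrow> fourier_L2 f g \<longrightarrow>
       integrable lborel (\<lambda>\<xi>. \<bar>\<xi>\<bar> ^ 1 * norm (g \<xi>)) \<and>
       (LINT \<xi>|lborel. \<bar>\<xi>\<bar> ^ 1 * norm (g \<xi>)) \<le> C * sobolev_norm \<sigma> f"
    using sobolev_weighted_L1[OF s] by blast
  show ?thesis
  proof (rule exI[of _ C], rule conjI[OF C(1)], intro allI impI)
    fix f f0 x
    assume f: "f \<in> sobolev \<sigma>" and f0: "continuous_on UNIV f0" "AE x in lborel. f x = f0 x"
    obtain g where g: "fourier_L2 f g" by (rule sobolev_fourier[OF f])
    have [measurable]: "g \<in> borel_measurable borel"
      using g by (auto simp: fourier_L2_def square_integrable_def)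
    have *: "f0 = synthesis g" "integrable lborel g"
      using sobolev_synthesis[OF _ f g f0] assms by auto
    have i: "integrable lborel (\<lambda>\<xi>. \<i> * complex_of_real \<xi> * g \<xi>)"
      using integrable_power_mult[of g 1] C(2)[rule_format, OF f g] by simp
    have d: "(f0 has_real_derivative synthesis (\<lambda>\<xi>. \<i> * complex_of_real \<xi> * g \<xi>) x) (at x)"
      unfolding *(1) by (rule synthesis_deriv[OF *(2) i])
    then have "deriv f0 x = synthesis (\<lambda>\<xi>. \<i> * complex_of_real \<xi> * g \<xi>) x" by (rule DERIV_imp_deriv)
    with d show "(f0 has_real_derivative deriv f0 x) (at x) \<and> \<bar>deriv f0 x\<bar> \<le> C * sobolev_norm \<sigma> f"
      using abs_synthesis_le[OF i, of x] C(2)[rule_format, OF f g] by (simp add: norm_mult)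
  qed
qed

theorem sobolev_embedding_C2:
  assumes "\<sigma> > 5 / 2" and f: "f \<in> sobolev \<sigma>" and f0: "continuous_on UNIV f0" "AE x in lborel. f x = f0 x"
  shows "(deriv f0 has_real_derivative deriv (deriv f0) x) (at x)"
    and "continuous_on UNIV (deriv (deriv f0))"
proof -
  obtain g where g: "fourier_L2 f g" by (rule sobolev_fourier[OF f])
  have [measurable]: "g \<in> borel_measurable borel"
    using g by (auto simp: fourier_L2_def square_integrable_def)
  have *: "f0 = synthesis g" "integrable lborel g"
    using sobolev_synthesis[OF _ f g f0] assms by auto
  have i1: "integrable lborel (\<lambda>\<xi>. \<i> * complex_of_real \<xi> * g \<xi>)"
    using integrable_power_mult[of g 1] sobolev_weighted_L1_integrable[OF _ f g, of 1] assms(1) by simp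
  have i2: "integrable lborel (\<lambda>\<xi>. \<i> * complex_of_real \<xi> * (\<i> * complex_of_real \<xi> * g \<xi>))"
    using integrable_power_mult[of g 2] sobolev_weighted_L1_integrable[OF _ f g, of 2] assms(1)
    by (simp add: power2_eq_square mult.assoc)
  have "deriv f0 x = synthesis (\<lambda>\<xi>. \<i> * complex_of_real \<xi> * g \<xi>) x" for x
    unfolding *(1) by (intro DERIV_imp_deriv synthesis_deriv[OF *(2) i1])
  then have 1: "deriv f0 = synthesis (\<lambda>\<xi>. \<i> * complex_of_real \<xi> * g \<xi>)" by (rule ext)
  have d: "(deriv f0 has_real_derivative synthesis (\<lambda>\<xi>. \<i> * complex_of_real \<xi> * (\<i> * complex_of_real \<xi> * g \<xi>)) x) (at x)" for x
    unfolding 1 by (rule synthesis_deriv[OF i1 i2])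
  then have 2: "deriv (deriv f0) = synthesis (\<lambda>\<xi>. \<i> * complex_of_real \<xi> * (\<i> * complex_of_real \<xi> * g \<xi>))"
    by (intro ext DERIV_imp_deriv)
  show "(deriv f0 has_real_derivative deriv (deriv f0) x) (at x)" unfolding 2 by (rule d)
  show "continuous_on UNIV (deriv (deriv f0))" unfolding 2 by (rule continuous_on_synthesis[OF i2])
qed

section \<open>Differential inequalities and one-sided exponential averages\<close>

text \<open>
  Monotonicity from one-sided information: at the ends of the time interval only derivatives within
  the interval exist.
\<close>

lemma nondecreasing_of_deriv_within:
  fixes f f' :: "real \<Rightarrow> real"
  assumes "a \<le> b" "{a..b} \<subseteq> S"
    and "\<And>r. r \<in> {a..b} \<Longrightarrow> (f has_real_derivative f' r) (at r within S)"
    and "\<And>r. r \<in> {a..b} \<Longrightarrow> f' r \<ge> 0"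
  shows "f a \<le> f b"
proof (cases "a = b")
  case False
  with assms(1) have "a < b" by simp
  moreover have "(f has_derivative (\<lambda>h. f' r * h)) (at r within {a..b})" if "a \<le> r" "r \<le> b" for r
    using has_field_derivative_subset[OF assms(3) assms(2), of r] that
    by (simp add: has_field_derivative_def)
  ultimately obtain \<xi> where \<xi>: "\<xi> \<in> {a<..<b}" "f b - f a = f' \<xi> * (b - a)"
    using mvt_simple[of a b f "\<lambda>r h. f' r * h"] by auto
  moreover have "f' \<xi> * (b - a) \<ge> 0" using assms(4)[of \<xi>] \<xi>(1) \<open>a < b\<close> by simp
  ultimately show ?thesis by linarith
qed simp

lemma abs_diff_le_of_deriv_le:
  fixes f f' \<phi> \<phi>' :: "real \<Rightarrow> real"
  assumes "a \<le> b" "{a..b} \<subseteq> S"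
    and f: "\<And>r. r \<in> {a..b} \<Longrightarrow> (f has_real_derivative f' r) (at r within S)"
    and \<phi>: "\<And>r. r \<in> {a..b} \<Longrightarrow> (\<phi> has_real_derivative \<phi>' r) (at r within S)"
    and le: "\<And>r. r \<in> {a..b} \<Longrightarrow> \<bar>f' r\<bar> \<le> \<phi>' r"
  shows "\<bar>f b - f a\<bar> \<le> \<phi> b - \<phi> a"
proof -
  have "\<phi> a - f a \<le> \<phi> b - f b"
  proof (rule nondecreasing_of_deriv_within[OF assms(1,2)])
    fix r assume r: "r \<in> {a..b}"
    show "((\<lambda>x. \<phi> x - f x) has_real_derivative \<phi>' r - f' r) (at r within S)"
      by (rule DERIV_diff[OF \<phi>[OF r] f[OF r]])
    show "\<phi>' r - f' r \<ge> 0" using le[OF r] by linarith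
  qed
  moreover have "\<phi> a + f a \<le> \<phi> b + f b"
  proof (rule nondecreasing_of_deriv_within[OF assms(1,2)])
    fix r assume r: "r \<in> {a..b}"
    show "((\<lambda>x. \<phi> x + f x) has_real_derivative \<phi>' r + f' r) (at r within S)"
      by (rule DERIV_add[OF \<phi>[OF r] f[OF r]])
    show "\<phi>' r + f' r \<ge> 0" using le[OF r] by linarith
  qed
  ultimately show ?thesis by linarith
qed

text \<open>
  Gronwall's inequality for a family whose rates are controlled by the supremum over the family.
  Let \<open>Z\<close> be the supremum of $|f_i(t)|\, e^{-2K|t-t_0|}$ over all indices and times.  Integrating the
  derivative bound gives $Z \le \epsilon + ET + Z/2$, because the integral of $K e^{2Kr}$ is half of
  $e^{2Kr}$.  The argument works in both time directions.
\<close>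

lemma family_gronwall:
  fixes f f' :: "'i \<Rightarrow> real \<Rightarrow> real"
  assumes K: "K > 0" and E: "E \<ge> 0" and t0: "t0 \<in> {0..T}"
    and deriv: "\<And>i t. t \<in> {0..T} \<Longrightarrow> (f i has_real_derivative f' i t) (at t within {0..T})"
    and bdd: "\<And>i t. t \<in> {0..T} \<Longrightarrow> \<bar>f i t\<bar> \<le> A"
    and init: "\<And>i. \<bar>f i t0\<bar> \<le> \<epsilon>"
    and le: "\<And>i t Z. t \<in> {0..T} \<Longrightarrow> (\<And>j. \<bar>f j t\<bar> \<le> Z) \<Longrightarrow> \<bar>f' i t\<bar> \<le> K * Z + E"
    and t: "t \<in> {0..T}"
  shows "\<bar>f i t\<bar> \<le> 2 * (\<epsilon> + E * T) * exp (2 * K * T)"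
proof -
  define e where "e r = exp (2 * K * \<bar>r - t0\<bar>)" for r
  define V where "V = {\<bar>f i r\<bar> / e r | i r. r \<in> {0..T}}"
  define Z where "Z = Sup V"
  have e1: "e r \<ge> 1" for r using K by (simp add: e_def)
  have e0: "e r > 0" for r by (simp add: e_def)
  have "bdd_above V"
  proof (rule bdd_aboveI[of _ A])
    fix v assume "v \<in> V"
    then obtain i r where v: "v = \<bar>f i r\<bar> / e r" "r \<in> {0..T}" by (auto simp: V_def)
    have "\<bar>f i r\<bar> / e r \<le> \<bar>f i r\<bar> / 1" using e1[of r] by (intro divide_left_mono) auto
    with v bdd[of r i] show "v \<le> A" by simp
  qed
  then have Z: "\<bar>f i r\<bar> / e r \<le> Z" if "r \<in> {0..T}" for i r
    unfolding Z_def by (rule cSup_upper[rotated]) (use that in \<open>auto simp: V_def\<close>)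
  then have Z': "\<bar>f i r\<bar> \<le> Z * e r" if "r \<in> {0..T}" for i r
    using that e0[of r] by (simp add: divide_le_eq)
  have d: "\<bar>f' i r\<bar> \<le> K * (Z * e r) + E" if "r \<in> {0..T}" for i r
    using le[OF that, of "Z * e r"] Z'[OF that] by blast
  have Z0: "Z \<ge> 0" using Z[OF t0, of undefined] e0[of t0] by (meson abs_ge_zero divide_nonneg_pos order_trans)
  have step: "\<bar>f i r - f i t0\<bar> \<le> Z / 2 * (e r - 1) + E * \<bar>r - t0\<bar>" if r: "r \<in> {0..T}" for i r
  proof (cases "t0 \<le> r")
    case True
    have "\<bar>f i r - f i t0\<bar> \<le> (Z / 2 * exp (2 * K * (r - t0)) + E * r) - (Z / 2 * exp (2 * K * (t0 - t0)) + E * t0)"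
    proof (rule abs_diff_le_of_deriv_le[OF True, where S = "{0..T}" and f' = "f' i"
          and \<phi> = "\<lambda>r. Z / 2 * exp (2 * K * (r - t0)) + E * r"])
      fix q assume q: "q \<in> {t0..r}"
      then have q': "q \<in> {0..T}" using t0 r by auto
      show "(f i has_real_derivative f' i q) (at q within {0..T})" by (rule deriv[OF q'])
      show "((\<lambda>r. Z / 2 * exp (2 * K * (r - t0)) + E * r) has_real_derivative
          K * (Z * exp (2 * K * (q - t0))) + E) (at q within {0..T})"
        by (auto intro!: derivative_eq_intros)
      show "\<bar>f' i q\<bar> \<le> K * (Z * exp (2 * K * (q - t0))) + E"
        using d[OF q', of i] q by (simp add: e_def)
    qed (use t0 r in auto)
    then show ?thesis using True by (simp add: e_def algebra_simps)
  next
    case False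
    have "\<bar>f i t0 - f i r\<bar> \<le> (- Z / 2 * exp (2 * K * (t0 - t0)) + E * t0) - (- Z / 2 * exp (2 * K * (t0 - r)) + E * r)"
    proof (rule abs_diff_le_of_deriv_le[where S = "{0..T}" and f' = "f' i"
          and \<phi> = "\<lambda>r. - Z / 2 * exp (2 * K * (t0 - r)) + E * r"])
      fix q assume q: "q \<in> {r..t0}"
      then have q': "q \<in> {0..T}" using t0 r by auto
      show "(f i has_real_derivative f' i q) (at q within {0..T})" by (rule deriv[OF q'])
      show "((\<lambda>r. - Z / 2 * exp (2 * K * (t0 - r)) + E * r) has_real_derivative
          K * (Z * exp (2 * K * (t0 - q))) + E) (at q within {0..T})"
        by (auto intro!: derivative_eq_intros)
      show "\<bar>f' i q\<bar> \<le> K * (Z * exp (2 * K * (t0 - q))) + E"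
        using d[OF q', of i] q by (simp add: e_def)
    qed (use t0 r False in auto)
    then show ?thesis using False by (simp add: e_def algebra_simps abs_minus_commute)
  qed
  have key: "\<bar>f i r\<bar> / e r \<le> \<epsilon> + E * T + Z / 2" if r: "r \<in> {0..T}" for i r
  proof -
    have eps: "0 \<le> \<epsilon>" using init[of i] by linarith
    have "E * \<bar>r - t0\<bar> \<le> E * T" using r t0 E by (intro mult_left_mono) auto
    then have "\<bar>f i r\<bar> \<le> \<epsilon> + Z / 2 * e r + E * T"
    proof -
      have "Z / 2 * (e r - 1) \<le> Z / 2 * e r" using Z0 by (intro mult_left_mono) auto
      with \<open>E * \<bar>r - t0\<bar> \<le> E * T\<close> show ?thesis using step[OF r, of i] init[of i] by linarith
    qed
    also have "\<dots> \<le> (\<epsilon> + E * T + Z / 2) * e r"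
    proof -
      have "(\<epsilon> + E * T) * 1 \<le> (\<epsilon> + E * T) * e r"
        using e1[of r] eps E t0 by (intro mult_left_mono) auto
      then show ?thesis by (simp add: algebra_simps)
    qed
    finally show ?thesis using e0[of r] by (simp add: divide_le_eq)
  qed
  have "Z \<le> \<epsilon> + E * T + Z / 2"
    unfolding Z_def by (rule cSup_least) (use t0 key in \<open>auto simp: V_def Z_def\<close>)
  then have Zle: "Z \<le> 2 * (\<epsilon> + E * T)" by simp
  have "\<bar>f i t\<bar> \<le> Z * e t" by (rule Z'[OF t])
  also have "\<dots> \<le> (2 * (\<epsilon> + E * T)) * exp (2 * K * T)"
  proof (rule mult_mono[OF Zle])
    have "\<bar>t - t0\<bar> \<le> T" using t t0 by auto
    then show "e t \<le> exp (2 * K * T)" using K by (simp add: e_def)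
  qed (use Zle Z0 e0[of t] in auto)
  finally show ?thesis by simp
qed

text \<open>
  The functions $g \mp \frac{B}{\mu} e^{-\mu x}$ are monotone in opposite directions and enclose the
  limit of \<open>g\<close> at \<open>+\<infinity>\<close>.
\<close>

lemma limit_of_exp_decaying_deriv:
  fixes g g' :: "real \<Rightarrow> real"
  assumes d: "\<And>x. (g has_real_derivative g' x) (at x)"
    and le: "\<And>x. \<bar>g' x\<bar> \<le> B * exp (- \<mu> * x)" and \<mu>: "\<mu> > 0"
  obtains c where "\<And>x. \<bar>c - g x\<bar> \<le> B / \<mu> * exp (- \<mu> * x)"
proof -
  define b where "b x = B / \<mu> * exp (- \<mu> * x)" for x
  have B: "B \<ge> 0" using le[of 0] by simp
  have b0: "b x \<ge> 0" for x using B \<mu> by (simp add: b_def)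
  have db: "(b has_real_derivative - (B * exp (- \<mu> * x))) (at x)" for x
    unfolding b_def using \<mu> by (auto intro!: derivative_eq_intros)
  have mono: "\<bar>g y - g x\<bar> \<le> b x - b y" if "x \<le> y" for x y
    using abs_diff_le_of_deriv_le[OF that, of UNIV g g' "\<lambda>x. - b x" "\<lambda>x. B * exp (- \<mu> * x)"]
      d le DERIV_minus[OF db] by auto
  have cross: "g x - b x \<le> g y + b y" for x y
    using mono[of x y] mono[of y x] b0[of x] b0[of y] by (cases "x \<le> y") auto
  define c where "c = (SUP x. g x - b x)"
  have bdd: "bdd_above (range (\<lambda>x. g x - b x))"
    using cross[of _ 0] by (intro bdd_aboveI[of _ "g 0 + b 0"]) auto
  have "g x - b x \<le> c" for x unfolding c_def by (rule cSUP_upper[OF _ bdd]) simp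
  moreover have "c \<le> g x + b x" for x unfolding c_def by (rule cSUP_least) (use cross in auto)
  ultimately have "\<bar>c - g x\<bar> \<le> b x" for x by (simp add: abs_le_iff algebra_simps)
  then show ?thesis using that by (auto simp: b_def)
qed

text \<open>
  This is $\int_x^\infty e^{x-y} F(y)\,dy$.  Applied to $z \mapsto F(-z)$ at $-x$ it gives
  $\int_{-\infty}^x e^{y-x} F(y)\,dy$, so that both halves of a convolution with $e^{-|x|}$ are
  expressed by it.
\<close>

definition exp_avg :: "(real \<Rightarrow> real) \<Rightarrow> real \<Rightarrow> real" where
  "exp_avg F x = (LINT z|lborel. indicator {0..} z * exp (- z) * F (x + z))"

lemma exp_weight:
  "integrable lborel (\<lambda>z::real. indicator {0..} z * exp (- z))"
  "(LINT z|lborel. indicator {0..} z * exp (- z)) = (1::real)"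
proof -
  have "(\<integral>\<^sup>+z. ennreal (exp (- z)) * indicator {0..} z \<partial>lborel) = ennreal (0 - (- exp (- 0)))"
  proof (rule nn_integral_FTC_atLeast[where F = "\<lambda>z. - exp (- z)"])
    show "((\<lambda>z. - exp (- z :: real)) \<longlongrightarrow> 0) at_top" by real_asymp
  qed (auto intro!: derivative_eq_intros)
  then have nn: "(\<integral>\<^sup>+z. ennreal (indicator {0..} z * exp (- z)) \<partial>lborel) = ennreal 1"
    by (subst nn_integral_cong[where v = "\<lambda>x. ennreal (exp (- x)) * indicator {0..} x"])
       (auto simp: indicator_def)
  show 1: "integrable lborel (\<lambda>z::real. indicator {0..} z * exp (- z))"
    by (rule integrableI_nonneg) (auto simp: nn)
  show "(LINT z|lborel. indicator {0..} z * exp (- z)) = (1::real)"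
    using nn by (subst integral_eq_nn_integral) auto
qed

locale bounded_continuous =
  fixes F :: "real \<Rightarrow> real" and K :: real
  assumes cont: "continuous_on UNIV F" and bounded: "\<And>x. \<bar>F x\<bar> \<le> K"
begin

lemma measurable [measurable]: "F \<in> borel_measurable borel"
  by (rule borel_measurable_continuous_onI[OF cont])

lemma integrable: "integrable lborel (\<lambda>z. indicator {0..} z * exp (- z) * F (x + z))"
  by (rule Bochner_Integration.integrable_bound[OF integrable_mult_left[OF exp_weight(1), of K]])
     (use bounded order_trans[OF abs_ge_zero bounded] in \<open>auto simp: abs_mult intro!: mult_left_mono\<close>)

lemma reflected: "bounded_continuous (\<lambda>x. F (- x)) K"
  by unfold_locales (auto intro!: continuous_on_compose2[OF cont] continuous_intros bounded)

lemma abs_exp_avg_le: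
  assumes "\<And>y. y \<ge> x \<Longrightarrow> \<bar>F y\<bar> \<le> B"
  shows "\<bar>exp_avg F x\<bar> \<le> B"
proof -
  have "\<bar>exp_avg F x\<bar> \<le> (LINT z|lborel. \<bar>indicator {0..} z * exp (- z) * F (x + z)\<bar>)"
    unfolding exp_avg_def by (rule integral_abs_bound)
  also have "\<dots> \<le> (LINT z|lborel. indicator {0..} z * exp (- z) * B)"
  proof (rule integral_mono)
    show "\<bar>indicator {0..} z * exp (- z) * F (x + z)\<bar> \<le> indicator {0..} z * exp (- z) * B" for z
      using assms[of "x + z"] by (auto simp: indicator_def abs_mult)
  qed (use integrable exp_weight(1) in auto)
  also have "\<dots> = B" using exp_weight(2) by simp
  finally show ?thesis .
qed

lemma exp_avg_nonneg:
  assumes "\<And>y. F y \<ge> 0"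
  shows "exp_avg F x \<ge> 0"
  unfolding exp_avg_def by (rule Bochner_Integration.integral_nonneg) (auto simp: assms)

lemma exp_avg_deriv: "(exp_avg F has_real_derivative exp_avg F x - F x) (at x)"
proof -
  define g where "g y = exp (- y) * F y" for y
  define \<Phi> where "\<Phi> x = (LINT y|lborel. indicator {x..} y * g y)" for x
  have gm [measurable]: "g \<in> borel_measurable borel" unfolding g_def by measurable
  have gc: "continuous_on S g" for S
    unfolding g_def by (intro continuous_intros continuous_on_subset[OF cont]) auto
  have eq: "exp_avg F x = exp x * \<Phi> x" and int: "integrable lborel (\<lambda>y. indicator {x..} y * g y)" for x
  proof -
    have *: "indicator {x..} (x + 1 * z) * g (x + 1 * z) = exp (- x) * (indicator {0..} z * exp (- z) * F (x + z))" for z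
      by (auto simp: indicator_def g_def exp_diff exp_minus field_simps)
    have "\<Phi> x = \<bar>1\<bar> *\<^sub>R (LINT z|lborel. indicator {x..} (x + 1 * z) * g (x + 1 * z))"
      unfolding \<Phi>_def by (rule lborel_integral_real_affine) simp
    also have "\<dots> = exp (- x) * exp_avg F x" unfolding * exp_avg_def by simp
    finally show "exp_avg F x = exp x * \<Phi> x" by (simp add: exp_minus field_simps)
    have "integrable lborel (\<lambda>z. indicator {x..} (x + 1 * z) * g (x + 1 * z))"
      unfolding * using integrable by auto
    then show "integrable lborel (\<lambda>y. indicator {x..} y * g y)"
      by (subst (asm) lborel_integrable_real_affine_iff) auto
  qed
  have \<Phi>: "\<Phi> y = \<Phi> (x - 1) - integral {x - 1..y} g" if "y \<ge> x - 1" for y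
  proof -
    have si: "set_integrable lborel {x - 1..y} g"
      by (rule borel_integrable_atLeastAtMost') (rule gc)
    have "\<Phi> (x - 1) = (LINT z|lborel. indicator {x - 1..y} z * g z + indicator {y..} z * g z)"
      unfolding \<Phi>_def
    proof (rule integral_cong_AE)
      show "AE z in lborel. indicator {x - 1..} z * g z = indicator {x - 1..y} z * g z + indicator {y..} z * g z"
        using AE_lborel_singleton[of y] by eventually_elim (use that in \<open>auto simp: indicator_def\<close>)
    qed auto
    also have "\<dots> = (LINT z|lborel. indicator {x - 1..y} z * g z) + \<Phi> y"
      unfolding \<Phi>_def using si int by (subst Bochner_Integration.integral_add) (auto simp: set_integrable_def)
    also have "(LINT z|lborel. indicator {x - 1..y} z * g z) = integral {x - 1..y} g"
      using set_borel_integral_eq_integral(2)[OF si] by (simp add: set_lebesgue_integral_def)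
    finally show ?thesis by simp
  qed
  have "((\<lambda>y. integral {x - 1..y} g) has_real_derivative g x) (at x within {x - 1..x + 1})"
    by (rule integral_has_real_derivative[OF gc]) auto
  then have "((\<lambda>y. integral {x - 1..y} g) has_real_derivative g x) (at x)"
    by (simp add: at_within_Icc_at)
  then have "((\<lambda>y. \<Phi> (x - 1) - integral {x - 1..y} g) has_real_derivative - g x) (at x)"
    by (auto intro!: derivative_eq_intros)
  then have "(\<Phi> has_real_derivative - g x) (at x)"
    by (rule has_field_derivative_transform_within_open[where S = "{x - 1<..}"])
       (auto intro: \<Phi>[symmetric])
  from DERIV_mult[OF DERIV_exp this]
  have "((\<lambda>x. exp x * \<Phi> x) has_real_derivative exp x * \<Phi> x - F x) (at x)"
    by (rule DERIV_cong) (simp add: g_def exp_minus)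
  moreover have "exp_avg F = (\<lambda>x. exp x * \<Phi> x)" by (rule ext) (rule eq)
  ultimately show ?thesis by simp
qed

end

text \<open>
  The solutions of $D' = D$ are the multiples of $e^x$, and only zero is bounded.
\<close>

lemma bounded_solution_unique:
  fixes D :: "real \<Rightarrow> real"
  assumes D: "\<And>x. (D has_real_derivative D x) (at x)" and bd: "\<And>x. \<bar>D x\<bar> \<le> B"
  shows "D x = 0"
proof -
  have "((\<lambda>x. exp (- x) * D x) has_real_derivative 0) (at y)" for y
    using D[of y] by (auto intro!: derivative_eq_intros)
  then have const: "exp (- y) * D y = exp (- x) * D x" for y
    using DERIV_isconst_all[of "\<lambda>x. exp (- x) * D x" y x] by blast
  have "((\<lambda>y. exp (- y) * B) \<longlongrightarrow> 0 * B) at_top"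
    by (intro tendsto_mult_right) real_asymp
  then have lim0: "((\<lambda>y. exp (- y) * B) \<longlongrightarrow> 0) at_top" by simp
  have "norm (exp (- y) * D y) \<le> exp (- y) * B" for y
    using bd[of y] by (simp add: abs_mult)
  then have "((\<lambda>y. exp (- y) * D y) \<longlongrightarrow> 0) at_top"
    by (rule Lim_null_comparison[OF always_eventually[OF allI] lim0])
  moreover have "((\<lambda>y. exp (- y) * D y) \<longlongrightarrow> exp (- x) * D x) at_top"
    by (rule tendsto_eventually[OF always_eventually[OF allI[OF const]]])
  ultimately have "exp (- x) * D x = 0"
    using tendsto_unique[OF trivial_limit_at_top_linorder] by blast
  then show ?thesis by simp
qed

section \<open>Evolution along characteristics\<close>

text \<open>
  A classical form of the Camassa-Holm equation, with $G * F$ and $\partial_x G * F$ split into the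
  averages over the two half-lines: the evolution of \<open>u\<close> and of its space derivative along the flow,
  and the evolution of \<open>u\<close> at a fixed point of space.
\<close>

locale CH_lagrangian =
  fixes T M :: real and u ux uxx \<eta> :: "real \<Rightarrow> real \<Rightarrow> real"
  assumes T: "T > 0" and M: "M > 0"
    and deriv_u: "\<And>t x. t \<in> {0..T} \<Longrightarrow> (u t has_real_derivative ux t x) (at x)"
    and deriv_ux: "\<And>t x. t \<in> {0..T} \<Longrightarrow> (ux t has_real_derivative uxx t x) (at x)"
    and u_le: "\<And>t x. t \<in> {0..T} \<Longrightarrow> \<bar>u t x\<bar> \<le> M"
    and ux_le: "\<And>t x. t \<in> {0..T} \<Longrightarrow> \<bar>ux t x\<bar> \<le> M"
    and flow_0: "\<And>x. \<eta> x 0 = x"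
    and flow: "\<And>t x. t \<in> {0..T} \<Longrightarrow> ((\<lambda>r. \<eta> x r) has_real_derivative u t (\<eta> x t)) (at t within {0..T})"
    and lagrange_u: "\<And>t x. t \<in> {0..T} \<Longrightarrow> ((\<lambda>r. u r (\<eta> x r)) has_real_derivative
        (exp_avg (\<lambda>z. (u t (- z))\<^sup>2 + (ux t (- z))\<^sup>2 / 2) (- \<eta> x t)
          - exp_avg (\<lambda>z. (u t z)\<^sup>2 + (ux t z)\<^sup>2 / 2) (\<eta> x t)) / 2) (at t within {0..T})"
    and lagrange_ux: "\<And>t x. t \<in> {0..T} \<Longrightarrow> ((\<lambda>r. ux r (\<eta> x r)) has_real_derivative
        (u t (\<eta> x t))\<^sup>2 - (ux t (\<eta> x t))\<^sup>2 / 2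
        - (exp_avg (\<lambda>z. (u t (- z))\<^sup>2 + (ux t (- z))\<^sup>2 / 2) (- \<eta> x t)
          + exp_avg (\<lambda>z. (u t z)\<^sup>2 + (ux t z)\<^sup>2 / 2) (\<eta> x t)) / 2) (at t within {0..T})"
    and euler_u: "\<And>t y. t \<in> {0..T} \<Longrightarrow> ((\<lambda>r. u r y) has_real_derivative
        - (u t y * ux t y)
        + (exp_avg (\<lambda>z. (u t (- z))\<^sup>2 + (ux t (- z))\<^sup>2 / 2) (- y)
          - exp_avg (\<lambda>z. (u t z)\<^sup>2 + (ux t z)\<^sup>2 / 2) y) / 2) (at t within {0..T})"
begin

lemma reflected:
  "CH_lagrangian T M (\<lambda>t x. - u t (- x)) (\<lambda>t x. ux t (- x)) (\<lambda>t x. - uxx t (- x)) (\<lambda>x t. - \<eta> (- x) t)"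
proof
  fix t x assume t: "t \<in> {0..T}"
  have neg: "(uminus has_real_derivative - 1) (at x)"
    by (rule derivative_eq_intros refl)+
  show "((\<lambda>x. - u t (- x)) has_real_derivative ux t (- x)) (at x)"
    using DERIV_minus[OF DERIV_chain2[where g = uminus, OF deriv_u[OF t] neg]] by simp
  show "((\<lambda>x. ux t (- x)) has_real_derivative - uxx t (- x)) (at x)"
    using DERIV_chain2[where g = uminus, OF deriv_ux[OF t] neg] by simp
  show "((\<lambda>r. - \<eta> (- x) r) has_real_derivative - u t (- (- \<eta> (- x) t))) (at t within {0..T})"
    using DERIV_minus[OF flow[OF t]] by simp
  show "((\<lambda>r. - u r (- (- \<eta> (- x) r))) has_real_derivative
        (exp_avg (\<lambda>z. (- u t (- (- z)))\<^sup>2 + (ux t (- (- z)))\<^sup>2 / 2) (- (- \<eta> (- x) t))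
          - exp_avg (\<lambda>z. (- u t (- z))\<^sup>2 + (ux t (- z))\<^sup>2 / 2) (- \<eta> (- x) t)) / 2) (at t within {0..T})"
    using DERIV_minus[OF lagrange_u[OF t, of "- x"]] by (simp add: minus_divide_left)
  show "((\<lambda>r. ux r (- (- \<eta> (- x) r))) has_real_derivative
        (- u t (- (- \<eta> (- x) t)))\<^sup>2 - (ux t (- (- \<eta> (- x) t)))\<^sup>2 / 2
        - (exp_avg (\<lambda>z. (- u t (- (- z)))\<^sup>2 + (ux t (- (- z)))\<^sup>2 / 2) (- (- \<eta> (- x) t))
          + exp_avg (\<lambda>z. (- u t (- z))\<^sup>2 + (ux t (- z))\<^sup>2 / 2) (- \<eta> (- x) t)) / 2) (at t within {0..T})"
    using lagrange_ux[OF t, of "- x"] by (simp add: add.commute)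
  show "((\<lambda>r. - u r (- x)) has_real_derivative
        - (- u t (- x) * ux t (- x))
        + (exp_avg (\<lambda>z. (- u t (- (- z)))\<^sup>2 + (ux t (- (- z)))\<^sup>2 / 2) (- x)
          - exp_avg (\<lambda>z. (- u t (- z))\<^sup>2 + (ux t (- z))\<^sup>2 / 2) x) / 2) (at t within {0..T})"
    by (rule DERIV_cong[OF DERIV_minus[OF euler_u[OF t, of "- x"]]])
       (simp add: field_simps)
qed (use T M u_le ux_le flow_0 in auto)

definition F :: "real \<Rightarrow> real \<Rightarrow> real" where
  "F t x = (u t x)\<^sup>2 + (ux t x)\<^sup>2 / 2"

definition p :: "real \<Rightarrow> real \<Rightarrow> real" where
  "p t x = u t x + ux t x"

definition I :: "real \<Rightarrow> real \<Rightarrow> real" where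
  "I t = exp_avg (\<lambda>x. (p t x)\<^sup>2 / 2)"

lemma continuous_u: "t \<in> {0..T} \<Longrightarrow> continuous_on S (u t)"
  using deriv_u by (meson DERIV_continuous_on has_field_derivative_at_within)

lemma continuous_ux: "t \<in> {0..T} \<Longrightarrow> continuous_on S (ux t)"
  using deriv_ux by (meson DERIV_continuous_on has_field_derivative_at_within)

lemma deriv_p: "t \<in> {0..T} \<Longrightarrow> (p t has_real_derivative ux t x + uxx t x) (at x)"
  unfolding p_def[abs_def] by (intro DERIV_add deriv_u deriv_ux)

lemma p_le: "t \<in> {0..T} \<Longrightarrow> \<bar>p t x\<bar> \<le> 2 * M"
  using u_le[of t x] ux_le[of t x] by (simp add: p_def)

lemma square_le_square: "\<bar>a\<bar> \<le> b \<Longrightarrow> (a::real)\<^sup>2 \<le> b\<^sup>2"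
  by (metis abs_ge_zero power2_abs power_mono)

lemma bounded_continuous_F: "t \<in> {0..T} \<Longrightarrow> bounded_continuous (F t) (M\<^sup>2 + M\<^sup>2 / 2)"
  unfolding F_def[abs_def]
proof
  assume t: "t \<in> {0..T}"
  show "continuous_on UNIV (\<lambda>x. (u t x)\<^sup>2 + (ux t x)\<^sup>2 / 2)"
    by (intro continuous_intros continuous_u continuous_ux t) simp
  show "\<bar>(u t x)\<^sup>2 + (ux t x)\<^sup>2 / 2\<bar> \<le> M\<^sup>2 + M\<^sup>2 / 2" for x
    using square_le_square[OF u_le[OF t, of x]] square_le_square[OF ux_le[OF t, of x]] by simp
qed

lemma bounded_continuous_p: "t \<in> {0..T} \<Longrightarrow> bounded_continuous (\<lambda>x. (p t x)\<^sup>2 / 2) ((2 * M)\<^sup>2 / 2)"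
proof
  assume t: "t \<in> {0..T}"
  show "continuous_on UNIV (\<lambda>x. (p t x)\<^sup>2 / 2)"
    unfolding p_def by (intro continuous_intros continuous_u continuous_ux t) simp
  show "\<bar>(p t x)\<^sup>2 / 2\<bar> \<le> (2 * M)\<^sup>2 / 2" for x
    using square_le_square[OF p_le[OF t, of x]] by simp
qed

lemma deriv_I: "t \<in> {0..T} \<Longrightarrow> (I t has_real_derivative I t x - (p t x)\<^sup>2 / 2) (at x)"
  unfolding I_def by (rule bounded_continuous.exp_avg_deriv[OF bounded_continuous_p])

lemma I_nonneg: "t \<in> {0..T} \<Longrightarrow> I t x \<ge> 0"
  unfolding I_def by (rule bounded_continuous.exp_avg_nonneg[OF bounded_continuous_p]) auto

lemma half_p_square_le:
  assumes "t \<in> {0..T}" "\<bar>p t y\<bar> \<le> \<beta>"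
  shows "(p t y)\<^sup>2 / 2 \<le> M * \<beta>"
proof -
  have "\<bar>p t y\<bar> * \<bar>p t y\<bar> \<le> (2 * M) * \<beta>"
    using p_le[OF assms(1), of y] assms(2) M by (intro mult_mono) auto
  then show ?thesis by (simp add: power2_eq_square)
qed

lemma I_le:
  assumes t: "t \<in> {0..T}" and \<beta>: "\<And>y. y \<ge> x \<Longrightarrow> \<bar>p t y\<bar> \<le> \<beta>"
  shows "I t x \<le> M * \<beta>"
proof -
  have "\<bar>I t x\<bar> \<le> M * \<beta>"
    unfolding I_def
    by (rule bounded_continuous.abs_exp_avg_le[OF bounded_continuous_p[OF t]])
       (use half_p_square_le[OF t \<beta>] in simp)
  then show ?thesis by simp
qed

text \<open>
  Since $u u_x - \tfrac12 p^2 = \tfrac12 u^2 - F$, both sides solve $D' = D - F$.  Their difference is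
  a bounded solution of $D' = D$, hence zero.
\<close>

lemma exp_avg_F: 
  assumes t: "t \<in> {0..T}"
  shows "exp_avg (F t) x = (u t x)\<^sup>2 / 2 + I t x"
proof -
  let ?D = "\<lambda>x. exp_avg (F t) x - ((u t x)\<^sup>2 / 2 + I t x)"
  have "?D x = 0"
  proof (rule bounded_solution_unique[where D = ?D])
    fix x
    have "(?D has_real_derivative (exp_avg (F t) x - F t x) - (u t x * ux t x + (I t x - (p t x)\<^sup>2 / 2))) (at x)"
      by (rule derivative_eq_intros bounded_continuous.exp_avg_deriv[OF bounded_continuous_F[OF t]] deriv_u[OF t] deriv_I[OF t] refl | simp)+
    then show "(?D has_real_derivative ?D x) (at x)"
      by (rule DERIV_cong)
         (simp add: F_def p_def power2_eq_square field_simps)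
    have "\<bar>exp_avg (F t) x\<bar> \<le> M\<^sup>2 + M\<^sup>2 / 2"
      by (intro bounded_continuous.abs_exp_avg_le[OF bounded_continuous_F[OF t]]
          bounded_continuous.bounded[OF bounded_continuous_F[OF t]])
    moreover have "\<bar>I t x\<bar> \<le> (2 * M)\<^sup>2 / 2"
      unfolding I_def by (intro bounded_continuous.abs_exp_avg_le[OF bounded_continuous_p[OF t]]
          bounded_continuous.bounded[OF bounded_continuous_p[OF t]])
    moreover have "(u t x)\<^sup>2 \<le> M\<^sup>2" by (rule square_le_square[OF u_le[OF t]])
    ultimately show "\<bar>?D x\<bar> \<le> (M\<^sup>2 + M\<^sup>2 / 2) + (M\<^sup>2 / 2 + (2 * M)\<^sup>2 / 2)"
      using zero_le_power2[of "u t x"] unfolding abs_le_iff by linarith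
  qed
  then show ?thesis by simp
qed

text \<open>
  In the sum of the equations for \<open>u\<close> and \<open>u\<^sub>x\<close> the averages over the left half-line cancel.  What
  remains depends only on values at and to the right of the characteristic and is homogeneous
  quadratic in \<open>u\<close> and \<open>p\<close> with a factor \<open>p\<close> in every term.
\<close>

lemma lagrange_p:
  assumes t: "t \<in> {0..T}"
  shows "((\<lambda>r. p r (\<eta> x r)) has_real_derivative
    p t (\<eta> x t) * u t (\<eta> x t) - (p t (\<eta> x t))\<^sup>2 / 2 - I t (\<eta> x t)) (at t within {0..T})"
proof -
  let ?Jm = "exp_avg (\<lambda>z. (u t (- z))\<^sup>2 + (ux t (- z))\<^sup>2 / 2) (- \<eta> x t)"
  have F: "exp_avg (\<lambda>z. (u t z)\<^sup>2 + (ux t z)\<^sup>2 / 2) (\<eta> x t) = (u t (\<eta> x t))\<^sup>2 / 2 + I t (\<eta> x t)"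
    using exp_avg_F[OF t, of "\<eta> x t"] by (simp add: F_def[abs_def])
  have eq: "(?Jm - ((u t (\<eta> x t))\<^sup>2 / 2 + I t (\<eta> x t))) / 2
      + ((u t (\<eta> x t))\<^sup>2 - (ux t (\<eta> x t))\<^sup>2 / 2 - (?Jm + ((u t (\<eta> x t))\<^sup>2 / 2 + I t (\<eta> x t))) / 2)
    = p t (\<eta> x t) * u t (\<eta> x t) - (p t (\<eta> x t))\<^sup>2 / 2 - I t (\<eta> x t)"
    by (simp add: p_def power2_eq_square field_simps)
  show ?thesis
    using DERIV_add[OF lagrange_u[OF t, of x] lagrange_ux[OF t, of x]]
    unfolding F eq p_def[symmetric] .
qed

lemma flow_continuous: "continuous_on {0..T} (\<eta> x)"
  by (rule DERIV_continuous_on[where D = "\<lambda>t. u t (\<eta> x t)"]) (rule flow)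

lemma u_lipschitz:
  assumes t: "t \<in> {0..T}"
  shows "\<bar>u t y - u t x\<bar> \<le> M * \<bar>y - x\<bar>"
proof -
  have *: "\<bar>u t y - u t x\<bar> \<le> M * \<bar>y - x\<bar>" if "x \<le> y" for x y
    using abs_diff_le_of_deriv_le[OF that, of UNIV "u t" "ux t" "\<lambda>x. M * x" "\<lambda>_. M"]
      deriv_u[OF t] ux_le[OF t] that
    by (auto intro!: derivative_eq_intros simp: right_diff_distrib)
  show ?thesis using *[of x y] *[of y x] by (cases "x \<le> y") (auto simp: abs_minus_commute)
qed

lemma flow_displacement:
  assumes t: "t \<in> {0..T}"
  shows "\<bar>\<eta> x t - x\<bar> \<le> M * T"
proof -
  have "\<bar>\<eta> x t - \<eta> x 0\<bar> \<le> M * t - M * 0"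
  proof (rule abs_diff_le_of_deriv_le[where S = "{0..T}"])
    fix r assume "r \<in> {0..t}"
    then have r: "r \<in> {0..T}" using t by auto
    show "((\<lambda>r. \<eta> x r) has_real_derivative u r (\<eta> x r)) (at r within {0..T})" by (rule flow[OF r])
    show "\<bar>u r (\<eta> x r)\<bar> \<le> M" by (rule u_le[OF r])
  qed (use t in \<open>auto intro!: derivative_eq_intros\<close>)
  also have "\<dots> \<le> M * T" using t M by simp
  finally show ?thesis by (simp add: flow_0)
qed

text \<open>
  The squared distance of two characteristics changes at the relative rate \<open>2 * M\<close> at most, as \<open>M\<close>
  bounds the Lipschitz constant of \<open>u\<close>.
\<close>

lemma flow_gap_square:
  assumes t: "t \<in> {0..T}"
  shows "(y - x)\<^sup>2 * exp (- 2 * M * t) \<le> (\<eta> y t - \<eta> x t)\<^sup>2"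
    and "(\<eta> y t - \<eta> x t)\<^sup>2 \<le> (y - x)\<^sup>2 * exp (2 * M * t)"
proof -
  define g where "g r = (\<eta> y r - \<eta> x r)\<^sup>2" for r
  define g' where "g' r = 2 * (\<eta> y r - \<eta> x r) * (u r (\<eta> y r) - u r (\<eta> x r))" for r
  have g: "(g has_real_derivative g' r) (at r within {0..T})" if r: "r \<in> {0..T}" for r
    unfolding g_def g'_def
    by (auto intro!: derivative_eq_intros flow[OF r])
  have g'le: "\<bar>g' r\<bar> \<le> 2 * M * g r" if r: "r \<in> {0..T}" for r
  proof -
    have "\<bar>g' r\<bar> = 2 * \<bar>\<eta> y r - \<eta> x r\<bar> * \<bar>u r (\<eta> y r) - u r (\<eta> x r)\<bar>"
      by (simp only: g'_def abs_mult abs_numeral)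
    also have "\<dots> \<le> 2 * \<bar>\<eta> y r - \<eta> x r\<bar> * (M * \<bar>\<eta> y r - \<eta> x r\<bar>)"
      by (intro mult_left_mono u_lipschitz[OF r]) auto
    also have "\<dots> = 2 * M * \<bar>\<eta> y r - \<eta> x r\<bar>\<^sup>2"
      by (simp only: power2_eq_square mult.assoc mult.left_commute)
    finally show ?thesis by (simp add: g_def)
  qed
  have sub: "{0..t} \<subseteq> {0..T}" using t by auto
  have "g 0 * exp (2 * M * 0) \<le> g t * exp (2 * M * t)"
  proof (rule nondecreasing_of_deriv_within[OF _ sub])
    fix r assume "r \<in> {0..t}"
    then have r: "r \<in> {0..T}" using t by auto
    show "((\<lambda>r. g r * exp (2 * M * r)) has_real_derivative (g' r + 2 * M * g r) * exp (2 * M * r)) (at r within {0..T})"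
      by (rule derivative_eq_intros g[OF r] refl | simp add: algebra_simps)+
    show "(g' r + 2 * M * g r) * exp (2 * M * r) \<ge> 0" using g'le[OF r] by simp
  qed (use t in auto)
  then have 1: "(y - x)\<^sup>2 \<le> g t * exp (2 * M * t)" by (simp add: g_def flow_0)
  have "(y - x)\<^sup>2 * exp (- 2 * M * t) \<le> (g t * exp (2 * M * t)) * exp (- 2 * M * t)"
    by (rule mult_right_mono[OF 1]) simp
  also have "\<dots> = g t" by (simp add: mult.assoc mult_exp_exp)
  finally show "(y - x)\<^sup>2 * exp (- 2 * M * t) \<le> (\<eta> y t - \<eta> x t)\<^sup>2" by (simp add: g_def)
  have "- g 0 * exp (- 2 * M * 0) \<le> - g t * exp (- 2 * M * t)"
  proof (rule nondecreasing_of_deriv_within[OF _ sub])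
    fix r assume "r \<in> {0..t}"
    then have r: "r \<in> {0..T}" using t by auto
    show "((\<lambda>r. - g r * exp (- 2 * M * r)) has_real_derivative (2 * M * g r - g' r) * exp (- 2 * M * r)) (at r within {0..T})"
      by (rule derivative_eq_intros g[OF r] refl | simp add: algebra_simps)+
    show "(2 * M * g r - g' r) * exp (- 2 * M * r) \<ge> 0" using g'le[OF r] by simp
  qed (use t in auto)
  then have 2: "g t * exp (- 2 * M * t) \<le> (y - x)\<^sup>2" by (simp add: g_def flow_0)
  have "g t = (g t * exp (- 2 * M * t)) * exp (2 * M * t)" by (simp add: mult.assoc mult_exp_exp)
  also have "\<dots> \<le> (y - x)\<^sup>2 * exp (2 * M * t)"
    by (rule mult_right_mono[OF 2]) simp
  finally show "(\<eta> y t - \<eta> x t)\<^sup>2 \<le> (y - x)\<^sup>2 * exp (2 * M * t)" by (simp add: g_def)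
qed

text \<open>
  By continuity in time, characteristics that never meet keep their order.
\<close>

lemma flow_gap:
  assumes t: "t \<in> {0..T}" and xy: "x < y"
  shows "(y - x) * exp (- M * T) \<le> \<eta> y t - \<eta> x t" "\<eta> y t - \<eta> x t \<le> (y - x) * exp (M * T)"
    "\<eta> x t < \<eta> y t"
proof -
  let ?d = "\<lambda>r. \<eta> y r - \<eta> x r"
  have nz: "?d r \<noteq> 0" if r: "r \<in> {0..T}" for r
  proof
    assume "?d r = 0"
    then have "(y - x)\<^sup>2 * exp (- 2 * M * r) \<le> 0" using flow_gap_square(1)[OF r, of y x] by simp
    moreover have "(y - x)\<^sup>2 * exp (- 2 * M * r) > 0" using xy by simp
    ultimately show False by linarith
  qed
  have pos: "?d t > 0"
  proof (rule ccontr)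
    assume "\<not> ?d t > 0"
    then have neg: "?d t \<le> 0" by simp
    have "continuous_on {0..t} ?d"
      by (intro continuous_intros continuous_on_subset[OF flow_continuous]) (use t in auto)
    then have "\<exists>r\<ge>0. r \<le> t \<and> ?d r = 0"
      using IVT2'[of ?d t 0 0] neg t xy by (auto simp: flow_0)
    then obtain r where "r \<ge> 0" "r \<le> t" "?d r = 0" by auto
    with nz[of r] t show False by auto
  qed
  then show "\<eta> x t < \<eta> y t" by simp
  have eT: "exp (M * t) \<le> exp (M * T)" "exp (- M * T) \<le> exp (- M * t)" using t M by auto
  have "((y - x) * exp (- M * t))\<^sup>2 \<le> (?d t)\<^sup>2"
    using flow_gap_square(1)[OF t, of y x] by (simp add: power_mult_distrib exp_double[symmetric] mult.assoc)
  then have "(y - x) * exp (- M * t) \<le> ?d t" using pos by (auto intro: power2_le_imp_le)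
  moreover have "(y - x) * exp (- M * T) \<le> (y - x) * exp (- M * t)" using xy eT by (intro mult_left_mono) auto
  ultimately show "(y - x) * exp (- M * T) \<le> \<eta> y t - \<eta> x t" by linarith
  have "(?d t)\<^sup>2 \<le> ((y - x) * exp (M * t))\<^sup>2"
    using flow_gap_square(2)[OF t, of y x] by (simp add: power_mult_distrib exp_double[symmetric] mult.assoc)
  then have "?d t \<le> (y - x) * exp (M * t)" using xy by (auto intro: power2_le_imp_le)
  moreover have "(y - x) * exp (M * t) \<le> (y - x) * exp (M * T)" using xy eT by (intro mult_left_mono) auto
  ultimately show "\<eta> y t - \<eta> x t \<le> (y - x) * exp (M * T)" by linarith
qed

lemma flow_mono_iff: "t \<in> {0..T} \<Longrightarrow> \<eta> x t \<le> \<eta> y t \<longleftrightarrow> x \<le> y"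
  using flow_gap(3)[of t x y] flow_gap(3)[of t y x] by (cases x y rule: linorder_cases) auto

lemma flow_continuous_label:
  assumes t: "t \<in> {0..T}"
  shows "continuous_on UNIV (\<lambda>x. \<eta> x t)"
proof (rule lipschitz_on_continuous_on)
  show "(exp (M * T))-lipschitz_on UNIV (\<lambda>x. \<eta> x t)"
  proof (rule lipschitz_onI)
    fix x y
    show "dist (\<eta> x t) (\<eta> y t) \<le> exp (M * T) * dist x y"
      using flow_gap[OF t, of x y] flow_gap[OF t, of y x]
      by (cases x y rule: linorder_cases) (auto simp: dist_real_def mult.commute)
  qed simp
qed

lemma flow_surj:
  assumes t: "t \<in> {0..T}"
  obtains x where "\<eta> x t = y"
proof -
  have "\<exists>x\<ge>y - M * T. x \<le> y + M * T \<and> \<eta> x t = y"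
  proof (rule IVT')
    show "\<eta> (y - M * T) t \<le> y" "y \<le> \<eta> (y + M * T) t"
      using flow_displacement[OF t, of "y - M * T"] flow_displacement[OF t, of "y + M * T"] by auto
    show "y - M * T \<le> y + M * T" using M T by simp
    show "continuous_on {y - M * T..y + M * T} (\<lambda>x. \<eta> x t)"
      by (rule continuous_on_subset[OF flow_continuous_label[OF t]]) simp
  qed
  then show ?thesis using that by auto
qed

text \<open>
  The mechanism behind persistence of decay.  A nondecreasing weight is compatible with the nonlocal
  term, since \<open>I t\<close> at a characteristic only involves characteristics with larger labels, where the
  weight is at least as large.  Boundedness of the weight makes the supremum finite; the estimate is
  uniform in the bound \<open>W\<close>, so that unbounded weights are reached by truncation.
\<close>

lemma weighted_gronwall:
  assumes s: "s \<in> {0..T}" and t: "t \<in> {0..T}"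
    and w: "\<And>x. 0 \<le> w x" "\<And>x. w x \<le> W" "mono w"
    and init: "\<And>x. w x * \<bar>p s (\<eta> x s)\<bar> \<le> \<epsilon>"
  shows "w x * \<bar>p t (\<eta> x t)\<bar> \<le> 2 * \<epsilon> * exp (6 * M * T)"
proof -
  let ?R = "\<lambda>x t. p t (\<eta> x t) * u t (\<eta> x t) - (p t (\<eta> x t))\<^sup>2 / 2 - I t (\<eta> x t)"
  have "\<bar>w x * p t (\<eta> x t)\<bar> \<le> 2 * (\<epsilon> + 0 * T) * exp (2 * (3 * M) * T)"
  proof (rule family_gronwall[where f = "\<lambda>x t. w x * p t (\<eta> x t)" and f' = "\<lambda>x t. w x * ?R x t" and A = "W * (2 * M)", OF _ _ s])
    show "\<bar>w x * p s (\<eta> x s)\<bar> \<le> \<epsilon>" for x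
      using init[of x] w(1)[of x] by (simp add: abs_mult)
  next
    fix x t Z assume t: "t \<in> {0..T}"
    show "((\<lambda>r. w x * p r (\<eta> x r)) has_real_derivative w x * ?R x t) (at t within {0..T})"
      by (rule DERIV_cmult[OF lagrange_p[OF t]])
    show "\<bar>w x * p t (\<eta> x t)\<bar> \<le> W * (2 * M)"
      unfolding abs_mult using w(1,2)[of x] p_le[OF t] w(2)[THEN order_trans[OF w(1)]] by (intro mult_mono) auto
    assume Z: "\<And>j. \<bar>w j * p t (\<eta> j t)\<bar> \<le> Z"
    have Zx: "w x * \<bar>p t (\<eta> x t)\<bar> \<le> Z" using Z[of x] w(1)[of x] by (simp add: abs_mult)
    show "\<bar>w x * ?R x t\<bar> \<le> 3 * M * Z + 0"
    proof (cases "w x = 0")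
      case True then show ?thesis using Zx M by simp
    next
      case False
      with w(1)[of x] have wx: "w x > 0" by simp
      have "I t (\<eta> x t) \<le> M * (Z / w x)"
      proof (rule I_le[OF t])
        fix y assume y: "\<eta> x t \<le> y"
        obtain x' where x': "\<eta> x' t = y" by (rule flow_surj[OF t])
        with y have "x \<le> x'" using flow_mono_iff[OF t, of x x'] by simp
        then have "w x * \<bar>p t y\<bar> \<le> w x' * \<bar>p t y\<bar>" by (intro mult_right_mono monoD[OF w(3)]) auto
        also have "\<dots> \<le> Z" using Z[of x'] w(1)[of x'] x' by (simp add: abs_mult)
        finally show "\<bar>p t y\<bar> \<le> Z / w x" using wx by (simp add: field_simps)
      qed
      then have 1: "w x * I t (\<eta> x t) \<le> M * Z" using wx by (simp add: field_simps)
      have 2: "w x * I t (\<eta> x t) \<ge> 0" using w(1) I_nonneg[OF t] by simp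
      have "\<bar>w x * (p t (\<eta> x t) * u t (\<eta> x t) - (p t (\<eta> x t))\<^sup>2 / 2)\<bar>
         = (w x * \<bar>p t (\<eta> x t)\<bar>) * \<bar>u t (\<eta> x t) - p t (\<eta> x t) / 2\<bar>"
      proof -
        have "w x * (p t (\<eta> x t) * u t (\<eta> x t) - (p t (\<eta> x t))\<^sup>2 / 2)
          = w x * (p t (\<eta> x t) * (u t (\<eta> x t) - p t (\<eta> x t) / 2))"
          by (simp add: power2_eq_square algebra_simps)
        then show ?thesis using wx by (simp add: abs_mult)
      qed
      also have "\<dots> \<le> Z * (2 * M)"
        using Zx u_le[OF t, of "\<eta> x t"] p_le[OF t, of "\<eta> x t"] wx
        by (intro mult_mono) (auto intro: order_trans[OF _ Zx])
      finally have "\<bar>w x * (p t (\<eta> x t) * u t (\<eta> x t) - (p t (\<eta> x t))\<^sup>2 / 2)\<bar> \<le> 2 * M * Z" by (simp only: mult.commute mult.left_commute)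
      then show ?thesis using 1 2 by (simp add: right_diff_distrib)
    qed
  qed (use M t in auto)
  then show ?thesis using w(1)[of x] by (simp add: abs_mult mult_ac)
qed

end

context CH_lagrangian
begin

lemma deriv_exp_u:
  "t \<in> {0..T} \<Longrightarrow> ((\<lambda>x. exp x * u t x) has_real_derivative exp x * p t x) (at x)"
  by (rule DERIV_cong[OF DERIV_mult[OF DERIV_exp deriv_u]]) (auto simp: p_def algebra_simps)

lemma ux_zero:
  assumes t: "t \<in> {0..T}" and "open S" "x \<in> S" "\<And>y. y \<in> S \<Longrightarrow> u t y = 0"
  shows "ux t x = 0"
proof -
  have "(u t has_real_derivative 0) (at x)"
    by (rule has_field_derivative_transform_within_open[where f = "\<lambda>_. 0" and S = S]) (use assms in auto)
  then show ?thesis using DERIV_unique[OF deriv_u[OF t]] by blast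
qed

text \<open>
  The indicator of \<open>{b<..}\<close> as a weight: where the datum vanishes, \<open>p\<close> vanishes and continues to do
  so, and \<open>p = 0\<close> means that $e^x u$ is locally constant.
\<close>

lemma exponential_tail:
  assumes t: "t \<in> {0..T}" and zero: "\<And>x. x > b \<Longrightarrow> u 0 x = 0"
  shows "\<exists>c. \<forall>x>\<eta> b t. u t x = c * exp (- x)"
proof -
  have p0: "p 0 x = 0" if "x > b" for x
    using ux_zero[of 0 "{b<..}" x] zero that T by (auto simp: p_def)
  have p: "p t y = 0" if y: "y > \<eta> b t" for y
  proof -
    obtain x where x: "\<eta> x t = y" by (rule flow_surj[OF t])
    with y have "b < x" using flow_mono_iff[OF t, of x b] by simp
    have "indicator {b<..} x * \<bar>p t (\<eta> x t)\<bar> \<le> 2 * 0 * exp (6 * M * T)"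
    proof (rule weighted_gronwall[OF _ t, where W = 1 and s = 0])
      show "mono (indicator {b<..} :: real \<Rightarrow> real)" by (auto simp: mono_def indicator_def)
      show "indicator {b<..} x * \<bar>p 0 (\<eta> x 0)\<bar> \<le> 0" for x using p0[of x] by (simp add: flow_0 indicator_def)
    qed (use T in \<open>auto simp: indicator_def\<close>)
    then show ?thesis using x \<open>b < x\<close> by simp
  qed
  define y0 where "y0 = \<eta> b t + 1"
  have const: "exp y * u t y = exp x * u t x" if "\<eta> b t < x" "x \<le> y" for x y
  proof -
    have "\<bar>exp y * u t y - exp x * u t x\<bar> \<le> 0 - 0"
    proof (rule abs_diff_le_of_deriv_le[OF that(2), of UNIV _ "\<lambda>x. exp x * p t x" "\<lambda>_. 0" "\<lambda>_. 0"])
      fix r assume "r \<in> {x..y}"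
      then show "\<bar>exp r * p t r\<bar> \<le> 0" using p[of r] that by simp
    qed (auto intro: deriv_exp_u[OF t])
    then show ?thesis by simp
  qed
  show ?thesis
  proof (intro exI[of _ "exp y0 * u t y0"] allI impI)
    fix x assume x: "x > \<eta> b t"
    have "exp x * u t x = exp y0 * u t y0"
      using const[of x y0] const[of y0 x] x by (cases "x \<le> y0") (auto simp: y0_def)
    then show "u t x = exp y0 * u t y0 * exp (- x)"
      by (simp add: exp_minus field_simps)
  qed
qed

text \<open>
  If \<open>u\<close> vanished at time \<open>t\<close>, then the constant weight, used from \<open>t\<close> back to \<open>0\<close>, would give
  \<open>p = 0\<close> initially.  Then the datum would be a multiple of $e^{-x}$, and only zero is bounded.
\<close>

lemma never_vanishes:
  assumes t: "t \<in> {0..T}" and nz: "u 0 x0 \<noteq> 0"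
  shows "\<exists>x. u t x \<noteq> 0"
proof (rule ccontr)
  assume "\<not> ?thesis"
  then have z: "u t x = 0" for x by simp
  then have "p t x = 0" for x using ux_zero[OF t, of UNIV x] by (simp add: p_def)
  then have "1 * \<bar>p 0 (\<eta> x 0)\<bar> \<le> 2 * 0 * exp (6 * M * T)" for x
    by (intro weighted_gronwall[OF t, where W = 1 and w = "\<lambda>_. 1"]) (use T in \<open>auto simp: mono_def\<close>)
  then have "ux 0 x = - u 0 x" for x by (simp add: flow_0 p_def add_eq_0_iff)
  have neg: "(uminus has_real_derivative - 1) (at x)" for x :: real
    by (rule derivative_eq_intros refl)+
  have "u 0 (- (- x0)) = 0"
  proof (rule bounded_solution_unique[where D = "\<lambda>x. u 0 (- x)" and B = M])
    fix x
    have "((\<lambda>x. u 0 (- x)) has_real_derivative ux 0 (- x) * (- 1)) (at x)"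
      by (rule DERIV_chain2[OF deriv_u neg]) (use T in simp)
    then show "((\<lambda>x. u 0 (- x)) has_real_derivative u 0 (- x)) (at x)"
      using \<open>\<And>x. ux 0 x = - u 0 x\<close> by simp
  qed (use u_le T in auto)
  with nz show False by simp
qed

end

section \<open>The coefficient of the exponential tail\<close>

locale CH_decaying = CH_lagrangian +
  fixes A \<kappa> :: real
  assumes \<kappa>: "\<kappa> > 1"
    and u0_nonzero: "\<exists>x. u 0 x \<noteq> 0"
    and u0_decay: "\<And>x. \<bar>u 0 x\<bar> \<le> A * exp (- \<kappa> * x)"
    and ux0_decay: "\<And>x. \<bar>ux 0 x\<bar> \<le> A * exp (- \<kappa> * x)"
begin

definition B :: real where
  "B = 4 * A * exp (6 * M * T) * exp (\<kappa> * M * T)"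

lemma A_nonneg: "A \<ge> 0"
  using u0_decay[of 0] by simp

lemma B_nonneg: "B \<ge> 0"
  using A_nonneg by (simp add: B_def)

text \<open>
  The weights $e^{\kappa \min(z, x)}$ are bounded, and their constants do not depend on the truncation
  point \<open>x\<close>.  The factor $e^{\kappa M T}$ in \<open>B\<close> accounts for the displacement of characteristics.
\<close>

lemma p_decay:
  assumes t: "t \<in> {0..T}"
  shows "\<bar>p t y\<bar> \<le> B * exp (- \<kappa> * y)"
proof -
  obtain x where x: "\<eta> x t = y" by (rule flow_surj[OF t])
  let ?w = "\<lambda>z. exp (\<kappa> * min z x)"
  have p0: "\<bar>p 0 z\<bar> \<le> 2 * A * exp (- \<kappa> * z)" for z
    using u0_decay[of z] ux0_decay[of z] by (simp add: p_def)
  have "?w x * \<bar>p t (\<eta> x t)\<bar> \<le> 2 * (2 * A) * exp (6 * M * T)"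
  proof (rule weighted_gronwall[OF _ t, where s = 0 and w = ?w and W = "exp (\<kappa> * x)"])
    show "?w z * \<bar>p 0 (\<eta> z 0)\<bar> \<le> 2 * A" for z
    proof -
      have "?w z * \<bar>p 0 z\<bar> \<le> exp (\<kappa> * z) * (2 * A * exp (- \<kappa> * z))"
        using p0[of z] \<kappa> by (intro mult_mono) auto
      also have "\<dots> = 2 * A" by (simp add: exp_minus)
      finally show ?thesis by (simp add: flow_0)
    qed
  qed (use T \<kappa> in \<open>auto simp: mono_def min_def\<close>)
  then have "\<bar>p t y\<bar> \<le> 4 * A * exp (6 * M * T) * exp (- \<kappa> * x)"
    using x by (simp add: exp_minus field_simps)
  also have "\<dots> \<le> 4 * A * exp (6 * M * T) * (exp (\<kappa> * M * T) * exp (- \<kappa> * y))"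
  proof -
    have "\<kappa> * y \<le> \<kappa> * (x + M * T)"
      using flow_displacement[OF t, of x] x \<kappa> by (intro mult_left_mono) auto
    then have "exp (- \<kappa> * x) \<le> exp (\<kappa> * M * T) * exp (- \<kappa> * y)"
      by (simp add: mult_exp_exp algebra_simps)
    then show ?thesis using A_nonneg by (intro mult_left_mono) auto
  qed
  finally show ?thesis by (simp add: B_def mult.assoc)
qed

text \<open>
  The number that $e^x u$ approaches at the rate given by the decay of its derivative $e^x p$.
\<close>

definition c :: "real \<Rightarrow> real" where
  "c t = (SOME c. \<forall>x. \<bar>c - exp x * u t x\<bar> \<le> B / (\<kappa> - 1) * exp (- (\<kappa> - 1) * x))"

lemma c_approx:
  assumes t: "t \<in> {0..T}"
  shows "\<bar>c t - exp x * u t x\<bar> \<le> B / (\<kappa> - 1) * exp (- (\<kappa> - 1) * x)"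
proof -
  have "\<exists>c. \<forall>x. \<bar>c - exp x * u t x\<bar> \<le> B / (\<kappa> - 1) * exp (- (\<kappa> - 1) * x)"
  proof (rule limit_of_exp_decaying_deriv[OF deriv_exp_u[OF t]])
    fix x
    have "\<bar>exp x * p t x\<bar> \<le> exp x * (B * exp (- \<kappa> * x))"
      using p_decay[OF t, of x] by (simp add: abs_mult)
    also have "\<dots> = B * exp (- (\<kappa> - 1) * x)"
      by (simp add: mult_exp_exp algebra_simps)
    finally show "\<bar>exp x * p t x\<bar> \<le> B * exp (- (\<kappa> - 1) * x)" .
  qed (use \<kappa> in auto)
  then show ?thesis unfolding c_def by (rule someI2_ex) blast
qed

lemma error_tendsto_0: "((\<lambda>x. C * exp (- (\<kappa> - 1) * x)) \<longlongrightarrow> 0) at_top"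
proof -
  have "((\<lambda>x. exp (- (\<kappa> - 1) * x)) \<longlongrightarrow> 0) at_top" using \<kappa> by real_asymp
  from tendsto_mult_right_zero[OF this] show ?thesis by simp
qed

lemma c_limit:
  assumes t: "t \<in> {0..T}"
  shows "((\<lambda>x. exp x * u t x) \<longlongrightarrow> c t) at_top"
proof (rule Lim_transform2[OF tendsto_const])
  show "((\<lambda>x. c t - exp x * u t x) \<longlongrightarrow> 0) at_top"
  proof (rule Lim_null_comparison[OF always_eventually error_tendsto_0], rule allI)
    show "norm (c t - exp x * u t x) \<le> B / (\<kappa> - 1) * exp (- (\<kappa> - 1) * x)" for x
      using c_approx[OF t, of x] by (simp only: real_norm_def)
  qed
qed

text \<open>
  The datum itself decays faster than $e^{-x}$.
\<close>

lemma c_0: "c 0 = 0"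
proof -
  have "norm (exp x * u 0 x) \<le> A * exp (- (\<kappa> - 1) * x)" for x
  proof -
    have "norm (exp x * u 0 x) \<le> exp x * (A * exp (- \<kappa> * x))"
      using u0_decay[of x] by (simp add: abs_mult)
    also have "\<dots> = A * exp (- (\<kappa> - 1) * x)"
      by (simp add: mult_exp_exp algebra_simps)
    finally show ?thesis .
  qed
  then have "((\<lambda>x. exp x * u 0 x) \<longlongrightarrow> 0) at_top"
    by (intro Lim_null_comparison[OF always_eventually error_tendsto_0]) auto
  then show ?thesis using c_limit[of 0] T tendsto_unique[OF trivial_limit_at_top_linorder] by auto
qed

lemma c_continuous: "continuous_on {0..T} c"
proof (rule uniform_limit_theorem[where F = at_top and f = "\<lambda>x t. exp x * u t x"])
  show "\<forall>\<^sub>F x in at_top. continuous_on {0..T} (\<lambda>t. exp x * u t x)"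
    by (intro always_eventually allI continuous_intros DERIV_continuous_on[OF euler_u])
  show "uniform_limit {0..T} (\<lambda>x t. exp x * u t x) c at_top"
  proof (rule uniform_limitI)
    fix e :: real assume "e > 0"
    with error_tendsto_0 have "\<forall>\<^sub>F x in at_top. B / (\<kappa> - 1) * exp (- (\<kappa> - 1) * x) < e"
      by (rule order_tendstoD)
    then show "\<forall>\<^sub>F x in at_top. \<forall>t\<in>{0..T}. dist (exp x * u t x) (c t) < e"
    proof eventually_elim
      case (elim x)
      show ?case
      proof
        fix t assume "t \<in> {0..T}"
        from order.strict_trans1[OF c_approx[OF this] elim]
        show "dist (exp x * u t x) (c t) < e" by (simp only: dist_real_def abs_minus_commute)
      qed
    qed
  qed
qed simp

text \<open>
  The average $J(y) = \int_{-\infty}^y e^{z-y} F(z)\,dz$ over the left half-line; it satisfies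
  $(e^y J)_y = e^y F$.
\<close>

definition Jm :: "real \<Rightarrow> real \<Rightarrow> real" where
  "Jm t y = exp_avg (\<lambda>z. F t (- z)) (- y)"

lemma Jm_nonneg: "t \<in> {0..T} \<Longrightarrow> Jm t y \<ge> 0"
  unfolding Jm_def
  by (rule bounded_continuous.exp_avg_nonneg[OF bounded_continuous.reflected[OF bounded_continuous_F]])
     (auto simp: F_def)

lemma deriv_exp_Jm:
  assumes t: "t \<in> {0..T}"
  shows "((\<lambda>y. exp y * Jm t y) has_real_derivative exp y * F t y) (at y)"
proof -
  have neg: "(uminus has_real_derivative - 1) (at y)"
    by (rule derivative_eq_intros refl)+
  have "((\<lambda>y. exp_avg (\<lambda>z. F t (- z)) (- y)) has_real_derivative
      (exp_avg (\<lambda>z. F t (- z)) (- y) - F t (- (- y))) * (- 1)) (at y)"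
    by (rule DERIV_chain2[OF bounded_continuous.exp_avg_deriv[OF bounded_continuous.reflected[OF bounded_continuous_F[OF t]]] neg])
  then have "(Jm t has_real_derivative F t y - Jm t y) (at y)"
    unfolding Jm_def[abs_def] by (rule DERIV_cong) simp
  from DERIV_mult[OF DERIV_exp this] show ?thesis
    by (rule DERIV_cong) (simp add: algebra_simps)
qed

text \<open>
  By \<open>exp_avg_F\<close>, the terms of $u_t$ apart from the average over the left half-line are
  $\tfrac34 u^2 - u p - \tfrac12 I$.  The square has the favourable sign, and the other two carry the
  decay of \<open>p\<close>.
\<close>

lemma deriv_time_exp_u:
  assumes t: "t \<in> {0..T}"
  obtains d where "((\<lambda>r. exp x * u r x) has_real_derivative d) (at t within {0..T})"
    "d \<ge> exp x * Jm t x / 2 - 2 * M * B * exp (- (\<kappa> - 1) * x)"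
proof -
  let ?d = "- (u t x * ux t x) + (Jm t x - exp_avg (F t) x) / 2"
  have \<beta>: "\<bar>p t y\<bar> \<le> B * exp (- \<kappa> * x)" if "y \<ge> x" for y
  proof -
    have "B * exp (- \<kappa> * y) \<le> B * exp (- \<kappa> * x)"
      using that \<kappa> B_nonneg by (intro mult_left_mono) auto
    with p_decay[OF t, of y] show ?thesis by linarith
  qed
  have I: "I t x \<le> M * (B * exp (- \<kappa> * x))" by (rule I_le[OF t \<beta>])
  have up: "u t x * p t x \<le> M * (B * exp (- \<kappa> * x))"
  proof -
    have "\<bar>u t x\<bar> * \<bar>p t x\<bar> \<le> M * (B * exp (- \<kappa> * x))"
      using u_le[OF t, of x] \<beta>[of x] M by (intro mult_mono) auto
    then show ?thesis using abs_ge_self[of "u t x * p t x"] by (simp add: abs_mult)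
  qed
  have "?d = Jm t x / 2 + (3 / 4) * (u t x)\<^sup>2 - u t x * p t x - I t x / 2"
    unfolding exp_avg_F[OF t] by (simp add: p_def power2_eq_square field_simps)
  moreover have "(3 / 4) * (u t x)\<^sup>2 \<ge> 0" by simp
  ultimately have "?d \<ge> Jm t x / 2 - 2 * (M * (B * exp (- \<kappa> * x)))"
    using I up I_nonneg[OF t, of x] M B_nonneg \<kappa> 
    by (smt (verit, best) exp_gt_zero field_sum_of_halves mult_nonneg_nonneg)
  then have "exp x * ?d \<ge> exp x * (Jm t x / 2 - 2 * (M * (B * exp (- \<kappa> * x))))"
    by (intro mult_left_mono) auto
  also have "exp x * (Jm t x / 2 - 2 * (M * (B * exp (- \<kappa> * x)))) = exp x * Jm t x / 2 - 2 * M * B * (exp x * exp (- \<kappa> * x))"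
    by (simp add: algebra_simps)
  also have "exp x * exp (- \<kappa> * x) = exp (- (\<kappa> - 1) * x)" by (simp add: mult_exp_exp algebra_simps)
  finally have "exp x * ?d \<ge> exp x * Jm t x / 2 - 2 * M * B * exp (- (\<kappa> - 1) * x)" .
  moreover have "((\<lambda>r. exp x * u r x) has_real_derivative exp x * ?d) (at t within {0..T})"
    using DERIV_cmult[OF euler_u[OF t, of x]] unfolding Jm_def F_def[abs_def] .
  ultimately show ?thesis using that by blast
qed

lemma exp_u_increment:
  assumes rs: "0 \<le> r" "r \<le> s" "s \<le> T"
    and Jm: "\<And>q. q \<in> {r..s} \<Longrightarrow> exp x * Jm q x \<ge> 2 * \<delta>"
  shows "exp x * u s x - exp x * u r x \<ge> (\<delta> - 2 * M * B * exp (- (\<kappa> - 1) * x)) * (s - r)"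
proof -
  let ?C = "\<delta> - 2 * M * B * exp (- (\<kappa> - 1) * x)"
  have "\<forall>q\<in>{0..T}. \<exists>d. ((\<lambda>r. exp x * u r x) has_real_derivative d) (at q within {0..T}) \<and>
    d \<ge> exp x * Jm q x / 2 - 2 * M * B * exp (- (\<kappa> - 1) * x)"
    using deriv_time_exp_u by metis
  then obtain d where d: "\<And>q. q \<in> {0..T} \<Longrightarrow> ((\<lambda>r. exp x * u r x) has_real_derivative d q) (at q within {0..T})"
    "\<And>q. q \<in> {0..T} \<Longrightarrow> d q \<ge> exp x * Jm q x / 2 - 2 * M * B * exp (- (\<kappa> - 1) * x)"
    by metis
  have "exp x * u r x - ?C * r \<le> exp x * u s x - ?C * s"
  proof (rule nondecreasing_of_deriv_within[OF rs(2), of "{0..T}"])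
    fix q assume q: "q \<in> {r..s}"
    then have q': "q \<in> {0..T}" using rs by auto
    show "((\<lambda>r. exp x * u r x - ?C * r) has_real_derivative d q - ?C * 1) (at q within {0..T})"
      by (intro DERIV_diff DERIV_cmult d(1)[OF q'] DERIV_ident)
    show "d q - ?C * 1 \<ge> 0" using d(2)[OF q'] Jm[OF q] by simp
  qed (use rs in auto)
  then show ?thesis by (simp add: algebra_simps)
qed

lemma c_increment:
  assumes rs: "0 \<le> r" "r \<le> s" "s \<le> T"
    and Jm: "\<And>x q. x \<ge> y \<Longrightarrow> q \<in> {r..s} \<Longrightarrow> exp x * Jm q x \<ge> 2 * \<delta>"
  shows "c s - c r \<ge> \<delta> * (s - r)"
proof (rule tendsto_le[OF trivial_limit_at_top_linorder])
  show "((\<lambda>x. exp x * u s x - exp x * u r x) \<longlongrightarrow> c s - c r) at_top"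
    by (intro tendsto_diff c_limit) (use rs in auto)
  have "((\<lambda>x. (\<delta> - 2 * M * B * exp (- (\<kappa> - 1) * x)) * (s - r)) \<longlongrightarrow> (\<delta> - 0) * (s - r)) at_top"
    by (intro tendsto_intros error_tendsto_0)
  then show "((\<lambda>x. (\<delta> - 2 * M * B * exp (- (\<kappa> - 1) * x)) * (s - r)) \<longlongrightarrow> \<delta> * (s - r)) at_top"
    by simp
  show "\<forall>\<^sub>F x in at_top. (\<delta> - 2 * M * B * exp (- (\<kappa> - 1) * x)) * (s - r) \<le> exp x * u s x - exp x * u r x"
    using eventually_ge_at_top[of y] by eventually_elim (rule exp_u_increment[OF rs Jm])
qed

lemma c_mono: "0 \<le> r \<Longrightarrow> r \<le> s \<Longrightarrow> s \<le> T \<Longrightarrow> c r \<le> c s"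
  using c_increment[of r s 0 0] Jm_nonneg by auto

text \<open>
  Near a point where \<open>u\<close> does not vanish, \<open>u\<close> stays away from zero on a space-time rectangle.  As
  $e^x J$ is nondecreasing in \<open>x\<close>, the contribution of this rectangle persists for all large \<open>x\<close>.
\<close>

lemma Jm_lower_bound:
  assumes r: "0 \<le> r" "r < T"
  shows "\<exists>s y \<delta>. r < s \<and> s \<le> T \<and> \<delta> > 0 \<and>
    (\<forall>q\<in>{r..s}. \<forall>x\<ge>y. exp x * Jm q x \<ge> 2 * \<delta>)"
proof -
  have r': "r \<in> {0..T}" using r by auto
  obtain x0 where "u 0 x0 \<noteq> 0" using u0_nonzero by auto
  then obtain y0 where y0: "u r y0 \<noteq> 0" using never_vanishes[OF r'] by auto
  define \<alpha> where "\<alpha> = \<bar>u r y0\<bar>"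
  have \<alpha>: "\<alpha> > 0" using y0 by (simp add: \<alpha>_def)
  have "continuous_on {0..T} (\<lambda>t. u t y0)" by (rule DERIV_continuous_on[OF euler_u])
  then obtain d where d: "d > 0" "\<And>q. q \<in> {0..T} \<Longrightarrow> dist q r < d \<Longrightarrow> dist (u q y0) (u r y0) < \<alpha> / 4"
    unfolding continuous_on_iff using r' \<alpha> by (metis divide_pos_pos zero_less_numeral)
  define s where "s = min T (r + d / 2)"
  \<comment> \<open>over the distance \<open>l\<close> the values of \<open>u\<close> change by at most \<open>\<alpha> / 4\<close>\<close>
  define l where "l = \<alpha> / (4 * M)"
  have l: "l > 0" using \<alpha> M by (simp add: l_def)
  define \<delta> where "\<delta> = exp y0 * (\<alpha> / 2)\<^sup>2 * l / 2"
  show ?thesis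
  proof (rule exI[of _ s], rule exI[of _ "y0 + l"], rule exI[of _ \<delta>], intro conjI ballI allI impI)
    show "r < s" "s \<le> T" using r d by (auto simp: s_def)
    show "\<delta> > 0" using \<alpha> l by (simp add: \<delta>_def)
    fix q x assume q: "q \<in> {r..s}" and x: "x \<ge> y0 + l"
    have q': "q \<in> {0..T}" using q r by (auto simp: s_def)
    have qd: "\<bar>u q y0 - u r y0\<bar> < \<alpha> / 4"
      using d(2)[OF q'] q d(1) by (auto simp: s_def dist_real_def)
    have F: "exp z * F q z \<ge> exp y0 * (\<alpha> / 2)\<^sup>2" if z: "z \<in> {y0..y0 + l}" for z
    proof -
      have "\<bar>u q z - u q y0\<bar> \<le> M * l"
      proof -
        have "M * \<bar>z - y0\<bar> \<le> M * l" using z M by (intro mult_left_mono) auto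
        with u_lipschitz[OF q', of z y0] show ?thesis by linarith
      qed
      also have "M * l = \<alpha> / 4" using M by (simp add: l_def)
      finally have "\<alpha> / 2 \<le> \<bar>u q z\<bar>" using qd unfolding \<alpha>_def by linarith
      then have "(\<alpha> / 2)\<^sup>2 \<le> (u q z)\<^sup>2" using \<alpha> by (metis abs_ge_zero less_eq_real_def half_gt_zero power2_abs power_mono)
      also have "\<dots> \<le> F q z" by (simp add: F_def)
      finally show ?thesis using z by (intro mult_mono) auto
    qed
    have "exp y0 * Jm q y0 - (exp y0 * (\<alpha> / 2)\<^sup>2) * y0 \<le> exp (y0 + l) * Jm q (y0 + l) - (exp y0 * (\<alpha> / 2)\<^sup>2) * (y0 + l)"
    proof (rule nondecreasing_of_deriv_within[where S = UNIV and a = y0 and b = "y0 + l"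
          and f = "\<lambda>z. exp z * Jm q z - (exp y0 * (\<alpha> / 2)\<^sup>2) * z"])
      fix z assume z: "z \<in> {y0..y0 + l}"
      show "((\<lambda>z. exp z * Jm q z - (exp y0 * (\<alpha> / 2)\<^sup>2) * z) has_real_derivative exp z * F q z - exp y0 * (\<alpha> / 2)\<^sup>2 * 1) (at z)"
        by (intro DERIV_diff DERIV_cmult deriv_exp_Jm[OF q'] DERIV_ident)
      show "exp z * F q z - exp y0 * (\<alpha> / 2)\<^sup>2 * 1 \<ge> 0" using F[OF z] by simp
    qed (use l in auto)
    moreover have "exp y0 * Jm q y0 \<ge> 0" using Jm_nonneg[OF q'] by simp
    ultimately have "2 * \<delta> \<le> exp (y0 + l) * Jm q (y0 + l)" by (simp add: \<delta>_def algebra_simps)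
    also have "\<dots> \<le> exp x * Jm q x"
      by (rule nondecreasing_of_deriv_within[where S = UNIV, OF x _ deriv_exp_Jm[OF q']])
         (auto simp: F_def)
    finally show "exp x * Jm q x \<ge> 2 * \<delta>" .
  qed
qed

lemma c_strict_mono:
  assumes "0 \<le> r" "r < t" "t \<le> T"
  shows "c r < c t"
proof -
  obtain s y \<delta> where s: "r < s" "s \<le> T" "\<delta> > 0"
    "\<forall>q\<in>{r..s}. \<forall>x\<ge>y. exp x * Jm q x \<ge> 2 * \<delta>"
    using Jm_lower_bound[of r] assms by auto
  define s' where "s' = min s t"
  have s': "r < s'" "s' \<le> t" "s' \<le> s" using s assms by (auto simp: s'_def)
  have "\<delta> * (s' - r) \<le> c s' - c r"
    by (rule c_increment[of _ _ y]) (use s s' assms in auto)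
  moreover have "\<delta> * (s' - r) > 0" using s s' by simp
  moreover have "c s' \<le> c t" by (rule c_mono) (use s' assms in auto)
  ultimately show ?thesis by linarith
qed

lemma c_pos: "0 < t \<Longrightarrow> t \<le> T \<Longrightarrow> c t > 0"
  using c_strict_mono[of 0 t] c_0 by simp

end

section \<open>Decay of the momentum\<close>

context CH_lagrangian
begin

text \<open>
  The rate of change of \<open>p\<close> along the flow.
\<close>

definition R :: "real \<Rightarrow> real \<Rightarrow> real" where
  "R t z = p t z * u t z - (p t z)\<^sup>2 / 2 - I t z"

lemma R_difference_le:
  assumes t: "t \<in> {0..T}" and z: "z1 \<le> z2" and \<beta>: "\<And>z. z \<ge> z1 \<Longrightarrow> \<bar>p t z\<bar> \<le> \<beta>"
  shows "\<bar>R t z2 - R t z1\<bar> \<le> 3 * M * \<bar>p t z2 - p t z1\<bar> + 3 * M * \<beta> * (z2 - z1)"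
proof -
  have \<beta>0: "\<beta> \<ge> 0" using \<beta>[of z1] by simp
  have "\<bar>I t z2 - I t z1\<bar> \<le> 2 * M * \<beta> * z2 - 2 * M * \<beta> * z1"
  proof (rule abs_diff_le_of_deriv_le[OF z, where S = UNIV])
    fix z assume z: "z \<in> {z1..z2}"
    show "(I t has_real_derivative I t z - (p t z)\<^sup>2 / 2) (at z)" by (rule deriv_I[OF t])
    show "((\<lambda>z. 2 * M * \<beta> * z) has_real_derivative 2 * M * \<beta> * 1) (at z)"
      by (intro DERIV_cmult DERIV_ident)
    have "I t z \<le> M * \<beta>" by (rule I_le[OF t]) (use z \<beta> in auto)
    moreover have "(p t z)\<^sup>2 / 2 \<le> M * \<beta>" by (rule half_p_square_le[OF t \<beta>]) (use z in auto)
    moreover have "I t z \<ge> 0" "(p t z)\<^sup>2 / 2 \<ge> 0" using I_nonneg[OF t] by auto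
    ultimately show "\<bar>I t z - (p t z)\<^sup>2 / 2\<bar> \<le> 2 * M * \<beta> * 1" by linarith
  qed auto
  then have 1: "\<bar>I t z2 - I t z1\<bar> \<le> 2 * M * \<beta> * (z2 - z1)" by (simp add: algebra_simps)
  have "\<bar>p t z2 * u t z2 - p t z1 * u t z1\<bar> = \<bar>(p t z2 - p t z1) * u t z2 + p t z1 * (u t z2 - u t z1)\<bar>"
    by (simp add: algebra_simps)
  also have "\<dots> \<le> \<bar>p t z2 - p t z1\<bar> * \<bar>u t z2\<bar> + \<bar>p t z1\<bar> * \<bar>u t z2 - u t z1\<bar>"
    by (metis abs_mult abs_triangle_ineq)
  also have "\<dots> \<le> \<bar>p t z2 - p t z1\<bar> * M + \<beta> * (M * \<bar>z2 - z1\<bar>)"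
    using \<beta>[of z1] \<beta>0 by (intro add_mono mult_mono u_le[OF t] u_lipschitz[OF t]) auto
  finally have 2: "\<bar>p t z2 * u t z2 - p t z1 * u t z1\<bar> \<le> M * \<bar>p t z2 - p t z1\<bar> + M * \<beta> * (z2 - z1)"
    using z by (simp add: mult.commute mult.left_commute)
  have "\<bar>(p t z2)\<^sup>2 / 2 - (p t z1)\<^sup>2 / 2\<bar> = \<bar>p t z2 + p t z1\<bar> / 2 * \<bar>p t z2 - p t z1\<bar>"
  proof -
    have "(p t z2)\<^sup>2 / 2 - (p t z1)\<^sup>2 / 2 = (p t z2 + p t z1) / 2 * (p t z2 - p t z1)"
      by (simp add: power2_eq_square algebra_simps)
    then show ?thesis by (simp only: abs_mult abs_divide abs_numeral)
  qed
  also have "\<dots> \<le> 2 * M * \<bar>p t z2 - p t z1\<bar>"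
    using p_le[OF t, of z1] p_le[OF t, of z2] by (intro mult_right_mono) auto
  finally have 3: "\<bar>(p t z2)\<^sup>2 / 2 - (p t z1)\<^sup>2 / 2\<bar> \<le> 2 * M * \<bar>p t z2 - p t z1\<bar>" .
  have "\<bar>R t z2 - R t z1\<bar> \<le> \<bar>p t z2 * u t z2 - p t z1 * u t z1\<bar> + \<bar>(p t z2)\<^sup>2 / 2 - (p t z1)\<^sup>2 / 2\<bar> + \<bar>I t z2 - I t z1\<bar>"
    unfolding R_def by linarith
  with 1 2 3 show ?thesis by (simp add: algebra_simps)
qed

end

context CH_decaying
begin

text \<open>
  The increment of \<open>p\<close> between two characteristics satisfies a scalar Gronwall inequality.  The
  inhomogeneous term carries the decay of \<open>p\<close> and the distance of the labels, so that division by
  this distance gives an estimate for the derivative.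
\<close>

lemma p_increment_le:
  assumes t: "t \<in> {0..T}" and xy: "x < y"
  shows "\<bar>p t (\<eta> y t) - p t (\<eta> x t)\<bar>
    \<le> 2 * (\<bar>p 0 y - p 0 x\<bar> + 3 * M * B * exp (\<kappa> * M * T) * exp (M * T) * T * exp (- \<kappa> * x) * (y - x)) * exp (6 * M * T)"
proof -
  define \<beta> where "\<beta> = B * exp (\<kappa> * M * T) * exp (- \<kappa> * x)"
  have \<beta>0: "\<beta> \<ge> 0" using B_nonneg by (simp add: \<beta>_def)
  define E where "E = 3 * M * \<beta> * ((y - x) * exp (M * T))"
  have \<beta>: "\<bar>p r z\<bar> \<le> \<beta>" if r: "r \<in> {0..T}" and z: "z \<ge> \<eta> x r" for r z
  proof -
    have "\<kappa> * (x - M * T) \<le> \<kappa> * z"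
      using flow_displacement[OF r, of x] z \<kappa> by (intro mult_left_mono) auto
    then have "exp (- \<kappa> * z) \<le> exp (\<kappa> * M * T) * exp (- \<kappa> * x)"
      by (simp add: mult_exp_exp algebra_simps)
    then have "B * exp (- \<kappa> * z) \<le> \<beta>"
      unfolding \<beta>_def mult.assoc by (rule mult_left_mono[OF _ B_nonneg])
    with p_decay[OF r, of z] show ?thesis by linarith
  qed
  have "\<bar>p t (\<eta> y t) - p t (\<eta> x t)\<bar> \<le> 2 * (\<bar>p 0 y - p 0 x\<bar> + E * T) * exp (2 * (3 * M) * T)"
  proof (rule family_gronwall[where f = "\<lambda>_::unit. \<lambda>t. p t (\<eta> y t) - p t (\<eta> x t)"
        and f' = "\<lambda>_ t. R t (\<eta> y t) - R t (\<eta> x t)" and A = "4 * M" and T = T and K = "3 * M" and E = E, OF _ _ _ _ _ _ _ t])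
    fix r assume r: "r \<in> {0..T}"
    show "((\<lambda>t. p t (\<eta> y t) - p t (\<eta> x t)) has_real_derivative R r (\<eta> y r) - R r (\<eta> x r)) (at r within {0..T})"
      unfolding R_def by (intro DERIV_diff lagrange_p[OF r])
    show "\<bar>p r (\<eta> y r) - p r (\<eta> x r)\<bar> \<le> 4 * M"
      using p_le[OF r, of "\<eta> y r"] p_le[OF r, of "\<eta> x r"] by linarith
    fix Z assume Z: "\<And>j::unit. \<bar>p r (\<eta> y r) - p r (\<eta> x r)\<bar> \<le> Z"
    have "\<bar>R r (\<eta> y r) - R r (\<eta> x r)\<bar> \<le> 3 * M * \<bar>p r (\<eta> y r) - p r (\<eta> x r)\<bar> + 3 * M * \<beta> * (\<eta> y r - \<eta> x r)"
      by (rule R_difference_le[OF r _ \<beta>[OF r]]) (use flow_gap(3)[OF r xy] in auto)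
    also have "\<dots> \<le> 3 * M * Z + E"
      unfolding E_def using Z flow_gap(2)[OF r xy] M \<beta>0 by (intro add_mono mult_left_mono) auto
    finally show "\<bar>R r (\<eta> y r) - R r (\<eta> x r)\<bar> \<le> 3 * M * Z + E" .
  next
    show "0 \<in> {0..T}" using T by simp
    show "\<bar>p 0 (\<eta> y 0) - p 0 (\<eta> x 0)\<bar> \<le> \<bar>p 0 y - p 0 x\<bar>" by (simp add: flow_0)
    show "0 \<le> E" using M \<beta>0 xy by (simp add: E_def)
    show "0 < 3 * M" using M by simp
  qed
  then show ?thesis by (simp add: E_def \<beta>_def mult.commute mult.left_commute)
qed

text \<open>
  Divide the estimate for increments by the distance of the characteristics, which is comparable to
  that of their labels, and let the labels merge.
\<close>

lemma px_lagrangian_le: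
  assumes t: "t \<in> {0..T}"
  shows "\<bar>ux t (\<eta> x t) + uxx t (\<eta> x t)\<bar>
    \<le> 2 * exp (7 * M * T) * (\<bar>ux 0 x + uxx 0 x\<bar> + 3 * M * B * exp (\<kappa> * M * T) * exp (M * T) * T * exp (- \<kappa> * x))"
proof (rule tendsto_le[OF trivial_limit_at_right_real])
  let ?E = "3 * M * B * exp (\<kappa> * M * T) * exp (M * T) * T * exp (- \<kappa> * x)"
  have fl: "filterlim (\<lambda>y. \<eta> y t) (at (\<eta> x t)) (at_right x)"
  proof (rule filterlim_atI)
    have "((\<lambda>y. \<eta> y t) \<longlongrightarrow> \<eta> x t) (at x)"
      using flow_continuous_label[OF t] by (simp add: continuous_on_eq_continuous_at isCont_def)
    then show "((\<lambda>y. \<eta> y t) \<longlongrightarrow> \<eta> x t) (at_right x)"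
      by (rule tendsto_mono[OF at_le[OF subset_UNIV]])
    show "\<forall>\<^sub>F y in at_right x. \<eta> y t \<noteq> \<eta> x t"
      using eventually_at_right_less[of x] by eventually_elim (use flow_gap(3)[OF t] in force)
  qed
  have "((\<lambda>z. (p t z - p t (\<eta> x t)) / (z - \<eta> x t)) \<longlongrightarrow> ux t (\<eta> x t) + uxx t (\<eta> x t)) (at (\<eta> x t))"
    using deriv_p[OF t, of "\<eta> x t"] by (simp add: has_field_derivative_iff)
  from tendsto_rabs[OF filterlim_compose[OF this fl]]
  show "((\<lambda>y. \<bar>(p t (\<eta> y t) - p t (\<eta> x t)) / (\<eta> y t - \<eta> x t)\<bar>) \<longlongrightarrow> \<bar>ux t (\<eta> x t) + uxx t (\<eta> x t)\<bar>) (at_right x)" .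
  have "((\<lambda>y. (p 0 y - p 0 x) / (y - x)) \<longlongrightarrow> ux 0 x + uxx 0 x) (at x)"
    using deriv_p[of 0 x] T by (simp add: has_field_derivative_iff)
  then have "((\<lambda>y. (p 0 y - p 0 x) / (y - x)) \<longlongrightarrow> ux 0 x + uxx 0 x) (at_right x)"
    by (rule tendsto_mono[OF at_le[OF subset_UNIV]])
  then show "((\<lambda>y. 2 * exp (7 * M * T) * (\<bar>(p 0 y - p 0 x) / (y - x)\<bar> + ?E))
      \<longlongrightarrow> 2 * exp (7 * M * T) * (\<bar>ux 0 x + uxx 0 x\<bar> + ?E)) (at_right x)"
    by (intro tendsto_intros)
  show "\<forall>\<^sub>F y in at_right x. \<bar>(p t (\<eta> y t) - p t (\<eta> x t)) / (\<eta> y t - \<eta> x t)\<bar>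
      \<le> 2 * exp (7 * M * T) * (\<bar>(p 0 y - p 0 x) / (y - x)\<bar> + ?E)"
    using eventually_at_right_less[of x]
  proof eventually_elim
    case (elim y)
    have gap: "(y - x) * exp (- M * T) \<le> \<eta> y t - \<eta> x t" "\<eta> y t - \<eta> x t > 0"
      using flow_gap[OF t elim] by auto
    have pos: "(y - x) * exp (- M * T) > 0" using elim by simp
    have "\<bar>(p t (\<eta> y t) - p t (\<eta> x t)) / (\<eta> y t - \<eta> x t)\<bar> = \<bar>p t (\<eta> y t) - p t (\<eta> x t)\<bar> / (\<eta> y t - \<eta> x t)"
      using gap by simp
    also have "\<dots> \<le> \<bar>p t (\<eta> y t) - p t (\<eta> x t)\<bar> / ((y - x) * exp (- M * T))"
      using gap pos by (intro divide_left_mono) auto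
    also have "\<dots> \<le> (2 * (\<bar>p 0 y - p 0 x\<bar> + ?E * (y - x)) * exp (6 * M * T)) / ((y - x) * exp (- M * T))"
      by (rule divide_right_mono[OF p_increment_le[OF t elim] less_imp_le[OF pos]])
    also have "\<dots> = 2 * (exp (6 * M * T) * exp (M * T)) * (\<bar>(p 0 y - p 0 x) / (y - x)\<bar> + ?E)"
    proof -
      have cancel: "2 * (a + e * h) * q / (h * exp (- m * T)) = 2 * (q * exp (m * T)) * (a / h + e)"
        if "h > 0" for a e h q m :: real
        using that by (simp add: exp_minus field_simps)
      have "\<bar>(p 0 y - p 0 x) / (y - x)\<bar> = \<bar>p 0 y - p 0 x\<bar> / (y - x)" using elim by simp
      then show ?thesis by (simp only: cancel[of "y - x"] elim diff_gt_0_iff_gt)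
    qed
    also have "exp (6 * M * T) * exp (M * T) = exp (7 * M * T)" by (simp add: mult_exp_exp)
    finally show ?case .
  qed
qed

text \<open>
  The momentum is $h = p - p_x$.
\<close>

lemma h_decay:
  assumes t: "t \<in> {0..T}" and init: "\<And>x. x \<ge> X \<Longrightarrow> \<bar>ux 0 x + uxx 0 x\<bar> \<le> A' * exp (- \<kappa> * x)"
  shows "\<exists>C. \<forall>z\<ge>X + M * T. \<bar>u t z - uxx t z\<bar> \<le> C * exp (- \<kappa> * z)"
proof -
  define D where "D = 2 * exp (7 * M * T) * (A' + 3 * M * B * exp (\<kappa> * M * T) * exp (M * T) * T)"
  have A'0: "A' \<ge> 0" 
    using order_trans[OF abs_ge_zero init[of X]] by (simp add: zero_le_mult_iff)
  have D0: "D \<ge> 0" unfolding D_def using A'0 M T B_nonneg by (intro mult_nonneg_nonneg add_nonneg_nonneg) auto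
  show ?thesis
  proof (intro exI[of _ "B + D * exp (\<kappa> * M * T)"] allI impI)
    fix z assume z: "z \<ge> X + M * T"
    obtain x where x: "\<eta> x t = z" by (rule flow_surj[OF t])
    have xz: "z - M * T \<le> x" using flow_displacement[OF t, of x] x by auto
    have "\<bar>ux t z + uxx t z\<bar> \<le> 2 * exp (7 * M * T) * (\<bar>ux 0 x + uxx 0 x\<bar> + 3 * M * B * exp (\<kappa> * M * T) * exp (M * T) * T * exp (- \<kappa> * x))"
      using px_lagrangian_le[OF t, of x] unfolding x .
    also have "\<dots> \<le> 2 * exp (7 * M * T) * (A' * exp (- \<kappa> * x) + 3 * M * B * exp (\<kappa> * M * T) * exp (M * T) * T * exp (- \<kappa> * x))"
      using init[of x] xz z by (intro mult_left_mono add_right_mono) auto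
    also have "\<dots> = D * exp (- \<kappa> * x)" by (simp add: D_def algebra_simps)
    also have "\<dots> \<le> D * (exp (\<kappa> * M * T) * exp (- \<kappa> * z))"
    proof (rule mult_left_mono[OF _ D0])
      have "\<kappa> * (z - M * T) \<le> \<kappa> * x" using xz \<kappa> by (intro mult_left_mono) auto
      then show "exp (- \<kappa> * x) \<le> exp (\<kappa> * M * T) * exp (- \<kappa> * z)"
        by (simp add: mult_exp_exp algebra_simps)
    qed
    finally have px: "\<bar>ux t z + uxx t z\<bar> \<le> D * exp (\<kappa> * M * T) * exp (- \<kappa> * z)" by (simp add: mult.assoc)
    have "\<bar>u t z - uxx t z\<bar> \<le> \<bar>p t z\<bar> + \<bar>ux t z + uxx t z\<bar>" unfolding p_def by linarith
    with px p_decay[OF t, of z] show "\<bar>u t z - uxx t z\<bar> \<le> (B + D * exp (\<kappa> * M * T)) * exp (- \<kappa> * z)"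
      by (simp add: distrib_right)
  qed
qed

end

section \<open>From strong solutions to characteristics\<close>

text \<open>
  The suprema over space depend continuously on time, hence are bounded on the compact interval.
\<close>

lemma uniform_bound_on_interval:
  fixes f :: "real \<Rightarrow> real \<Rightarrow> real"
  assumes T: "T > 0"
    and bdd: "\<And>t. t \<in> {0..T} \<Longrightarrow> \<exists>B. \<forall>x. \<bar>f t x\<bar> \<le> B"
    and cont: "\<And>t. t \<in> {0..T} \<Longrightarrow>
      \<exists>N. (N \<longlongrightarrow> 0) (at t within {0..T}) \<and> (\<forall>r\<in>{0..T}. \<forall>x. \<bar>f r x - f t x\<bar> \<le> N r)"
  obtains M where "\<And>t x. t \<in> {0..T} \<Longrightarrow> \<bar>f t x\<bar> \<le> M"
proof -
  define b where "b t = (SUP x. \<bar>f t x\<bar>)" for t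
  have up: "\<bar>f t x\<bar> \<le> b t" if t: "t \<in> {0..T}" for t x
  proof -
    obtain B where "\<forall>x. \<bar>f t x\<bar> \<le> B" using bdd[OF t] by blast
    then have "bdd_above (range (\<lambda>x. \<bar>f t x\<bar>))" by (intro bdd_aboveI[of _ B]) auto
    then show ?thesis unfolding b_def by (rule cSUP_upper[rotated]) simp
  qed
  have "continuous_on {0..T} b"
    unfolding continuous_on_def
  proof
    fix t assume t: "t \<in> {0..T}"
    obtain N where N: "(N \<longlongrightarrow> 0) (at t within {0..T})" "\<forall>r\<in>{0..T}. \<forall>x. \<bar>f r x - f t x\<bar> \<le> N r"
      using cont[OF t] by blast
    have bN: "norm (b r - b t) \<le> N r" if r: "r \<in> {0..T}" for r
    proof -
      have 1: "\<bar>f r x\<bar> \<le> b t + N r" for x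
        using N(2)[rule_format, OF r, of x] up[OF t, of x] by linarith
      have 2: "\<bar>f t x\<bar> \<le> b r + N r" for x
        using N(2)[rule_format, OF r, of x] up[OF r, of x] by linarith
      have "b r \<le> b t + N r" unfolding b_def[of r] by (rule cSUP_least) (use 1 in auto)
      moreover have "b t \<le> b r + N r" unfolding b_def[of t] by (rule cSUP_least) (use 2 in auto)
      ultimately show ?thesis by simp
    qed
    have "\<forall>\<^sub>F r in at t within {0..T}. norm (b r - b t) \<le> N r"
      using bN by (auto simp: eventually_at_filter)
    then have "((\<lambda>r. b r - b t) \<longlongrightarrow> 0) (at t within {0..T})"
      by (rule Lim_null_comparison[OF _ N(1)])
    then show "(b \<longlongrightarrow> b t) (at t within {0..T})" by (simp add: LIM_zero_iff)
  qed
  then have "compact (b ` {0..T})" by (rule compact_continuous_image) simp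
  then obtain M where M: "\<forall>y\<in>b ` {0..T}. norm y \<le> M"
    using compact_imp_bounded bounded_iff by blast
  show ?thesis
  proof (rule that[of M])
    fix t x assume t: "t \<in> {0..T}"
    have "\<bar>b t\<bar> \<le> M" using M t by auto
    with up[OF t, of x] show "\<bar>f t x\<bar> \<le> M" by linarith
  qed
qed

text \<open>
  The chain rule for $r \mapsto g(r, \gamma(r))$ when the time derivative of \<open>g\<close> is only known as
  a limit of difference quotients that is uniform in space: uniformity allows evaluation at the
  moving point $\gamma(r)$.
\<close>

lemma deriv_along_curve:
  fixes g :: "real \<Rightarrow> real \<Rightarrow> real"
  assumes quot: "\<And>r x. r \<in> S \<Longrightarrow> r \<noteq> t \<Longrightarrow> \<bar>(g r x - g t x) / (r - t) - G x\<bar> \<le> N r"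
    and N: "(N \<longlongrightarrow> 0) (at t within S)"
    and G: "isCont G (\<gamma> t)"
    and g: "(g t has_real_derivative D) (at (\<gamma> t))"
    and \<gamma>: "(\<gamma> has_real_derivative e) (at t within S)"
  shows "((\<lambda>r. g r (\<gamma> r)) has_real_derivative G (\<gamma> t) + D * e) (at t within S)"
proof -
  have "(\<gamma> \<longlongrightarrow> \<gamma> t) (at t within S)"
    using DERIV_isCont \<gamma> by (metis continuous_within has_field_derivative_imp_has_derivative has_derivative_continuous)
  then have G': "((\<lambda>r. G (\<gamma> r)) \<longlongrightarrow> G (\<gamma> t)) (at t within S)"
    by (rule isCont_tendsto_compose[OF G])
  have "\<forall>\<^sub>F r in at t within S. norm ((g r (\<gamma> r) - g t (\<gamma> r)) / (r - t) - G (\<gamma> r)) \<le> N r"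
    using quot by (auto simp: eventually_at_filter)
  then have "((\<lambda>r. (g r (\<gamma> r) - g t (\<gamma> r)) / (r - t) - G (\<gamma> r)) \<longlongrightarrow> 0) (at t within S)"
    by (rule Lim_null_comparison[OF _ N])
  from tendsto_add[OF this G']
  have 1: "((\<lambda>r. (g r (\<gamma> r) - g t (\<gamma> r)) / (r - t)) \<longlongrightarrow> G (\<gamma> t)) (at t within S)" by simp
  have "((\<lambda>r. g t (\<gamma> r)) has_real_derivative D * e) (at t within S)"
    by (rule DERIV_chain2[OF g \<gamma>])
  then have 2: "((\<lambda>r. (g t (\<gamma> r) - g t (\<gamma> t)) / (r - t)) \<longlongrightarrow> D * e) (at t within S)"
    by (simp add: has_field_derivative_iff)
  have "((\<lambda>r. (g r (\<gamma> r) - g t (\<gamma> t)) / (r - t)) \<longlongrightarrow> G (\<gamma> t) + D * e) (at t within S)"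
    using tendsto_add[OF 1 2] by (simp add: add_divide_distrib[symmetric])
  then show ?thesis by (simp add: has_field_derivative_iff)
qed

lemma deriv_CH_kernel:
  "z > 0 \<Longrightarrow> deriv CH_kernel z = - exp (- z) / 2"
  "z < 0 \<Longrightarrow> deriv CH_kernel z = exp z / 2"
proof -
  assume z: "z > 0"
  have "((\<lambda>z. exp (- z) / 2) has_real_derivative - exp (- z) / 2) (at z)"
    by (auto intro!: derivative_eq_intros)
  then have "(CH_kernel has_real_derivative - exp (- z) / 2) (at z)"
    by (rule has_field_derivative_transform_within_open[where S = "{0<..}"]) (use z in \<open>auto simp: CH_kernel_def\<close>)
  then show "deriv CH_kernel z = - exp (- z) / 2" by (rule DERIV_imp_deriv)
next
  assume z: "z < 0"
  have "((\<lambda>z. exp z / 2) has_real_derivative exp z / 2) (at z)"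
    by (auto intro!: derivative_eq_intros)
  then have "(CH_kernel has_real_derivative exp z / 2) (at z)"
    by (rule has_field_derivative_transform_within_open[where S = "{..<0}"]) (use z in \<open>auto simp: CH_kernel_def\<close>)
  then show "deriv CH_kernel z = exp z / 2" by (rule DERIV_imp_deriv)
qed

lemma (in bounded_continuous) convolution_deriv_CH_kernel:
  "Defs.convolution (deriv CH_kernel) F x = (exp_avg F x - exp_avg (\<lambda>z. F (- z)) (- x)) / 2"
proof -
  interpret r: bounded_continuous "\<lambda>z. F (- z)" K by (rule reflected)
  let ?a = "\<lambda>y. indicator {0..} (y - x) * exp (- (y - x)) * F (x + (y - x))"
  let ?b = "\<lambda>y. indicator {0..} (x - y) * exp (- (x - y)) * F (- (- x + (x - y)))"
  have a: "integrable lborel ?a" "(LINT y|lborel. ?a y) = exp_avg F x"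
    using lborel_integrable_real_affine[OF integrable[of x], of 1 "- x"]
      lborel_integral_real_affine[of 1 "\<lambda>z. indicator {0..} z * exp (- z) * F (x + z)" "- x"]
    by (simp_all add: exp_avg_def)
  have b: "integrable lborel ?b" "(LINT y|lborel. ?b y) = exp_avg (\<lambda>z. F (- z)) (- x)"
    using lborel_integrable_real_affine[OF r.integrable[of "- x"], of "-1" x]
      lborel_integral_real_affine[of "-1" "\<lambda>z. indicator {0..} z * exp (- z) * F (- (- x + z))" x]
    by (simp_all add: exp_avg_def)
  have "Defs.convolution (deriv CH_kernel) F x = (LINT y|lborel. (?a y - ?b y) / 2)"
    unfolding Defs.convolution_def
  proof (rule integral_cong_AE)
    have m: "(\<lambda>y. (?a y - ?b y) / 2) \<in> borel_measurable borel" by measurable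
    show "(\<lambda>y. (?a y - ?b y) / 2) \<in> borel_measurable lborel" using m by simp
    have eq: "deriv CH_kernel (x - y) * F y = (?a y - ?b y) / 2" if "y \<noteq> x" for y
      using that deriv_CH_kernel[of "x - y"] by (cases "x < y") (auto simp: indicator_def)
    show "AE y in lborel. deriv CH_kernel (x - y) * F y = (?a y - ?b y) / 2"
      using AE_lborel_singleton[of x] by eventually_elim (rule eq)
    have "(\<lambda>y. if y = x then deriv CH_kernel 0 * F x else (?a y - ?b y) / 2) \<in> borel_measurable borel"
      using m by measurable
    also have "(\<lambda>y. if y = x then deriv CH_kernel 0 * F x else (?a y - ?b y) / 2) = (\<lambda>y. deriv CH_kernel (x - y) * F y)"
      using eq by auto
    finally show "(\<lambda>y. deriv CH_kernel (x - y) * F y) \<in> borel_measurable lborel" by simp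
  qed
  also have "\<dots> = (exp_avg F x - exp_avg (\<lambda>z. F (- z)) (- x)) / 2"
    using a b by simp
  finally show ?thesis .
qed

lemma sobolev_diff: "f \<in> sobolev \<sigma> \<Longrightarrow> g \<in> sobolev \<sigma> \<Longrightarrow> (\<lambda>x. f x - g x) \<in> sobolev \<sigma>"
  using sobolev_lincomb[of f \<sigma> g 1 "-1"] by simp

lemma sobolev_scale: "f \<in> sobolev \<sigma> \<Longrightarrow> (\<lambda>x. f x / a) \<in> sobolev \<sigma>"
  using sobolev_lincomb[of f \<sigma> f "1 / a" 0] by simp

text \<open>
  The time derivative \<open>v\<close> is determined almost everywhere by the equation; its continuous
  representative \<open>V\<close> is continuously differentiable as \<open>u\<close> is $C^2$.  Embedding of $H^{s-1}$ in $C^1$,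
  with \<open>s - 1 > 3 / 2\<close>, turns the convergence of difference quotients in $H^{s-1}$ into uniform
  convergence for \<open>u\<close> and its space derivative.
\<close>

theorem strong_solution_lagrangian:
  fixes T s :: real and u \<eta> :: "real \<Rightarrow> real \<Rightarrow> real"
  assumes T: "T > 0" and s: "s > 5 / 2" and sol: "CH_strong_solution T s u" and flow: "is_flow T u \<eta>"
  obtains M where "CH_lagrangian T M u (\<lambda>t. deriv (u t)) (\<lambda>t. deriv (deriv (u t))) \<eta>"
proof -
  from sol obtain v where cont: "\<And>t. t \<in> {0..T} \<Longrightarrow> continuous_on UNIV (u t)"
    and C0: "C0_sobolev T s u" and C1: "C1_sobolev T (s - 1) u v"
    and eqn: "\<And>t. t \<in> {0..T} \<Longrightarrow> AE x in lborel. v t x + u t x * deriv (u t) x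
            + Defs.convolution (deriv CH_kernel) (\<lambda>y. (u t y)\<^sup>2 + (deriv (u t) y)\<^sup>2 / 2) x = 0"
    unfolding CH_strong_solution_def by blast
  have us: "u t \<in> sobolev s" if "t \<in> {0..T}" for t using C0 that by (auto simp: C0_sobolev_def)
  have lim0: "((\<lambda>r. sobolev_norm s (\<lambda>x. u r x - u t x)) \<longlongrightarrow> 0) (at t within {0..T})" if "t \<in> {0..T}" for t
    using C0 that by (auto simp: C0_sobolev_def)
  have us1: "u t \<in> sobolev (s - 1)" and vs1: "v t \<in> sobolev (s - 1)" if "t \<in> {0..T}" for t
    using C1 that by (auto simp: C1_sobolev_def C0_sobolev_def)
  have lim1: "((\<lambda>r. sobolev_norm (s - 1) (\<lambda>x. (u r x - u t x) / (r - t) - v t x)) \<longlongrightarrow> 0) (at t within {0..T})"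
    if "t \<in> {0..T}" for t
    using C1 that by (auto simp: C1_sobolev_def)
  have s1: "s > 1 / 2" "s > 3 / 2" "s - 1 > 1 / 2" "s - 1 > 3 / 2" using s by auto
  obtain Cb where Cb: "\<forall>f f0 x. f \<in> sobolev s \<longrightarrow> continuous_on UNIV f0 \<longrightarrow> (AE x in lborel. f x = f0 x) \<longrightarrow>
      (f0 has_real_derivative deriv f0 x) (at x) \<and> \<bar>deriv f0 x\<bar> \<le> Cb * sobolev_norm s f"
    using sobolev_embedding_C1[OF s1(2)] by blast
  have du: "(u t has_real_derivative deriv (u t) x) (at x)" if t: "t \<in> {0..T}" for t x
    using Cb[rule_format, OF us[OF t] cont[OF t]] by simp
  have ddu: "(deriv (u t) has_real_derivative deriv (deriv (u t)) x) (at x)"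
    and ddc: "continuous_on UNIV (deriv (deriv (u t)))" if t: "t \<in> {0..T}" for t x
    using sobolev_embedding_C2[OF s us[OF t] cont[OF t]] by auto
  obtain Ca where Ca: "\<forall>f f0 x. f \<in> sobolev s \<longrightarrow> continuous_on UNIV f0 \<longrightarrow> (AE x in lborel. f x = f0 x) \<longrightarrow>
      \<bar>f0 x\<bar> \<le> Ca * sobolev_norm s f"
    using sobolev_embedding_bounded[OF s1(1)] by blast
  obtain M1 where M1: "\<And>t x. t \<in> {0..T} \<Longrightarrow> \<bar>u t x\<bar> \<le> M1"
  proof (rule uniform_bound_on_interval[OF T, of u])
    fix t assume t: "t \<in> {0..T}"
    show "\<exists>B. \<forall>x. \<bar>u t x\<bar> \<le> B" using Ca[rule_format, OF us[OF t] cont[OF t]] by auto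
    show "\<exists>N. (N \<longlongrightarrow> 0) (at t within {0..T}) \<and> (\<forall>r\<in>{0..T}. \<forall>x. \<bar>u r x - u t x\<bar> \<le> N r)"
    proof (intro exI conjI ballI allI)
      show "((\<lambda>r. Ca * sobolev_norm s (\<lambda>x. u r x - u t x)) \<longlongrightarrow> 0) (at t within {0..T})"
        by (rule tendsto_mult_right_zero[OF lim0[OF t]])
      fix r x assume r: "r \<in> {0..T}"
      show "\<bar>u r x - u t x\<bar> \<le> Ca * sobolev_norm s (\<lambda>x. u r x - u t x)"
        using Ca[rule_format, of "\<lambda>x. u r x - u t x" "\<lambda>x. u r x - u t x" x]
          sobolev_diff[OF us[OF r] us[OF t]] continuous_on_diff[OF cont[OF r] cont[OF t]] by auto
    qed
  qed blast
  obtain M2 where M2: "\<And>t x. t \<in> {0..T} \<Longrightarrow> \<bar>deriv (u t) x\<bar> \<le> M2"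
  proof (rule uniform_bound_on_interval[OF T, of "\<lambda>t. deriv (u t)"])
    fix t assume t: "t \<in> {0..T}"
    show "\<exists>B. \<forall>x. \<bar>deriv (u t) x\<bar> \<le> B" using Cb[rule_format, OF us[OF t] cont[OF t]] by auto
    show "\<exists>N. (N \<longlongrightarrow> 0) (at t within {0..T}) \<and> (\<forall>r\<in>{0..T}. \<forall>x. \<bar>deriv (u r) x - deriv (u t) x\<bar> \<le> N r)"
    proof (intro exI conjI ballI allI)
      show "((\<lambda>r. Cb * sobolev_norm s (\<lambda>x. u r x - u t x)) \<longlongrightarrow> 0) (at t within {0..T})"
        by (rule tendsto_mult_right_zero[OF lim0[OF t]])
      fix r x assume r: "r \<in> {0..T}"
      have "deriv (\<lambda>x. u r x - u t x) x = deriv (u r) x - deriv (u t) x"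
        by (intro DERIV_imp_deriv DERIV_diff du r t)
      then show "\<bar>deriv (u r) x - deriv (u t) x\<bar> \<le> Cb * sobolev_norm s (\<lambda>x. u r x - u t x)"
        using Cb[rule_format, of "\<lambda>x. u r x - u t x" "\<lambda>x. u r x - u t x" x]
          sobolev_diff[OF us[OF r] us[OF t]] continuous_on_diff[OF cont[OF r] cont[OF t]] by auto
    qed
  qed blast
  \<comment> \<open>the maximum with 1 only ensures that the constant is positive\<close>
  define M where "M = max 1 (max M1 M2)"
  have "M1 \<le> M" "M2 \<le> M" by (auto simp: M_def)
  then have M: "M > 0" "\<And>t x. t \<in> {0..T} \<Longrightarrow> \<bar>u t x\<bar> \<le> M" "\<And>t x. t \<in> {0..T} \<Longrightarrow> \<bar>deriv (u t) x\<bar> \<le> M"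
    using order_trans[OF M1] order_trans[OF M2] by (auto simp: M_def)
  define F where "F t = (\<lambda>z. (u t z)\<^sup>2 + (deriv (u t) z)\<^sup>2 / 2)" for t
  define Jp where "Jp t x = exp_avg (F t) x" for t x
  define Jm where "Jm t x = exp_avg (\<lambda>z. F t (- z)) (- x)" for t x
  have dc: "continuous_on UNIV (deriv (u t))" if t: "t \<in> {0..T}" for t
    by (rule DERIV_continuous_on) (rule has_field_derivative_at_within[OF ddu[OF t]])
  have Fbc: "bounded_continuous (F t) (M\<^sup>2 + M\<^sup>2 / 2)" if t: "t \<in> {0..T}" for t
  proof
    show "continuous_on UNIV (F t)" unfolding F_def
      by (intro continuous_intros cont dc t) simp
    show "\<bar>F t x\<bar> \<le> M\<^sup>2 + M\<^sup>2 / 2" for x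
    proof -
      have "(u t x)\<^sup>2 \<le> M\<^sup>2" "(deriv (u t) x)\<^sup>2 \<le> M\<^sup>2"
        using M(2)[OF t, of x] M(3)[OF t, of x] M(1) by (auto simp: abs_le_square_iff[symmetric])
      then show ?thesis by (simp add: F_def)
    qed
  qed
  have dJp: "(Jp t has_real_derivative Jp t x - F t x) (at x)" if t: "t \<in> {0..T}" for t x
    unfolding Jp_def[abs_def] by (rule bounded_continuous.exp_avg_deriv[OF Fbc[OF t]])
  have dJm: "(Jm t has_real_derivative F t x - Jm t x) (at x)" if t: "t \<in> {0..T}" for t x
  proof -
    have neg: "(uminus has_real_derivative - 1) (at x)" by (rule derivative_eq_intros refl)+
    show ?thesis unfolding Jm_def[abs_def]
      by (rule DERIV_cong[OF DERIV_chain2[OF bounded_continuous.exp_avg_deriv[OF bounded_continuous.reflected[OF Fbc[OF t]]] neg]])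
         simp
  qed
  define V where "V t x = - (u t x * deriv (u t) x) + (Jm t x - Jp t x) / 2" for t x
  define V' where "V' t x = - ((deriv (u t) x)\<^sup>2 + u t x * deriv (deriv (u t)) x) + F t x - (Jm t x + Jp t x) / 2" for t x
  have dV: "(V t has_real_derivative V' t x) (at x)" if t: "t \<in> {0..T}" for t x
    unfolding V_def[abs_def]
    by (rule DERIV_cong[OF DERIV_add[OF DERIV_minus[OF DERIV_mult[OF du[OF t] ddu[OF t]]] DERIV_cdivide[OF DERIV_diff[OF dJm[OF t] dJp[OF t]]]]])
       (simp add: V'_def power2_eq_square field_simps)
  have contV: "continuous_on UNIV (V t)" if t: "t \<in> {0..T}" for t
    by (rule DERIV_continuous_on) (rule has_field_derivative_at_within[OF dV[OF t]])
  have contV': "isCont (V' t) x" if t: "t \<in> {0..T}" for t x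
  proof -
    have "isCont (deriv (deriv (u t))) x" using ddc[OF t] by (simp add: continuous_on_eq_continuous_at)
    moreover have "isCont (F t) x" using bounded_continuous.cont[OF Fbc[OF t]] by (simp add: continuous_on_eq_continuous_at)
    ultimately show ?thesis unfolding V'_def[abs_def]
      by (intro continuous_intros DERIV_isCont[OF du[OF t]] DERIV_isCont[OF ddu[OF t]]
          DERIV_isCont[OF dJm[OF t]] DERIV_isCont[OF dJp[OF t]]) auto
  qed
  have vV: "AE x in lborel. v t x = V t x" if t: "t \<in> {0..T}" for t
    using eqn[OF t]
  proof eventually_elim
    case (elim x)
    then show ?case
      unfolding F_def[of t, symmetric] bounded_continuous.convolution_deriv_CH_kernel[OF Fbc[OF t]]
      by (simp add: V_def Jp_def Jm_def field_simps)
  qed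
  obtain Cc where Cc: "\<forall>f f0 x. f \<in> sobolev (s - 1) \<longrightarrow> continuous_on UNIV f0 \<longrightarrow> (AE x in lborel. f x = f0 x) \<longrightarrow>
      \<bar>f0 x\<bar> \<le> Cc * sobolev_norm (s - 1) f"
    using sobolev_embedding_bounded[OF s1(3)] by blast
  obtain Cd where Cd: "\<forall>f f0 x. f \<in> sobolev (s - 1) \<longrightarrow> continuous_on UNIV f0 \<longrightarrow> (AE x in lborel. f x = f0 x) \<longrightarrow>
      (f0 has_real_derivative deriv f0 x) (at x) \<and> \<bar>deriv f0 x\<bar> \<le> Cd * sobolev_norm (s - 1) f"
    using sobolev_embedding_C1[OF s1(4)] by blast
  define N where "N t r = sobolev_norm (s - 1) (\<lambda>x. (u r x - u t x) / (r - t) - v t x)" for t r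
  have quot: "\<bar>(u r x - u t x) / (r - t) - V t x\<bar> \<le> Cc * N t r"
    and quot': "\<bar>(deriv (u r) x - deriv (u t) x) / (r - t) - V' t x\<bar> \<le> Cd * N t r"
    if t: "t \<in> {0..T}" and r: "r \<in> {0..T}" "r \<noteq> t" for t r x
  proof -
    let ?f = "\<lambda>x. (u r x - u t x) / (r - t) - v t x"
    let ?g = "\<lambda>x. (u r x - u t x) / (r - t) - V t x"
    have f: "?f \<in> sobolev (s - 1)"
      by (intro sobolev_diff sobolev_scale us1 vs1 t r)
    have f0: "continuous_on UNIV ?g"
      using r by (intro continuous_intros cont contV t) auto
    have ae: "AE x in lborel. ?f x = ?g x"
      using vV[OF t] by eventually_elim simp
    show "\<bar>(u r x - u t x) / (r - t) - V t x\<bar> \<le> Cc * N t r"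
      using Cc[rule_format, OF f f0 ae] by (simp add: N_def)
    have "deriv ?g x = (deriv (u r) x - deriv (u t) x) / (r - t) - V' t x"
      by (intro DERIV_imp_deriv DERIV_diff DERIV_cdivide du dV r t)
    then show "\<bar>(deriv (u r) x - deriv (u t) x) / (r - t) - V' t x\<bar> \<le> Cd * N t r"
      using Cd[rule_format, OF f f0 ae, of x] by (simp add: N_def)
  qed
  have N0: "((\<lambda>r. C * N t r) \<longlongrightarrow> 0) (at t within {0..T})" if "t \<in> {0..T}" for t C
    unfolding N_def by (rule tendsto_mult_right_zero[OF lim1[OF that]])
  have dflow: "((\<lambda>r. \<eta> x r) has_real_derivative u t (\<eta> x t)) (at t within {0..T})" if "t \<in> {0..T}" for t x
    using flow that by (auto simp: is_flow_def)
  have Jp: "exp_avg (\<lambda>z. (u t z)\<^sup>2 + (deriv (u t) z)\<^sup>2 / 2) x = Jp t x"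
    and Jm: "exp_avg (\<lambda>z. (u t (- z))\<^sup>2 + (deriv (u t) (- z))\<^sup>2 / 2) (- x) = Jm t x" for t x
    by (simp_all add: Jp_def Jm_def F_def)
  have "CH_lagrangian T M u (\<lambda>t. deriv (u t)) (\<lambda>t. deriv (deriv (u t))) \<eta>"
  proof (unfold_locales, unfold Jp Jm)
    show "\<eta> x 0 = x" for x using flow by (auto simp: is_flow_def)
  next
    fix t x assume t: "t \<in> {0..T}"
    show "((\<lambda>r. u r (\<eta> x r)) has_real_derivative (Jm t (\<eta> x t) - Jp t (\<eta> x t)) / 2) (at t within {0..T})"
      by (rule DERIV_cong[OF deriv_along_curve[OF quot[OF t] N0[OF t] DERIV_isCont[OF dV[OF t]] du[OF t] dflow[OF t]]])
         (simp_all add: V_def)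
    show "((\<lambda>r. deriv (u r) (\<eta> x r)) has_real_derivative
        (u t (\<eta> x t))\<^sup>2 - (deriv (u t) (\<eta> x t))\<^sup>2 / 2 - (Jm t (\<eta> x t) + Jp t (\<eta> x t)) / 2) (at t within {0..T})"
      by (rule DERIV_cong[OF deriv_along_curve[OF quot'[OF t] N0[OF t] contV'[OF t] ddu[OF t] dflow[OF t]]])
         (simp_all add: V'_def F_def power2_eq_square)
    have "((\<lambda>r. u r x) has_real_derivative V t x + deriv (u t) x * 0) (at t within {0..T})"
      by (rule deriv_along_curve[where \<gamma> = "\<lambda>_. x", OF quot[OF t] N0[OF t] DERIV_isCont[OF dV[OF t]] du[OF t] DERIV_const])
    then show "((\<lambda>r. u r x) has_real_derivative - (u t x * deriv (u t) x) + (Jm t x - Jp t x) / 2) (at t within {0..T})"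
      by (simp add: V_def)
  qed (use T M du ddu dflow in auto)
  then show ?thesis by (rule that)
qed

section \<open>Exponential tails on both sides\<close>

text \<open>
  The properties that the coefficient at \<open>+\<infinity>\<close> of a solution and that of its reflection share.
\<close>

definition tail_coefficient :: "real \<Rightarrow> (real \<Rightarrow> real \<Rightarrow> real) \<Rightarrow> (real \<Rightarrow> real) \<Rightarrow> bool" where
  "tail_coefficient T u c \<longleftrightarrow> continuous_on {0<..T} c \<and> (\<forall>t\<in>{0<..T}. c t > 0) \<and>
     strict_mono_on {0<..T} c \<and>
     (\<forall>t\<in>{0<..T}. ((\<lambda>x. exp x * u t x) \<longlongrightarrow> c t) at_top)"

context CH_lagrangian
begin

text \<open>
  Decay near \<open>+\<infinity>\<close> suffices, because boundedness gives the inequalities elsewhere with a larger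
  constant.
\<close>

lemma decaying_intro:
  assumes \<kappa>: "\<kappa> > 1" and nz: "\<exists>x. u 0 x \<noteq> 0"
    and decay: "\<And>x. x \<ge> X \<Longrightarrow> \<bar>u 0 x\<bar> \<le> A * exp (- \<kappa> * x) \<and> \<bar>ux 0 x\<bar> \<le> A * exp (- \<kappa> * x)"
  obtains A' where "CH_decaying T M u ux uxx \<eta> A' \<kappa>"
proof -
  let ?A = "max A (M * exp (\<kappa> * X))"
  have large: "a \<le> ?A * exp (- \<kappa> * x)" if "a \<le> M" "x \<ge> X \<Longrightarrow> a \<le> A * exp (- \<kappa> * x)" for a x
  proof (cases "x \<ge> X")
    case True
    have "A * exp (- \<kappa> * x) \<le> ?A * exp (- \<kappa> * x)" by (intro mult_right_mono) auto
    with that(2)[OF True] show ?thesis by linarith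
  next
    case False
    then have "\<kappa> * x \<le> \<kappa> * X" using \<kappa> by (intro mult_left_mono) auto
    then have "M * 1 \<le> M * (exp (\<kappa> * X) * exp (- \<kappa> * x))"
      using M by (intro mult_left_mono) (auto simp: mult_exp_exp)
    also have "\<dots> \<le> ?A * exp (- \<kappa> * x)"
      unfolding mult.assoc[symmetric] by (intro mult_right_mono) auto
    finally show ?thesis using that(1) by simp
  qed
  have "CH_decaying T M u ux uxx \<eta> ?A \<kappa>"
  proof (intro CH_decaying.intro CH_decaying_axioms.intro)
    show "CH_lagrangian T M u ux uxx \<eta>" by unfold_locales
    fix x
    show "\<bar>u 0 x\<bar> \<le> ?A * exp (- \<kappa> * x)"
      by (rule large) (use u_le[of 0 x] T decay[of x] in \<open>simp, blast\<close>)
    show "\<bar>ux 0 x\<bar> \<le> ?A * exp (- \<kappa> * x)"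
      by (rule large) (use ux_le[of 0 x] T decay[of x] in \<open>simp, blast\<close>)
  qed (use \<kappa> nz in auto)
  then show ?thesis by (rule that)
qed

end

lemma (in CH_decaying) tail_coefficient_c: "tail_coefficient T u c"
  unfolding tail_coefficient_def
proof (intro conjI ballI)
  show "continuous_on {0<..T} c" by (rule continuous_on_subset[OF c_continuous]) auto
  show "strict_mono_on {0<..T} c" by (auto intro!: strict_mono_onI c_strict_mono)
qed (use c_pos c_limit in auto)

lemma bigo_exp_abs_iff:
  "f \<in> O[at_infinity](\<lambda>x. exp (- k * \<bar>x\<bar>)) \<longleftrightarrow>
    (\<exists>C X. \<forall>x::real. \<bar>x\<bar> \<ge> X \<longrightarrow> \<bar>f x :: real\<bar> \<le> C * exp (- k * \<bar>x\<bar>))"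
proof
  assume "f \<in> O[at_infinity](\<lambda>x. exp (- k * \<bar>x\<bar>))"
  then obtain C where "eventually (\<lambda>x. norm (f x) \<le> C * norm (exp (- k * \<bar>x\<bar>))) at_infinity"
    by (elim landau_o.bigE) auto
  then show "\<exists>C X. \<forall>x. \<bar>x\<bar> \<ge> X \<longrightarrow> \<bar>f x\<bar> \<le> C * exp (- k * \<bar>x\<bar>)"
    unfolding eventually_at_infinity by auto
next
  assume "\<exists>C X. \<forall>x. \<bar>x\<bar> \<ge> X \<longrightarrow> \<bar>f x\<bar> \<le> C * exp (- k * \<bar>x\<bar>)"
  then obtain C X where "\<forall>x. \<bar>x\<bar> \<ge> X \<longrightarrow> \<bar>f x\<bar> \<le> C * exp (- k * \<bar>x\<bar>)" by blast
  then show "f \<in> O[at_infinity](\<lambda>x. exp (- k * \<bar>x\<bar>))"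
    by (intro bigoI[where c = C]) (auto simp: eventually_at_infinity)
qed

context CH_lagrangian
begin

lemma signed_coefficients:
  assumes "tail_coefficient T u cp" "tail_coefficient T (\<lambda>t x. - u t (- x)) cm"
  shows "signed_monotone_coeffs T cp (\<lambda>t. - cm t)"
    and "\<forall>t\<in>{0<..T}. ((\<lambda>x. exp x * u t x) \<longlongrightarrow> cp t) at_top \<and>
           ((\<lambda>x. exp (- x) * u t x) \<longlongrightarrow> - cm t) at_bot"
proof -
  show "signed_monotone_coeffs T cp (\<lambda>t. - cm t)"
    unfolding signed_monotone_coeffs_def
  proof (intro conjI ballI)
    show "continuous_on {0<..T} cp" "continuous_on {0<..T} (\<lambda>t. - cm t)" "strict_mono_on {0<..T} cp"
      using assms by (auto simp: tail_coefficient_def intro: continuous_on_minus)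
    show "strict_antimono_on {0<..T} (\<lambda>t. - cm t)"
    proof (rule monotone_onI)
      fix r t assume "r \<in> {0<..T}" "t \<in> {0<..T}" "r < t"
      moreover have "strict_mono_on {0<..T} cm" using assms by (simp add: tail_coefficient_def)
      ultimately show "- cm t < - cm r" using strict_mono_onD[of "{0<..T}" cm r t] by simp
    qed
  qed (use assms in \<open>auto simp: tail_coefficient_def\<close>)
  show "\<forall>t\<in>{0<..T}. ((\<lambda>x. exp x * u t x) \<longlongrightarrow> cp t) at_top \<and>
           ((\<lambda>x. exp (- x) * u t x) \<longlongrightarrow> - cm t) at_bot"
  proof
    fix t assume t: "t \<in> {0<..T}"
    have "((\<lambda>x. exp x * - u t (- x)) \<longlongrightarrow> cm t) at_top"
      using assms(2) t unfolding tail_coefficient_def by blast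
    from tendsto_minus[OF this]
    have "((\<lambda>x. exp (- (- x)) * u t (- x)) \<longlongrightarrow> - cm t) at_top"
      by simp
    then have "((\<lambda>x. exp (- x) * u t x) \<longlongrightarrow> - cm t) at_bot"
      unfolding filterlim_at_bot_mirror .
    moreover have "((\<lambda>x. exp x * u t x) \<longlongrightarrow> cp t) at_top"
      using assms(1) t unfolding tail_coefficient_def by blast
    ultimately show "((\<lambda>x. exp x * u t x) \<longlongrightarrow> cp t) at_top \<and>
           ((\<lambda>x. exp (- x) * u t x) \<longlongrightarrow> - cm t) at_bot" by blast
  qed
qed

lemma asymptotics_of_decaying_data:
  assumes \<kappa>: "\<kappa> > 1" and nz: "\<exists>x. u 0 x \<noteq> 0"
    and u0: "u 0 \<in> O[at_infinity](\<lambda>x. exp (- \<kappa> * \<bar>x\<bar>))"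
    and ux0: "ux 0 \<in> O[at_infinity](\<lambda>x. exp (- \<kappa> * \<bar>x\<bar>))"
    and uxx0: "uxx 0 \<in> O[at_infinity](\<lambda>x. exp (- \<kappa> * \<bar>x\<bar>))"
  shows "\<exists>cp cm. tail_coefficient T u cp \<and> tail_coefficient T (\<lambda>t x. - u t (- x)) cm"
    and "\<forall>t\<in>{0<..T}. (\<lambda>x. u t x - uxx t x) \<in> O[at_infinity](\<lambda>x. exp (- \<kappa> * \<bar>x\<bar>))"
proof -
  interpret m: CH_lagrangian T M "\<lambda>t x. - u t (- x)" "\<lambda>t x. ux t (- x)" "\<lambda>t x. - uxx t (- x)" "\<lambda>x t. - \<eta> (- x) t"
    by (rule reflected)
  obtain C1 X1 where 1: "\<forall>x. \<bar>x\<bar> \<ge> X1 \<longrightarrow> \<bar>u 0 x\<bar> \<le> C1 * exp (- \<kappa> * \<bar>x\<bar>)"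
    using u0 unfolding bigo_exp_abs_iff by blast
  obtain C2 X2 where 2: "\<forall>x. \<bar>x\<bar> \<ge> X2 \<longrightarrow> \<bar>ux 0 x\<bar> \<le> C2 * exp (- \<kappa> * \<bar>x\<bar>)"
    using ux0 unfolding bigo_exp_abs_iff by blast
  obtain C3 X3 where 3: "\<forall>x. \<bar>x\<bar> \<ge> X3 \<longrightarrow> \<bar>uxx 0 x\<bar> \<le> C3 * exp (- \<kappa> * \<bar>x\<bar>)"
    using uxx0 unfolding bigo_exp_abs_iff by blast
  define X where "X = max 0 (max X1 (max X2 X3))"
  define C where "C = max C1 (max C2 C3)"
  have weaken: "a \<le> C * exp (- \<kappa> * x)" if "a \<le> c * exp (- \<kappa> * x)" "c \<le> C" for a c x
  proof -
    have "c * exp (- \<kappa> * x) \<le> C * exp (- \<kappa> * x)" using that(2) by (intro mult_right_mono) auto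
    with that(1) show ?thesis by linarith
  qed
  let ?small = "\<lambda>x y. \<bar>u 0 y\<bar> \<le> C * exp (- \<kappa> * x) \<and> \<bar>ux 0 y\<bar> \<le> C * exp (- \<kappa> * x)
      \<and> \<bar>uxx 0 y\<bar> \<le> C * exp (- \<kappa> * x)"
  have d: "?small x x"
    "?small x (- x)"
    if "x \<ge> X" for x
  proof -
    have x: "x \<ge> 0" "x \<ge> X1" "x \<ge> X2" "x \<ge> X3" using that by (auto simp: X_def)
    have c: "C1 \<le> C" "C2 \<le> C" "C3 \<le> C" by (auto simp: C_def)
    have r: "\<bar>u 0 x\<bar> \<le> C1 * exp (- \<kappa> * x)" "\<bar>ux 0 x\<bar> \<le> C2 * exp (- \<kappa> * x)" "\<bar>uxx 0 x\<bar> \<le> C3 * exp (- \<kappa> * x)"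
      and l: "\<bar>u 0 (- x)\<bar> \<le> C1 * exp (- \<kappa> * x)" "\<bar>ux 0 (- x)\<bar> \<le> C2 * exp (- \<kappa> * x)" "\<bar>uxx 0 (- x)\<bar> \<le> C3 * exp (- \<kappa> * x)"
      using 1[rule_format, of x] 2[rule_format, of x] 3[rule_format, of x]
        1[rule_format, of "- x"] 2[rule_format, of "- x"] 3[rule_format, of "- x"] x by simp_all
    show "?small x x"
      using weaken[OF r(1) c(1)] weaken[OF r(2) c(2)] weaken[OF r(3) c(3)] by (intro conjI)
    show "?small x (- x)"
      using weaken[OF l(1) c(1)] weaken[OF l(2) c(2)] weaken[OF l(3) c(3)] by (intro conjI)
  qed
  obtain A where "CH_decaying T M u ux uxx \<eta> A \<kappa>"
    by (rule decaying_intro[OF \<kappa> nz, of X C]) (use d in auto)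
  then interpret p: CH_decaying T M u ux uxx \<eta> A \<kappa> .
  have nz': "\<exists>x. - u 0 (- x) \<noteq> 0" using nz by (metis minus_minus neg_equal_0_iff_equal)
  obtain A' where "CH_decaying T M (\<lambda>t x. - u t (- x)) (\<lambda>t x. ux t (- x)) (\<lambda>t x. - uxx t (- x)) (\<lambda>x t. - \<eta> (- x) t) A' \<kappa>"
    by (rule m.decaying_intro[OF \<kappa> nz', of X C]) (use d in auto)
  then interpret n: CH_decaying T M "\<lambda>t x. - u t (- x)" "\<lambda>t x. ux t (- x)" "\<lambda>t x. - uxx t (- x)" "\<lambda>x t. - \<eta> (- x) t" A' \<kappa> .
  show "\<exists>cp cm. tail_coefficient T u cp \<and> tail_coefficient T (\<lambda>t x. - u t (- x)) cm"
    using p.tail_coefficient_c n.tail_coefficient_c by blast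
  show "\<forall>t\<in>{0<..T}. (\<lambda>x. u t x - uxx t x) \<in> O[at_infinity](\<lambda>x. exp (- \<kappa> * \<bar>x\<bar>))"
  proof
    fix t assume "t \<in> {0<..T}"
    then have t: "t \<in> {0..T}" by auto
    have i1: "\<bar>ux 0 x + uxx 0 x\<bar> \<le> 2 * C * exp (- \<kappa> * x)" if "x \<ge> X" for x
      using d(1)[OF that] by linarith
    have i2: "\<bar>ux 0 (- x) + - uxx 0 (- x)\<bar> \<le> 2 * C * exp (- \<kappa> * x)" if "x \<ge> X" for x
      using d(2)[OF that] by linarith
    obtain D1 where D1: "\<forall>z\<ge>X + M * T. \<bar>u t z - uxx t z\<bar> \<le> D1 * exp (- \<kappa> * z)"
      using p.h_decay[OF t i1] by blast
    obtain D2 where D2: "\<forall>z\<ge>X + M * T. \<bar>- u t (- z) - - uxx t (- z)\<bar> \<le> D2 * exp (- \<kappa> * z)"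
      using n.h_decay[OF t i2] by blast
    have "\<bar>u t x - uxx t x\<bar> \<le> max D1 D2 * exp (- \<kappa> * \<bar>x\<bar>)" if x: "\<bar>x\<bar> \<ge> X + M * T" for x
    proof (cases "x \<ge> 0")
      case True
      then have "\<bar>u t x - uxx t x\<bar> \<le> D1 * exp (- \<kappa> * \<bar>x\<bar>)" using D1 x by simp
      also have "\<dots> \<le> max D1 D2 * exp (- \<kappa> * \<bar>x\<bar>)" by (intro mult_right_mono) auto
      finally show ?thesis .
    next
      case False
      then have "\<bar>u t x - uxx t x\<bar> \<le> D2 * exp (- \<kappa> * \<bar>x\<bar>)"
        using D2[rule_format, of "- x"] x by (simp add: abs_minus_commute)
      also have "\<dots> \<le> max D1 D2 * exp (- \<kappa> * \<bar>x\<bar>)" by (intro mult_right_mono) auto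
      finally show ?thesis .
    qed
    then show "(\<lambda>x. u t x - uxx t x) \<in> O[at_infinity](\<lambda>x. exp (- \<kappa> * \<bar>x\<bar>))"
      unfolding bigo_exp_abs_iff by blast
  qed
qed

lemma tail_identification:
  assumes c: "tail_coefficient T u c" and t: "t \<in> {0<..T}" and zero: "\<And>x. x > b \<Longrightarrow> u 0 x = 0"
    and x: "x > \<eta> b t"
  shows "u t x = c t * exp (- x)"
proof -
  have t': "t \<in> {0..T}" using t by auto
  obtain k where k: "\<forall>x>\<eta> b t. u t x = k * exp (- x)"
    using exponential_tail[OF t' zero] by blast
  have "((\<lambda>x. exp x * u t x) \<longlongrightarrow> k) at_top"
  proof (rule tendsto_eventually)
    show "\<forall>\<^sub>F x in at_top. exp x * u t x = k"
      using eventually_gt_at_top[of "\<eta> b t"]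
      by eventually_elim (simp add: k exp_minus)
  qed
  moreover have "((\<lambda>x. exp x * u t x) \<longlongrightarrow> c t) at_top" using c t by (auto simp: tail_coefficient_def)
  ultimately have "k = c t" using tendsto_unique[OF trivial_limit_at_top_linorder] by blast
  with k x show ?thesis by simp
qed

text \<open>
  A compactly supported datum decays at every rate; the rate \<open>2\<close> is an arbitrary choice above \<open>1\<close>.
  The constants of the exponential tails are then identified through their limits.
\<close>

lemma exterior_of_compact_data:
  assumes nz: "\<exists>x. u 0 x \<noteq> 0" and supp: "\<And>x. x \<notin> {a..b} \<Longrightarrow> u 0 x = 0"
  shows "\<exists>cp cm. (\<forall>t\<in>{0<..T}. (\<forall>x. x > \<eta> b t \<longrightarrow> u t x = cp t * exp (- x)) \<and>
                        (\<forall>x. x < \<eta> a t \<longrightarrow> u t x = cm t * exp x)) \<and>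
           signed_monotone_coeffs T cp cm"
proof -
  interpret m: CH_lagrangian T M "\<lambda>t x. - u t (- x)" "\<lambda>t x. ux t (- x)" "\<lambda>t x. - uxx t (- x)" "\<lambda>x t. - \<eta> (- x) t"
    by (rule reflected)
  have T0: "0 \<in> {0..T}" using T by simp
  have op: "open (- {a..b})" by (intro open_Compl closed_atLeastAtMost)
  have ux0: "ux 0 x = 0" if "x \<in> - {a..b}" for x
    by (rule ux_zero[OF T0 op that]) (use supp in auto)
  have uxx0: "uxx 0 x = 0" if "x \<in> - {a..b}" for x
  proof -
    have "(ux 0 has_real_derivative 0) (at x)"
      by (rule has_field_derivative_transform_within_open[where f = "\<lambda>_. 0" and S = "- {a..b}"])
         (use op that ux0 in auto)
    then show ?thesis using DERIV_unique[OF deriv_ux[OF T0]] by blast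
  qed
  have O: "f \<in> O[at_infinity](\<lambda>x. exp (- 2 * \<bar>x\<bar>))" if f: "\<And>x. x \<in> - {a..b} \<Longrightarrow> f x = 0" for f :: "real \<Rightarrow> real"
    unfolding bigo_exp_abs_iff
  proof (intro exI allI impI)
    fix x assume "max \<bar>a\<bar> \<bar>b\<bar> + 1 \<le> \<bar>x\<bar>"
    then have "x \<in> - {a..b}" by auto
    then show "\<bar>f x\<bar> \<le> 1 * exp (- 2 * \<bar>x\<bar>)" by (simp add: f)
  qed
  obtain cp cm where c: "tail_coefficient T u cp" "tail_coefficient T (\<lambda>t x. - u t (- x)) cm"
    using asymptotics_of_decaying_data(1)[of 2, OF _ nz O O O] supp ux0 uxx0 by auto
  have right: "u t x = cp t * exp (- x)" if "t \<in> {0<..T}" "x > \<eta> b t" for t x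
    by (rule tail_identification[OF c(1) that(1) _ that(2)]) (use supp in auto)
  have left: "u t x = - cm t * exp x" if "t \<in> {0<..T}" "x < \<eta> a t" for t x
  proof -
    have "- u t (- (- x)) = cm t * exp (- (- x))"
      by (rule m.tail_identification[OF c(2) that(1), of "- a"]) (use supp that(2) in auto)
    then show ?thesis by simp
  qed
  show ?thesis
  proof (rule exI[of _ cp], rule exI[of _ "\<lambda>t. - cm t"], intro conjI ballI allI impI)
    show "signed_monotone_coeffs T cp (\<lambda>t. - cm t)" by (rule signed_coefficients(1)[OF c])
  qed (rule right left; assumption)+
qed

end

theorem theorem1p4:
  fixes T s :: real and u \<eta> :: "real \<Rightarrow> real \<Rightarrow> real"
  assumes "T > 0" and "s > 5 / 2"
    and "CH_strong_solution T s u"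
    and "\<exists>x. u 0 x \<noteq> 0"
    and "is_flow T u \<eta>"
  shows
    "(\<forall>a b. closure {x. u 0 x \<noteq> 0} \<subseteq> {a..b} \<longrightarrow>
        (\<exists>cp cm. 
           (\<forall>t\<in>{0<..T}. (\<forall>x. x > \<eta> b t \<longrightarrow> u t x = cp t * exp (- x)) \<and>
                        (\<forall>x. x < \<eta> a t \<longrightarrow> u t x = cm t * exp x)) \<and>
           signed_monotone_coeffs T cp cm)) \<and>
     (\<forall>\<mu>>0. (\<forall>j\<in>{0,1,2}. (deriv ^^ j) (u 0) \<in> O[at_infinity](\<lambda>x. exp (- (1 + \<mu>) * \<bar>x\<bar>))) \<longrightarrow>
        (\<forall>t\<in>{0<..T}. (\<lambda>x. u t x - (deriv ^^ 2) (u t) x) \<in> O[at_infinity](\<lambda>x. exp (- (1 + \<mu>) * \<bar>x\<bar>))) \<and>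
        (\<exists>cp cm.
           (\<forall>t\<in>{0<..T}. ((\<lambda>x. exp x * u t x) \<longlongrightarrow> cp t) at_top \<and>
                        ((\<lambda>x. exp (- x) * u t x) \<longlongrightarrow> cm t) at_bot) \<and>
           signed_monotone_coeffs T cp cm))"
proof -
  obtain M where "CH_lagrangian T M u (\<lambda>t. deriv (u t)) (\<lambda>t. deriv (deriv (u t))) \<eta>"
    by (rule strong_solution_lagrangian[OF assms(1-3,5)])
  then interpret CH_lagrangian T M u "\<lambda>t. deriv (u t)" "\<lambda>t. deriv (deriv (u t))" \<eta> .
  have d2: "(deriv ^^ 2) f = deriv (deriv f)" for f :: "real \<Rightarrow> real"
    by (simp add: numeral_2_eq_2)
  show ?thesis
  proof (intro conjI allI impI)
    fix a b assume "closure {x. u 0 x \<noteq> 0} \<subseteq> {a..b}"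
    then have "u 0 x = 0" if "x \<notin> {a..b}" for x
      using that closure_subset[of "{x. u 0 x \<noteq> 0}"] by auto
    then show "\<exists>cp cm. (\<forall>t\<in>{0<..T}. (\<forall>x. x > \<eta> b t \<longrightarrow> u t x = cp t * exp (- x)) \<and>
                        (\<forall>x. x < \<eta> a t \<longrightarrow> u t x = cm t * exp x)) \<and>
           signed_monotone_coeffs T cp cm"
      by (rule exterior_of_compact_data[OF assms(4)])
  next
    fix \<mu> :: real
    assume \<mu>: "\<mu> > 0"
      and "\<forall>j\<in>{0,1,2}. (deriv ^^ j) (u 0) \<in> O[at_infinity](\<lambda>x. exp (- (1 + \<mu>) * \<bar>x\<bar>))"
    then have O: "u 0 \<in> O[at_infinity](\<lambda>x. exp (- (1 + \<mu>) * \<bar>x\<bar>))"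
      "deriv (u 0) \<in> O[at_infinity](\<lambda>x. exp (- (1 + \<mu>) * \<bar>x\<bar>))"
      "deriv (deriv (u 0)) \<in> O[at_infinity](\<lambda>x. exp (- (1 + \<mu>) * \<bar>x\<bar>))"
      by (simp_all add: d2)
    have \<kappa>: "1 + \<mu> > 1" using \<mu> by simp
    note * = asymptotics_of_decaying_data[OF \<kappa> assms(4) O]
    show "\<forall>t\<in>{0<..T}. (\<lambda>x. u t x - (deriv ^^ 2) (u t) x) \<in> O[at_infinity](\<lambda>x. exp (- (1 + \<mu>) * \<bar>x\<bar>))"
      unfolding d2 by (rule *(2))
    obtain cp cm where c: "tail_coefficient T u cp" "tail_coefficient T (\<lambda>t x. - u t (- x)) cm"
      using *(1) by blast
    show "\<exists>cp cm. (\<forall>t\<in>{0<..T}. ((\<lambda>x. exp x * u t x) \<longlongrightarrow> cp t) at_top \<and>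
                        ((\<lambda>x. exp (- x) * u t x) \<longlongrightarrow> cm t) at_bot) \<and>
           signed_monotone_coeffs T cp cm"
      by (rule exI[of _ cp], rule exI[of _ "\<lambda>t. - cm t"],
          rule conjI[OF signed_coefficients(2)[OF c] signed_coefficients(1)[OF c]])
  qed
qed

end
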